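(* For any $\varepsilon\in(0,1)$ and $p\in[1,2]$ there exists a randomized fully scalable MPC algorithm with the following guarantees. It receives as input a multiset $X=\{x_1,\dots,x_n\}\subset\mathbb{R}^d$ distributed across $m$ machines, each with local memory $s$ of at least $d n^{\alpha}\cdot\mathrm{poly}(1/\varepsilon)$ words for some $\alpha\in(0,1]$. After $O_\alpha(1)$ rounds of communication, each machine can compute, for every point $x_i$ in its memory, a (randomized) assignment $\mathbf{z}_i\in\{(1,0),(0,1)\}$ such that $$\mathbb{E}[f(\mathbf{z})]\le\min_{\substack{z\in\{0,1\}^{n\times\{0,1\}}\\ z_i\ne(0,0)}} f(z)+\varepsilon\sum_{i=1}^n\sum_{j=1}^n \|x_i-x_j\|_p,$$ where the expectation is over the internal randomness of the algorithm. The total space used is $O(nd)\cdot\mathrm{poly}(\log(nd)/\varepsilon)$.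
   Context: Cuts are encoded as $z\in\{0,1\}^{n\times\{0,1\}}$ with rows $z_i\in\{(1,0),(0,1),(0,0)\}$ ($(1,0)$: 0-side, $(0,1)$: 1-side), and $f(z)=\frac12\sum_{i,j}\|x_i-x_j\|_p\,(z_{i,0}z_{j,0}+z_{i,1}z_{j,1})$. Minimizing $f$ over complete cuts is equivalent to maximizing the total $\ell_p$-distance across the cut. MPC model: the input is partitioned arbitrarily across $m$ machines, each with local memory $s$ words (a word has $O(\log(nd\Delta/\varepsilon))$ bits, $\Delta$ the aspect ratio); computation proceeds in synchronous rounds, in each of which every machine sends and receives at most $s$ words. Fully scalable means the algorithm works with $s=\Theta(n^\alpha d)$ words (up to the stated factors) for any constant $\alpha\in(0,1]$ and $m=\Theta(nd/s)$ machines; total space is $m\cdot s$. Duplicate points are treated as distinct points. *)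

theory Defs
  imports "HOL-Probability.Probability" "HOL-Probability.Product_PMF"
begin

section \<open>Cuts and their cost\<close>

text \<open>
  A point set in \<open>d\<close>-space is given by \<open>x i j\<close> for \<open>i < n\<close> and \<open>j < d\<close>.  Points are
  identified by their index, so equal points with different indices are distinct points.
\<close>

definition lp_dist :: "real \<Rightarrow> nat \<Rightarrow> (nat \<Rightarrow> real) \<Rightarrow> (nat \<Rightarrow> real) \<Rightarrow> real" where
  "lp_dist p d u v = (\<Sum>j<d. \<bar>u j - v j\<bar> powr p) powr (1 / p)"

text \<open>The row \<open>z i = (z\<^sub>i\<^sub>,\<^sub>0, z\<^sub>i\<^sub>,\<^sub>1)\<close> places point \<open>i\<close>; \<open>(0, 0)\<close> means unassigned.\<close>

type_synonym row = "nat \<times> nat"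

definition cuts :: "nat \<Rightarrow> (nat \<Rightarrow> row) set" where
  "cuts n = {..<n} \<rightarrow>\<^sub>E {(1, 0), (0, 1), (0, 0)}"

definition complete_cuts :: "nat \<Rightarrow> (nat \<Rightarrow> row) set" where
  "complete_cuts n = {z \<in> cuts n. \<forall>i<n. z i \<noteq> (0, 0)}"

definition cut_cost :: "real \<Rightarrow> nat \<Rightarrow> nat \<Rightarrow> (nat \<Rightarrow> nat \<Rightarrow> real) \<Rightarrow> (nat \<Rightarrow> row) \<Rightarrow> real" where
  "cut_cost p n d x z =
     1 / 2 * (\<Sum>i<n. \<Sum>j<n. lp_dist p d (x i) (x j) *
                real (fst (z i) * fst (z j) + snd (z i) * snd (z j)))"

text \<open>Only nonzero distances count; the ratio is 1 if all points coincide.\<close>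

definition aspect_ratio :: "real \<Rightarrow> nat \<Rightarrow> nat \<Rightarrow> (nat \<Rightarrow> nat \<Rightarrow> real) \<Rightarrow> real" where
  "aspect_ratio p n d x =
     (let D = {lp_dist p d (x i) (x j) | i j. i < n \<and> j < n \<and> lp_dist p d (x i) (x j) \<noteq> 0}
      in if D = {} then 1 else Max D / Min D)"


section \<open>Massively parallel computation\<close>

text \<open>
  A word is either an input coordinate or a number of bounded bit length.  Coordinates are
  arbitrary reals, so they are atomic: a machine may compute with those it holds, store
  and forward them, but may not create new ones.  Everything else it stores or sends consists
  of \<open>Bits v\<close> with \<open>v < 2 ^ w\<close>, where \<open>w\<close> is the word length.  This rules out
  packing many words into a single real number.
\<close>

datatype mpc_word = Coord real | Bits nat

definition legal_words :: "nat \<Rightarrow> mpc_word set \<Rightarrow> mpc_word list \<Rightarrow> bool" where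
  "legal_words w held us \<longleftrightarrow>
     (\<forall>u \<in> set us. case u of Coord c \<Rightarrow> u \<in> held | Bits v \<Rightarrow> v < 2 ^ w)"

record mpc_params =
  num_points :: nat
  dimension :: nat
  num_machines :: nat
  local_space :: nat
  word_length :: nat

text \<open>
  \<open>mpc_step A P t k mem inb\<close> is the randomized local computation of machine \<open>k\<close> in round
  \<open>t\<close> on its memory and the words received in the previous round.  It yields the new
  memory and, for each machine, the words to be sent to it.  After the last round,
  \<open>mpc_output A P k mem inb\<close> yields one row for each input point of machine \<open>k\<close>, in the
  order in which the points were given to that machine.
\<close>

record mpc_algorithm =
  mpc_rounds :: "mpc_params \<Rightarrow> nat"
  mpc_step :: "mpc_params \<Rightarrow> nat \<Rightarrow> nat \<Rightarrow> mpc_word list \<Rightarrow> mpc_word list \<Rightarrow>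
                 (mpc_word list \<times> (nat \<Rightarrow> mpc_word list)) pmf"
  mpc_output :: "mpc_params \<Rightarrow> nat \<Rightarrow> mpc_word list \<Rightarrow> mpc_word list \<Rightarrow> row list pmf"

text \<open>For each machine, its memory and the words it has just received.\<close>

type_synonym mpc_config = "nat \<Rightarrow> mpc_word list \<times> mpc_word list"

text \<open>
  \<open>pl k\<close> lists the indices of the points initially held by machine \<open>k\<close>.  The indices
  themselves are not revealed to the machines.
\<close>

definition valid_placement :: "mpc_params \<Rightarrow> (nat \<Rightarrow> nat list) \<Rightarrow> bool" where
  "valid_placement P pl \<longleftrightarrow>
     distinct (concat (map pl [0..<num_machines P])) \<and>
     set (concat (map pl [0..<num_machines P])) = {..<num_points P} \<and>
     (\<forall>k < num_machines P. dimension P * length (pl k) \<le> local_space P)"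

definition mpc_init ::
  "mpc_params \<Rightarrow> (nat \<Rightarrow> nat \<Rightarrow> real) \<Rightarrow> (nat \<Rightarrow> nat list) \<Rightarrow> mpc_config" where
  "mpc_init P x pl = (\<lambda>k.
     if k < num_machines P
     then (concat (map (\<lambda>i. map (\<lambda>j. Coord (x i j)) [0..<dimension P]) (pl k)), [])
     else ([], []))"

definition mpc_deliver ::
  "mpc_params \<Rightarrow> (nat \<Rightarrow> mpc_word list \<times> (nat \<Rightarrow> mpc_word list)) \<Rightarrow> mpc_config" where
  "mpc_deliver P r = (\<lambda>k.
     if k < num_machines P
     then (fst (r k), concat (map (\<lambda>i. snd (r i) k) [0..<num_machines P]))
     else ([], []))"

primrec mpc_run ::
  "mpc_algorithm \<Rightarrow> mpc_params \<Rightarrow> (nat \<Rightarrow> nat \<Rightarrow> real) \<Rightarrow> (nat \<Rightarrow> nat list) \<Rightarrow> nat \<Rightarrow> mpc_config pmf"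
where
  "mpc_run A P x pl 0 = return_pmf (mpc_init P x pl)"
| "mpc_run A P x pl (Suc t) =
     bind_pmf (mpc_run A P x pl t) (\<lambda>c.
       map_pmf (mpc_deliver P)
         (Pi_pmf {..<num_machines P} ([], \<lambda>_. [])
            (\<lambda>k. mpc_step A P t k (fst (c k)) (snd (c k)))))"

text \<open>A point for which its machine outputs no row counts as unassigned.\<close>

definition collect_rows ::
  "mpc_params \<Rightarrow> (nat \<Rightarrow> nat list) \<Rightarrow> (nat \<Rightarrow> row list) \<Rightarrow> nat \<Rightarrow> row" where
  "collect_rows P pl rs = (\<lambda>i.
     case map_of (concat (map (\<lambda>k. zip (pl k) (rs k)) [0..<num_machines P])) i of
       None \<Rightarrow> (0, 0) | Some r \<Rightarrow> r)"

definition mpc_outcome ::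
  "mpc_algorithm \<Rightarrow> mpc_params \<Rightarrow> (nat \<Rightarrow> nat \<Rightarrow> real) \<Rightarrow> (nat \<Rightarrow> nat list) \<Rightarrow> (nat \<Rightarrow> row) pmf"
where
  "mpc_outcome A P x pl =
     bind_pmf (mpc_run A P x pl (mpc_rounds A P)) (\<lambda>c.
       map_pmf (collect_rows P pl)
         (Pi_pmf {..<num_machines P} []
            (\<lambda>k. mpc_output A P k (fst (c k)) (snd (c k)))))"

text \<open>
  In every possible execution, each machine keeps, sends and receives at most
  \<open>local_space P\<close> words per round, and all words it keeps or sends are legal.
\<close>

definition respects_mpc_limits ::
  "mpc_algorithm \<Rightarrow> mpc_params \<Rightarrow> (nat \<Rightarrow> nat \<Rightarrow> real) \<Rightarrow> (nat \<Rightarrow> nat list) \<Rightarrow> bool" where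
  "respects_mpc_limits A P x pl \<longleftrightarrow>
     (\<forall>t \<le> mpc_rounds A P. \<forall>c \<in> set_pmf (mpc_run A P x pl t). \<forall>k < num_machines P.
        length (fst (c k)) \<le> local_space P \<and> length (snd (c k)) \<le> local_space P) \<and>
     (\<forall>t < mpc_rounds A P. \<forall>c \<in> set_pmf (mpc_run A P x pl t). \<forall>k < num_machines P.
        \<forall>(mem, out) \<in> set_pmf (mpc_step A P t k (fst (c k)) (snd (c k))).
          (\<Sum>l < num_machines P. length (out l)) \<le> local_space P \<and>
          legal_words (word_length P) (set (fst (c k)) \<union> set (snd (c k)))
            (mem @ concat (map out [0..<num_machines P])))"

definition total_space_le ::
  "mpc_algorithm \<Rightarrow> mpc_params \<Rightarrow> (nat \<Rightarrow> nat \<Rightarrow> real) \<Rightarrow> (nat \<Rightarrow> nat list) \<Rightarrow> real \<Rightarrow> bool" where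
  "total_space_le A P x pl b \<longleftrightarrow>
     (\<forall>t \<le> mpc_rounds A P. \<forall>c \<in> set_pmf (mpc_run A P x pl t).
        real (\<Sum>k < num_machines P. length (fst (c k)) + length (snd (c k))) \<le> b)"


section \<open>Resource bounds\<close>

text \<open>
  For arguments \<open>y \<ge> 1\<close>, a bound \<open>poly(y)\<close> is written as \<open>C * y ^ c\<close>.  Logarithms get an
  additive 1 so that the bounds do not degenerate for the smallest inputs.
\<close>

definition local_space_bound :: "real \<Rightarrow> nat \<Rightarrow> real \<Rightarrow> real \<Rightarrow> nat \<Rightarrow> nat \<Rightarrow> real" where
  "local_space_bound C c \<epsilon> \<alpha> n d = real d * real n powr \<alpha> * (C * (1 / \<epsilon>) ^ c)"

definition total_space_bound :: "real \<Rightarrow> nat \<Rightarrow> real \<Rightarrow> nat \<Rightarrow> nat \<Rightarrow> real" where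
  "total_space_bound C c \<epsilon> n d = C * (real n * real d) * ((1 + log 2 (real n * real d)) / \<epsilon>) ^ c"

definition word_length_bound :: "nat \<Rightarrow> real \<Rightarrow> nat \<Rightarrow> nat \<Rightarrow> real \<Rightarrow> nat" where
  "word_length_bound W \<epsilon> n d \<Delta> = W * nat \<lceil>1 + log 2 (real n * real d * \<Delta> / \<epsilon>)\<rceil>"

end

theory Submission
  imports Defs
begin

text \<open>
  Put \<open>D = \<Sum>\<^sub>i\<^sub>j d(i,j)\<close> and encode a cut by \<open>y\<^sub>i \<in> {-1, 1}\<close>. Then \<open>f = (D + Q y) / 4\<close> for the quadratic form
  \<open>Q y = \<Sum>\<^sub>i\<^sub>j d(i,j) y\<^sub>i y\<^sub>j\<close>. Its diagonal vanishes, so independent rounding of a fractional \<open>y\<close>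
  preserves \<open>Q\<close> in expectation.

  Pick a uniformly random point \<open>c\<close> and sample points with probability \<open>q\<close> proportional to their
  distance to \<open>c\<close> plus the average such distance. By the triangle inequality \<open>d(i,j) / (q\<^sub>i q\<^sub>j)\<close> is
  at most a multiple of \<open>n \<Sum>\<^sub>i d(i,c)\<close>, whose expectation is \<open>D\<close>. This makes the problem dense:
  \<open>Q\<close> is the expectation of a bounded kernel under \<open>q\<close>. Starting with \<open>y = z\<close> for an optimal cut \<open>z\<close>,
  add \<open>(b - z) / L\<close> to \<open>y\<close> in each of \<open>L\<close> steps, where \<open>b\<close> is the sign vector minimising the linearisation
  of \<open>Q\<close> at \<open>y\<close> as estimated from a fresh block of \<open>L\<^sup>2\<close> samples. Each step costs \<open>O(1 / L\<^sup>2)\<close>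
  relative to the kernel bound, and after \<open>L\<close> steps \<open>z\<close> only enters through its values on the samples.
  These are guessed, and the best guess is selected on fresh pairs of samples, with an error that Hoeffding's
  lemma bounds uniformly over all guesses.

  Hence every machine only needs \<open>poly(1 / \<epsilon>)\<close> common samples. Weighted samples of disjoint sets can be
  merged exactly, so they are collected along a tree of fan-out about \<open>n\<^sup>\<alpha>\<close> and sent back down it. The
  local memory may be full with input, so shared words live in the inbox: each machine sends them to itself.
  If there are fewer points than samples, all points are sent to all machines.
\<close>

section \<open>Finitely supported and product distributions\<close>

text \<open>Two features of the model shape the construction. A computed distance cannot be sent,
  since a word is an input coordinate or bits; so sampling weights are natural numbers, distances
  rounded up relative to one positive reference distance. This is why a second point
  \<open>c'\<close> is drawn: the aspect ratio then limits both the loss by rounding and the size of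
  the weights. And machines do not know indices, so every rule is a function of coordinates;
  duplicates receive the same fractional value and only the final rounding can separate them. The
  average distance is added to the weights because with the distance alone \<open>c\<close> would
  never be sampled, although its distances to other points matter. The algorithm is fixed before
  \<alpha> is known. Hence the fan-out is read off from the local memory, and the depth is the least
  one that reaches all machines. Constants: the descent costs \<open>8 * M / L\<close> and the
  choice of the guess \<open>M / L\<close>, where the kernel bound \<open>M\<close> is at most 8 n
  times the total distance to \<open>c\<close>. Averaging over \<open>c\<close> gives 72 / L times
  \<open>D\<close>, the factor 1 / 4 in \<open>f\<close> leaves 18 / L, and L is at least 20 /
  \<epsilon>.\<close>

abbreviation (input) expect :: "'a pmf \<Rightarrow> ('a \<Rightarrow> real) \<Rightarrow> real" (\<open>\<E>\<close>) where
  "\<E> \<equiv> measure_pmf.expectation"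

lemma expectation_bind_finite:
  fixes h :: "'b \<Rightarrow> real"
  assumes "finite (set_pmf p)" "\<And>x. x \<in> set_pmf p \<Longrightarrow> finite (set_pmf (f x))"
  shows "\<E> (bind_pmf p f) h =
    \<E> p (\<lambda>x. \<E> (f x) h)"
  using pmf_expectation_bind[OF assms order_refl, where h = h]
    integral_measure_pmf_real[OF assms(1), where M = p and f = "\<lambda>x. \<E> (f x) h"]
  by (simp add: mult.commute)

lemma expectation_pair_finite:
  fixes h :: "'a \<times> 'b \<Rightarrow> real"
  assumes "finite (set_pmf p)" "finite (set_pmf q)"
  shows "\<E> (pair_pmf p q) h =
    \<E> p (\<lambda>x. \<E> q (\<lambda>y. h (x, y)))"
  unfolding pair_pmf_def using assms
  by (simp add: expectation_bind_finite)

lemma expectation_mono_finite: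
  fixes f g :: "'a \<Rightarrow> real"
  assumes "finite (set_pmf p)" "\<And>x. x \<in> set_pmf p \<Longrightarrow> f x \<le> g x"
  shows "\<E> p f \<le> \<E> p g"
  using assms by (intro integral_mono_AE integrable_measure_pmf_finite) (auto simp: AE_measure_pmf_iff)

lemma expectation_cong_pmf:
  fixes f g :: "'a \<Rightarrow> real"
  assumes "\<And>x. x \<in> set_pmf p \<Longrightarrow> f x = g x"
  shows "\<E> p f = \<E> p g"
  using assms by (intro integral_cong_AE) (auto simp: AE_measure_pmf_iff)

lemma finite_set_Pi_pmf:
  assumes "finite A" "\<And>x. x \<in> A \<Longrightarrow> finite (set_pmf (p x))"
  shows "finite (set_pmf (Pi_pmf A d p))"
  using assms by (simp add: set_Pi_pmf finite_PiE_dflt)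

text \<open>Computations that read disjoint blocks of independent coordinates have independent
  results. The induction peels off one block with \<open>Pi_pmf_union\<close>; by the locality of
  \<open>G\<close> the other computations ignore it.\<close>

lemma Pi_pmf_group_exact:
  assumes "finite A" "\<And>k. k \<in> A \<Longrightarrow> finite (C k)" "disjoint_family_on C A"
    and "\<And>k f g. k \<in> A \<Longrightarrow> (\<And>x. x \<in> C k \<Longrightarrow> f x = g x) \<Longrightarrow> G k f = G k g"
  shows "bind_pmf (Pi_pmf (\<Union>k\<in>A. C k) d p) (\<lambda>f. Pi_pmf A d' (\<lambda>k. G k f)) =
    Pi_pmf A d' (\<lambda>k. bind_pmf (Pi_pmf (C k) d p) (G k))"
  using assms
proof (induction A rule: finite_induct)
  case empty
  then show ?case by (simp add: bind_return_pmf)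
next
  case (insert a A)
  let ?U = "\<Union>k\<in>A. C k"
  have disj: "C a \<inter> ?U = {}" and dA: "disjoint_family_on C A"
    using insert.prems(2) insert.hyps by (auto simp: disjoint_family_on_def)
  have fin: "finite (C a)" "finite ?U" using insert.prems(1) insert.hyps by auto
  let ?m = "\<lambda>f g x. if x \<in> C a then f x else g x"
  have G1: "G a (?m f g) = G a f" for f g
    by (rule insert.prems(3)) auto
  have G2: "Pi_pmf A d' (\<lambda>k. G k (?m f g)) = Pi_pmf A d' (\<lambda>k. G k g)" for f g
    using disj by (intro Pi_pmf_cong refl insert.prems(3)) auto
  have IH: "bind_pmf (Pi_pmf ?U d p) (\<lambda>f. Pi_pmf A d' (\<lambda>k. G k f)) =
    Pi_pmf A d' (\<lambda>k. bind_pmf (Pi_pmf (C k) d p) (G k))"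
  proof (rule insert.IH[OF _ dA])
    show "G k f = G k g" if "k \<in> A" "\<And>x. x \<in> C k \<Longrightarrow> f x = g x" for k f g
      using that by (intro insert.prems(3)) auto
  qed (use insert.prems(1) in auto)
  have "bind_pmf (Pi_pmf (\<Union>k\<in>insert a A. C k) d p) (\<lambda>f. Pi_pmf (insert a A) d' (\<lambda>k. G k f)) =
    bind_pmf (Pi_pmf (C a) d p) (\<lambda>f. bind_pmf (Pi_pmf ?U d p) (\<lambda>g.
      Pi_pmf (insert a A) d' (\<lambda>k. G k (?m f g))))"
    by (simp add: Pi_pmf_union[OF fin disj] pair_pmf_def map_pmf_def bind_assoc_pmf bind_return_pmf)
  also have "\<dots> = bind_pmf (Pi_pmf (C a) d p) (\<lambda>f. bind_pmf (Pi_pmf ?U d p) (\<lambda>g.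
      bind_pmf (G a f) (\<lambda>y. bind_pmf (Pi_pmf A d' (\<lambda>k. G k g)) (\<lambda>h. return_pmf (h(a := y))))))"
    by (simp add: Pi_pmf_insert'[OF insert.hyps] G1 G2)
  also have "\<dots> = bind_pmf (Pi_pmf (C a) d p) (\<lambda>f. bind_pmf (G a f) (\<lambda>y.
      bind_pmf (Pi_pmf A d' (\<lambda>k. bind_pmf (Pi_pmf (C k) d p) (G k))) (\<lambda>h. return_pmf (h(a := y)))))"
    by (subst bind_commute_pmf) (simp add: IH[symmetric] bind_assoc_pmf)
  also have "\<dots> = Pi_pmf (insert a A) d' (\<lambda>k. bind_pmf (Pi_pmf (C k) d p) (G k))"
    by (simp add: Pi_pmf_insert'[OF insert.hyps] bind_assoc_pmf)
  finally show ?case .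
qed

text \<open>Coordinates outside all blocks are marginalised by resetting them to the default. In the
  tree these belong to machines that send nothing at the current level.\<close>

lemma Pi_pmf_group:
  assumes "finite A" "finite S" "\<And>k. k \<in> A \<Longrightarrow> C k \<subseteq> S" "disjoint_family_on C A"
    and G: "\<And>k f g. k \<in> A \<Longrightarrow> (\<And>x. x \<in> C k \<Longrightarrow> f x = g x) \<Longrightarrow> G k f = G k g"
  shows "bind_pmf (Pi_pmf S d p) (\<lambda>f. Pi_pmf A d' (\<lambda>k. G k f)) =
    Pi_pmf A d' (\<lambda>k. bind_pmf (Pi_pmf (C k) d p) (G k))"
proof -
  let ?U = "\<Union>k\<in>A. C k"
  have "bind_pmf (Pi_pmf ?U d p) (\<lambda>f. Pi_pmf A d' (\<lambda>k. G k f)) =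
    bind_pmf (Pi_pmf S d p) (\<lambda>f. Pi_pmf A d' (\<lambda>k. G k (\<lambda>x. if x \<in> ?U then f x else d)))"
    using assms(2,3) by (subst Pi_pmf_subset[of S ?U]) (auto simp: bind_map_pmf)
  also have "\<dots> = bind_pmf (Pi_pmf S d p) (\<lambda>f. Pi_pmf A d' (\<lambda>k. G k f))"
    by (intro bind_pmf_cong refl Pi_pmf_cong G) auto
  finally show ?thesis
    using Pi_pmf_group_exact[of A C G, OF assms(1) finite_subset[OF assms(3,2)] assms(4) G] by simp
qed

lemma Pi_pmf_map_default:
  assumes "finite A"
  shows "Pi_pmf A d' (\<lambda>x. map_pmf (g x) (p x)) =
    map_pmf (\<lambda>h x. if x \<in> A then g x (h x) else d') (Pi_pmf A d p)"
  using Pi_pmf_bind[OF assms, of d' p "\<lambda>x y. return_pmf (g x y)" d] assms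
  by (simp add: map_pmf_def)

lemma Pi_pmf_reindex:
  assumes "finite B" "inj_on \<phi> B"
  shows "map_pmf (\<lambda>f t. if t \<in> B then f (\<phi> t) else d) (Pi_pmf (\<phi> ` B) d p) = Pi_pmf B d (\<lambda>t. p (\<phi> t))"
proof -
  have "Pi_pmf B d (\<lambda>t. p (\<phi> t)) = Pi_pmf B d (\<lambda>t. bind_pmf (Pi_pmf {\<phi> t} d p) (\<lambda>f. return_pmf (f (\<phi> t))))"
    by (intro Pi_pmf_cong refl) (simp add: Pi_pmf_component flip: map_pmf_def)
  also have "\<dots> = bind_pmf (Pi_pmf (\<phi> ` B) d p) (\<lambda>f. Pi_pmf B d (\<lambda>t. return_pmf (f (\<phi> t))))"
    using assms by (intro Pi_pmf_group[symmetric]) (auto simp: disjoint_family_on_def inj_on_def)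
  finally show ?thesis using assms by (simp add: map_pmf_def)
qed

text \<open>Flattens machines times slots, and machines times local points, into one product over
  pairs, on which \<open>Pi_pmf_group\<close> and reindexing can act.\<close>

lemma Pi_pmf_nested:
  assumes "finite A" "\<And>k. k \<in> A \<Longrightarrow> finite (B k)"
  shows "Pi_pmf A d' (\<lambda>k. map_pmf (e k) (Pi_pmf (B k) d (p k))) =
    map_pmf (\<lambda>f k. if k \<in> A then e k (\<lambda>t. if t \<in> B k then f (k, t) else d) else d')
      (Pi_pmf (Sigma A B) d (\<lambda>(k, t). p k t))"
proof -
  let ?E = "\<lambda>k f. e k (\<lambda>t. if t \<in> B k then f (k, t) else d)"
  have "map_pmf (e k) (Pi_pmf (B k) d (p k)) =
    bind_pmf (Pi_pmf (Pair k ` B k) d (\<lambda>(k, t). p k t)) (\<lambda>f. return_pmf (?E k f))" if "k \<in> A" for k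
  proof -
    have "Pi_pmf (B k) d (p k) = map_pmf (\<lambda>f t. if t \<in> B k then f (k, t) else d)
        (Pi_pmf (Pair k ` B k) d (\<lambda>(k, t). p k t))"
      using Pi_pmf_reindex[of "B k" "Pair k" d "\<lambda>(k, t). p k t"] assms that by (simp add: inj_on_def)
    then show ?thesis by (simp add: pmf.map_comp o_def flip: map_pmf_def)
  qed
  then have "Pi_pmf A d' (\<lambda>k. map_pmf (e k) (Pi_pmf (B k) d (p k))) =
    Pi_pmf A d' (\<lambda>k. bind_pmf (Pi_pmf (Pair k ` B k) d (\<lambda>(k, t). p k t)) (\<lambda>f. return_pmf (?E k f)))"
    by (intro Pi_pmf_cong) auto
  also have "\<dots> = bind_pmf (Pi_pmf (Sigma A B) d (\<lambda>(k, t). p k t)) (\<lambda>f. Pi_pmf A d' (\<lambda>k. return_pmf (?E k f)))"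
  proof (intro Pi_pmf_group[symmetric])
    show "return_pmf (?E k f) = return_pmf (?E k g)"
      if "\<And>x. x \<in> Pair k ` B k \<Longrightarrow> f x = g x" for k f g
    proof -
      have "(\<lambda>t. if t \<in> B k then f (k, t) else d) = (\<lambda>t. if t \<in> B k then g (k, t) else d)"
        using that by auto
      then show ?thesis by simp
    qed
  qed (use assms in \<open>auto simp: disjoint_family_on_def\<close>)
  finally show ?thesis using assms by (simp add: map_pmf_def)
qed

text \<open>Natural weights can be transmitted as \<open>Bits\<close>. The default covers total
  weight 0, as for a machine without points.\<close>

definition wpick :: "'a \<Rightarrow> (nat \<times> 'a) list \<Rightarrow> 'a pmf" where
  "wpick dflt ws = (let W = sum_list (map fst ws) in
     if W = 0 then return_pmf dflt
     else pmf_of_list (map (\<lambda>(w, a). (a, real w / real W)) ws))"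

lemma wpick_zero: "sum_list (map fst ws) = 0 \<Longrightarrow> wpick dflt ws = return_pmf dflt"
  unfolding wpick_def by simp

lemma wpick_wf:
  assumes "sum_list (map fst ws) \<noteq> 0"
  shows "pmf_of_list_wf (map (\<lambda>(w, a). (a, real w / real (sum_list (map fst ws)))) ws)"
proof (rule pmf_of_list_wfI)
  let ?W = "sum_list (map fst ws)"
  have "(\<Sum>z\<leftarrow>ws. real (fst z) / real W) = real (sum_list (map fst ws)) / real W" for W
    by (induction ws) (auto simp: add_divide_distrib)
  then show "sum_list (map snd (map (\<lambda>(w, a). (a, real w / real ?W)) ws)) = 1"
    using assms by (simp add: case_prod_beta o_def)
qed auto

lemma pmf_wpick:
  assumes "sum_list (map fst ws) \<noteq> 0"
  shows "pmf (wpick dflt ws) y =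
    (\<Sum>z\<leftarrow>ws. if snd z = y then real (fst z) else 0) / real (sum_list (map fst ws))"
proof -
  have "sum_list (map snd (filter (\<lambda>z. fst z = y) (map (\<lambda>(w, a). (a, real w / W)) ws))) =
    (\<Sum>z\<leftarrow>ws. if snd z = y then real (fst z) else 0) / W" for W
    by (induction ws) (auto simp: add_divide_distrib)
  then show ?thesis
    unfolding wpick_def Let_def if_not_P[OF assms] by (simp only: pmf_pmf_of_list[OF wpick_wf[OF assms]])
qed

lemma set_wpick: "set_pmf (wpick dflt ws) \<subseteq> insert dflt (snd ` set ws)"
  unfolding wpick_def Let_def
  using set_pmf_of_list[OF wpick_wf, of ws] by (auto simp: image_iff) force

lemma finite_set_wpick: "finite (set_pmf (wpick dflt ws))"
  using set_wpick by (rule finite_subset) auto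

lemma sum_list_map_cong_mset:
  fixes f :: "'a \<Rightarrow> 'b::comm_monoid_add"
  assumes "mset xs = mset ys"
  shows "sum_list (map f xs) = sum_list (map f ys)"
  using assms by (metis mset_map sum_mset_sum_list)

lemma wpick_cong_mset:
  assumes "mset ws = mset ws'"
  shows "wpick dflt ws = wpick dflt ws'"
proof -
  note s = sum_list_map_cong_mset[OF assms]
  show ?thesis
  proof (cases "sum_list (map fst ws) = 0")
    case True then show ?thesis using s[of fst] by (simp add: wpick_zero)
  next
    case False
    then have "sum_list (map fst ws') \<noteq> 0" using s[of fst] by simp
    then show ?thesis using False
      by (intro pmf_eqI) (simp only: pmf_wpick not_False_eq_True s)
  qed
qed

text \<open>An element of list \<open>k\<close> with weight w wins its list with probability w /
  V_k, and list \<open>k\<close> wins with probability V_k / W, so V_k cancels. The outer pick is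
  linear in its candidates, hence only their marginals matter; lists of total weight 0 are never
  chosen.\<close>

lemma wpick_merge:
  assumes "finite S" "set ks \<subseteq> S"
  shows "bind_pmf (Pi_pmf S d (\<lambda>k. wpick dflt (ws k)))
      (\<lambda>f. wpick dflt (map (\<lambda>k. (sum_list (map fst (ws k)), f k)) ks)) =
    wpick dflt (concat (map ws ks))"
proof -
  let ?V = "\<lambda>k. sum_list (map fst (ws k))"
  have W1: "sum_list (map fst (map (\<lambda>k. (?V k, f k)) ks)) = sum_list (map ?V ks)" for f
    by (simp add: o_def)
  have W2: "sum_list (map fst (concat (map ws ks))) = sum_list (map ?V ks)"
    by (induction ks) auto
  show ?thesis
  proof (cases "sum_list (map ?V ks) = 0")
    case True
    then show ?thesis using W1 W2 by (simp add: wpick_zero)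
  next
    case False
    show ?thesis
    proof (rule pmf_eqI)
      fix y
      let ?P = "Pi_pmf S d (\<lambda>k. wpick dflt (ws k))"
      have fin: "finite (set_pmf ?P)" using assms by (intro finite_set_Pi_pmf finite_set_wpick)
      have comp: "\<E> ?P (\<lambda>f. if f k = y then r else 0) = r * pmf (wpick dflt (ws k)) y"
        if "k \<in> S" for k and r :: real
      proof -
        have "\<E> ?P (\<lambda>f. if f k = y then r else 0) =
          \<E> (map_pmf (\<lambda>f. f k) ?P) (\<lambda>a. r * indicator {y} a)"
          unfolding integral_map_pmf by (intro Bochner_Integration.integral_cong) (auto simp: indicator_def)
        also have "\<dots> = r * pmf (wpick dflt (ws k)) y"
          using that assms by (simp add: Pi_pmf_component measure_pmf_single)
        finally show ?thesis .
      qed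
      have one: "real (?V k) * pmf (wpick dflt (ws k)) y = (\<Sum>z\<leftarrow>ws k. if snd z = y then real (fst z) else 0)" for k
      proof (cases "?V k = 0")
        case True
        then have "\<And>z. z \<in> set (ws k) \<Longrightarrow> fst z = 0" by (simp add: sum_list_eq_0_iff)
        then have "(\<Sum>z\<leftarrow>ws k. if snd z = y then real (fst z) else 0) = (\<Sum>z\<leftarrow>ws k. 0)"
          by (intro arg_cong[of _ _ sum_list] map_cong) auto
        then show ?thesis using True by simp
      next
        case False
        then show ?thesis by (simp only: pmf_wpick not_False_eq_True) simp
      qed
      have lin: "\<E> ?P (\<lambda>f. \<Sum>k\<leftarrow>ks'. if f k = y then real (?V k) else 0) =
        (\<Sum>z\<leftarrow>concat (map ws ks'). if snd z = y then real (fst z) else 0)" if "set ks' \<subseteq> S" for ks'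
        using that
      proof (induction ks')
        case (Cons k ks')
        then show ?case using fin comp[of k "real (?V k)"]
          by (simp add: integrable_measure_pmf_finite one)
      qed auto
      have "pmf (bind_pmf ?P (\<lambda>f. wpick dflt (map (\<lambda>k. (?V k, f k)) ks))) y =
        \<E> ?P (\<lambda>f. pmf (wpick dflt (map (\<lambda>k. (?V k, f k)) ks)) y)"
        by (simp add: pmf_bind)
      also have "\<dots> = \<E> ?P (\<lambda>f. (\<Sum>k\<leftarrow>ks. if f k = y then real (?V k) else 0) / real (sum_list (map ?V ks)))"
        using False W1 by (simp only: pmf_wpick not_False_eq_True map_map o_def snd_conv fst_conv)
      also have "\<dots> = (\<Sum>z\<leftarrow>concat (map ws ks). if snd z = y then real (fst z) else 0) / real (sum_list (map ?V ks))"
        using lin[OF assms(2)] by simp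
      also have "\<dots> = pmf (wpick dflt (concat (map ws ks))) y"
        using False W2 by (simp only: pmf_wpick not_False_eq_True)
      finally show "pmf (bind_pmf ?P (\<lambda>f. wpick dflt (map (\<lambda>k. (?V k, f k)) ks))) y =
        pmf (wpick dflt (concat (map ws ks))) y" .
    qed
  qed
qed

section \<open>Minkowski's inequality\<close>

lemma powr_convex_combination:
  fixes a b t p :: real
  assumes "p \<ge> 1" "0 \<le> t" "t \<le> 1" "0 \<le> a" "0 \<le> b"
  shows "((1 - t) * a + t * b) powr p \<le> (1 - t) * a powr p + t * b powr p"
proof (cases "a = 0 \<or> b = 0 \<or> t = 0 \<or> t = 1")
  case True
  \<comment> \<open>In the degenerate cases at most one term survives, scaled by a factor
    \<open>s\<close> in [0, 1].\<close>
  have le: "s powr p \<le> s" if "0 \<le> s" "s \<le> 1" for s :: real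
    using powr_mono'[of 1 p s] that assms(1) by (cases "s = 0") auto
  have "(s * c) powr p \<le> s * c powr p" if "0 \<le> s" "s \<le> 1" "0 \<le> c" for s c :: real
    using le[OF that(1,2)] that by (simp add: powr_mult mult_right_mono)
  then show ?thesis using True assms by (auto simp: powr_mult)
next
  case False
  have "convex_on {0<..} (\<lambda>x::real. x powr p)"
    using assms(1) by (intro powr_convex) auto
  then show ?thesis using False assms
    by (auto dest!: convex_onD[where t = t and x = a and y = b])
qed

lemma lp_dist_nonneg: "0 \<le> lp_dist p d u v"
  by (simp add: lp_dist_def)

lemma lp_dist_self: "p \<ge> 1 \<Longrightarrow> lp_dist p d u u = 0"
  by (simp add: lp_dist_def)

lemma lp_dist_commute: "lp_dist p d u v = lp_dist p d v u"
  by (simp add: lp_dist_def abs_minus_commute)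

lemma lp_dist_cong:
  assumes "\<And>j. j < d \<Longrightarrow> u j = u' j" "\<And>j. j < d \<Longrightarrow> v j = v' j"
  shows "lp_dist p d u v = lp_dist p d u' v'"
  using assms by (simp add: lp_dist_def)

lemma lp_dist_powr:
  assumes "p \<ge> 1"
  shows "lp_dist p d u v powr p = (\<Sum>j<d. \<bar>u j - v j\<bar> powr p)"
  using assms by (simp add: lp_dist_def powr_powr sum_nonneg)

text \<open>Convexity proof of Minkowski's inequality. With \<open>t = b / (a + b)\<close>, each
  coordinate of the sum is \<open>a + b\<close> times a convex combination of the normalised
  coordinates, whose p-th powers sum to 1.\<close>

lemma lp_dist_triangle:
  assumes p: "p \<ge> 1"
  shows "lp_dist p d u w \<le> lp_dist p d u v + lp_dist p d v w"
proof -
  define a b where "a = lp_dist p d u v" and "b = lp_dist p d v w"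
  have nn: "0 \<le> a" "0 \<le> b" by (simp_all add: a_def b_def lp_dist_nonneg)
  have zero: "\<forall>j<d. f j = g j" if "lp_dist p d f g = 0" for f g
  proof -
    have "(\<Sum>j<d. \<bar>f j - g j\<bar> powr p) = 0" using lp_dist_powr[OF p, of d f g] that by simp
    then have "\<forall>j<d. \<bar>f j - g j\<bar> powr p = 0" by (subst (asm) sum_nonneg_eq_0_iff) auto
    then show ?thesis by simp
  qed
  consider "a = 0" | "b = 0" | "a > 0" "b > 0" using nn by linarith
  then show ?thesis
  proof cases
    case 1
    then have "lp_dist p d u w = lp_dist p d v w"
      using zero[of u v] by (intro lp_dist_cong) (auto simp: a_def)
    then show ?thesis by (simp add: lp_dist_nonneg)
  next
    case 2
    then have "lp_dist p d u w = lp_dist p d u v"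
      using zero[of v w] by (intro lp_dist_cong) (auto simp: b_def)
    then show ?thesis by (simp add: lp_dist_nonneg)
  next
    case 3
    define t where "t = b / (a + b)"
    have t: "0 \<le> t" "t \<le> 1" "1 - t = a / (a + b)" using 3 by (auto simp: t_def field_simps)
    have ap: "(\<Sum>j<d. \<bar>u j - v j\<bar> powr p) = a powr p" "(\<Sum>j<d. \<bar>v j - w j\<bar> powr p) = b powr p"
      using lp_dist_powr[OF p] by (simp_all add: a_def b_def)
    have "\<bar>u j - w j\<bar> powr p \<le> (a + b) powr p *
        ((1 - t) * (\<bar>u j - v j\<bar> powr p / a powr p) + t * (\<bar>v j - w j\<bar> powr p / b powr p))" for j
    proof -
      have "\<bar>u j - w j\<bar> \<le> \<bar>u j - v j\<bar> + \<bar>v j - w j\<bar>" by simp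
      also have "\<dots> = (a + b) * ((1 - t) * (\<bar>u j - v j\<bar> / a) + t * (\<bar>v j - w j\<bar> / b))"
      proof -
        have "(a + b) * (1 - t) = a" "(a + b) * t = b" unfolding t(3) unfolding t_def using 3 by auto
        then show ?thesis using 3 by (simp add: distrib_left flip: mult.assoc)
      qed
      finally have "\<bar>u j - w j\<bar> powr p \<le>
        ((a + b) * ((1 - t) * (\<bar>u j - v j\<bar> / a) + t * (\<bar>v j - w j\<bar> / b))) powr p"
        using p by (intro powr_mono2) auto
      also have "\<dots> = (a + b) powr p * ((1 - t) * (\<bar>u j - v j\<bar> / a) + t * (\<bar>v j - w j\<bar> / b)) powr p"
        using t 3 by (intro powr_mult)
      also have "\<dots> \<le> (a + b) powr p *
        ((1 - t) * (\<bar>u j - v j\<bar> / a) powr p + t * (\<bar>v j - w j\<bar> / b) powr p)"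
        using t 3 p by (intro mult_left_mono powr_convex_combination) auto
      finally show ?thesis using 3 by (simp add: powr_divide)
    qed
    then have "(\<Sum>j<d. \<bar>u j - w j\<bar> powr p) \<le> (\<Sum>j<d. (a + b) powr p *
        ((1 - t) * (\<bar>u j - v j\<bar> powr p / a powr p) + t * (\<bar>v j - w j\<bar> powr p / b powr p)))"
      by (intro sum_mono)
    also have "\<dots> = (a + b) powr p * ((1 - t) * ((\<Sum>j<d. \<bar>u j - v j\<bar> powr p) / a powr p)
        + t * ((\<Sum>j<d. \<bar>v j - w j\<bar> powr p) / b powr p))"
      by (simp add: sum.distrib sum_divide_distrib flip: sum_distrib_left)
        (simp add: sum_distrib_left sum_divide_distrib)
    also have "\<dots> = (a + b) powr p" using 3 by (simp add: ap)
    finally have "(\<Sum>j<d. \<bar>u j - w j\<bar> powr p) powr (1 / p) \<le> ((a + b) powr p) powr (1 / p)"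
      using p by (intro powr_mono2) (auto intro: sum_nonneg)
    then show ?thesis using 3 p by (simp add: lp_dist_def[of p d u w] powr_powr a_def b_def)
  qed
qed

section \<open>Sampling rule for bounded kernels\<close>

text \<open>The sum of the signs chosen at \<open>p\<close> in the first \<open>k\<close> steps.
  Block \<open>k\<close> supplies the samples of step \<open>k\<close>; the bracket is the current
  iterate at sample \<open>t\<close>, with \<open>\<sigma> t\<close> as the guessed value of the
  optimal cut there. Only the sign of the estimate counts, so \<open>u\<close> may be any positive
  multiple of the sampling probability, and no normalisation has to be known.\<close>

primrec vote_sum ::
  "('p \<Rightarrow> 'p \<Rightarrow> real) \<Rightarrow> ('p \<Rightarrow> real) \<Rightarrow> nat \<Rightarrow> (nat \<Rightarrow> 'p) \<Rightarrow> (nat \<Rightarrow> real) \<Rightarrow> nat \<Rightarrow> 'p \<Rightarrow> real" where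
  "vote_sum \<delta> u L s \<sigma> 0 p = 0"
| "vote_sum \<delta> u L s \<sigma> (Suc k) p = vote_sum \<delta> u L s \<sigma> k p +
     (if (\<Sum>t\<in>{k * L\<^sup>2..<Suc k * L\<^sup>2}. \<delta> p (s t) / u (s t) *
            ((1 - real k / real L) * \<sigma> t + vote_sum \<delta> u L s \<sigma> k (s t) / real L)) > 0
      then -1 else 1)"

text \<open>The square of \<open>(L ^ 3 + 1) * L\<close>: \<open>2 ^ (L ^ 3)\<close> guesses
  contribute about \<open>L ^ 3\<close> to the logarithm of the exponential moment, and the
  selection error has to shrink to a 1 / L fraction of the kernel bound.\<close>

definition num_pairs :: "nat \<Rightarrow> nat" where
  "num_pairs L = ((L ^ 3 + 1) * L)\<^sup>2"

definition num_slots :: "nat \<Rightarrow> nat" where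
  "num_slots L = L ^ 3 + 2 * num_pairs L"

definition guesses :: "nat \<Rightarrow> (nat \<Rightarrow> real) set" where
  "guesses L = {..<L ^ 3} \<rightarrow>\<^sub>E {-1, 1}"

text \<open>An unnormalised estimate of the quadratic form at the cut of guess
  \<open>\<sigma>\<close>. Each pair of slots behind the first \<open>L ^ 3\<close> gives one kernel
  evaluation.\<close>

definition guess_score ::
  "('p \<Rightarrow> 'p \<Rightarrow> real) \<Rightarrow> ('p \<Rightarrow> real) \<Rightarrow> nat \<Rightarrow> (nat \<Rightarrow> 'p) \<Rightarrow> (nat \<Rightarrow> real) \<Rightarrow> real" where
  "guess_score \<delta> u L s \<sigma> = (\<Sum>r<num_pairs L.
     let a = s (L ^ 3 + 2 * r); b = s (Suc (L ^ 3 + 2 * r)) in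
     \<delta> a b / (u a * u b) * (vote_sum \<delta> u L s \<sigma> L a / real L) * (vote_sum \<delta> u L s \<sigma> L b / real L))"

definition sample_rule ::
  "('p \<Rightarrow> 'p \<Rightarrow> real) \<Rightarrow> ('p \<Rightarrow> real) \<Rightarrow> nat \<Rightarrow> (nat \<Rightarrow> 'p) \<Rightarrow> 'p \<Rightarrow> real" where
  "sample_rule \<delta> u L s p =
     vote_sum \<delta> u L s (arg_min_on (guess_score \<delta> u L s) (guesses L)) L p / real L"

text \<open>Step \<open>k\<close> has read only the first \<open>k\<close> blocks. This makes block
  \<open>k\<close> fresh, and the pair slots fresh for the selection.\<close>

lemma vote_sum_cong:
  assumes "\<And>t. t < k * L\<^sup>2 \<Longrightarrow> s t = s' t" "\<And>t. t < k * L\<^sup>2 \<Longrightarrow> \<sigma> t = \<sigma>' t"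
  shows "vote_sum \<delta> u L s \<sigma> k p = vote_sum \<delta> u L s' \<sigma>' k p"
  using assms
proof (induction k arbitrary: p)
  case (Suc k)
  have v: "vote_sum \<delta> u L s \<sigma> k = vote_sum \<delta> u L s' \<sigma>' k"
    using Suc by (intro ext Suc.IH) auto
  have "s t = s' t \<and> \<sigma> t = \<sigma>' t" if "t \<in> {k * L\<^sup>2..<Suc k * L\<^sup>2}" for t
    using Suc.prems that by auto
  then show ?case unfolding vote_sum.simps v
    by (intro arg_cong2[where f = "(+)"] refl if_cong arg_cong2[where f = "(<)"] sum.cong) auto
qed simp

lemma abs_vote_sum_le: "\<bar>vote_sum \<delta> u L s \<sigma> k p\<bar> \<le> real k"
proof (induction k arbitrary: p)
  case (Suc k)
  have "\<bar>vote_sum \<delta> u L s \<sigma> (Suc k) p\<bar> \<le> \<bar>vote_sum \<delta> u L s \<sigma> k p\<bar> + 1" by auto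
  also have "\<dots> \<le> real k + 1" using Suc by simp
  finally show ?case by simp
qed simp

lemma abs_sample_rule_le: "\<bar>sample_rule \<delta> u L s p\<bar> \<le> 1"
  unfolding sample_rule_def
  using abs_vote_sum_le[of \<delta> u L s _ L p] by (cases "L = 0") (auto simp: field_simps)

lemma sample_rule_cong:
  assumes "\<And>t. t < num_slots L \<Longrightarrow> s t = s' t"
  shows "sample_rule \<delta> u L s p = sample_rule \<delta> u L s' p"
proof -
  have v: "vote_sum \<delta> u L s \<sigma> L p = vote_sum \<delta> u L s' \<sigma> L p" for \<sigma> p
    by (rule vote_sum_cong) (auto intro!: assms simp: num_slots_def power3_eq_cube power2_eq_square)
  have "guess_score \<delta> u L s = guess_score \<delta> u L s'"
    using assms by (auto simp: guess_score_def num_slots_def v Let_def fun_eq_iff intro!: sum.cong)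
  then show ?thesis by (simp add: sample_rule_def v)
qed

lemma finite_guesses: "finite (guesses L)" and guesses_nonempty: "guesses L \<noteq> {}"
  by (auto simp: guesses_def PiE_eq_empty_iff intro!: finite_PiE)

lemma card_guesses: "card (guesses L) = 2 ^ (L ^ 3)"
  by (simp add: guesses_def card_PiE numeral_2_eq_2)

section \<open>Moments of independent samples\<close>

lemma expectation_Pi_insert:
  fixes F :: "_ \<Rightarrow> real"
  assumes "finite A" "x \<notin> A" "\<And>x. finite (set_pmf (p x))"
  shows "\<E> (Pi_pmf (insert x A) d p) F =
    \<E> (p x) (\<lambda>y. \<E> (Pi_pmf A d p) (\<lambda>f. F (f(x := y))))"
  using assms by (simp add: Pi_pmf_insert expectation_pair_finite finite_set_Pi_pmf)

lemma expectation_Pi_split: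
  fixes F :: "_ \<Rightarrow> real"
  assumes "finite A" "finite B" "A \<inter> B = {}" "\<And>x. finite (set_pmf (p x))"
  shows "\<E> (Pi_pmf (A \<union> B) d p) F =
    \<E> (Pi_pmf A d p) (\<lambda>f.
      \<E> (Pi_pmf B d p) (\<lambda>g. F (\<lambda>x. if x \<in> A then f x else g x)))"
  using assms by (simp add: Pi_pmf_union expectation_pair_finite finite_set_Pi_pmf)

text \<open>The cross terms vanish because the samples are independent and centred.\<close>

lemma expectation_square_sum_Pi:
  fixes f :: "_ \<Rightarrow> real"
  assumes "finite B" "finite (set_pmf q)" "\<E> q f = 0"
  shows "\<E> (Pi_pmf B d (\<lambda>_. q)) (\<lambda>\<omega>. (\<Sum>t\<in>B. f (\<omega> t))\<^sup>2) =
    real (card B) * \<E> q (\<lambda>i. (f i)\<^sup>2)"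
  using assms(1)
proof (induction B rule: finite_induct)
  case (insert t B)
  let ?P = "Pi_pmf B d (\<lambda>_. q)"
  have fin: "finite (set_pmf ?P)" using insert assms by (intro finite_set_Pi_pmf) auto
  have S: "(\<Sum>a\<in>insert t B. f (fun_upd \<omega> t y a))\<^sup>2 =
      (f y)\<^sup>2 + 2 * f y * (\<Sum>a\<in>B. f (\<omega> a)) + (\<Sum>a\<in>B. f (\<omega> a))\<^sup>2" for y \<omega>
  proof -
    have "(\<Sum>a\<in>B. f (fun_upd \<omega> t y a)) = (\<Sum>a\<in>B. f (\<omega> a))"
      using insert by (intro sum.cong) auto
    then show ?thesis using insert by (simp add: power2_sum)
  qed
  note int = integrable_measure_pmf_finite[OF fin] integrable_measure_pmf_finite[OF assms(2)]
  have "\<E> (Pi_pmf (insert t B) d (\<lambda>_. q)) (\<lambda>\<omega>. (\<Sum>a\<in>insert t B. f (\<omega> a))\<^sup>2) =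
    \<E> q (\<lambda>y. \<E> ?P (\<lambda>\<omega>.
      (f y)\<^sup>2 + 2 * f y * (\<Sum>a\<in>B. f (\<omega> a)) + (\<Sum>a\<in>B. f (\<omega> a))\<^sup>2))"
    using insert assms by (subst expectation_Pi_insert) (simp_all only: S, simp_all)
  also have "\<dots> = \<E> q (\<lambda>y. (f y)\<^sup>2 +
      2 * f y * \<E> ?P (\<lambda>\<omega>. \<Sum>a\<in>B. f (\<omega> a)) +
      real (card B) * \<E> q (\<lambda>i. (f i)\<^sup>2))"
    using insert.IH by (simp add: int)
  also have "\<dots> = real (card (insert t B)) * \<E> q (\<lambda>i. (f i)\<^sup>2)"
    using insert assms by (simp add: int algebra_simps)
  finally show ?case .
qed simp

text \<open>Different pairs use disjoint slots, so the expectation factorises. This turns the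
  exponential moment of a pair estimate into a power.\<close>

lemma expectation_prod_pairs_Pi:
  fixes G :: "'i \<Rightarrow> 'i \<Rightarrow> real"
  assumes "finite (set_pmf q)"
  shows "\<E> (Pi_pmf {a..<a + 2 * R} d (\<lambda>_. q))
      (\<lambda>\<omega>. \<Prod>r<R. G (\<omega> (a + 2 * r)) (\<omega> (Suc (a + 2 * r)))) =
    (\<E> q (\<lambda>i. \<E> q (G i))) ^ R"
proof (induction R)
  case (Suc R)
  let ?P = "Pi_pmf {a..<a + 2 * R} d (\<lambda>_. q)"
  let ?F = "\<lambda>R \<omega>. \<Prod>r<R. G (\<omega> (a + 2 * r)) (\<omega> (Suc (a + 2 * r)))"
  have set: "{a..<a + 2 * Suc R} = insert (a + 2 * R) (insert (Suc (a + 2 * R)) {a..<a + 2 * R})" by auto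
  have F: "?F (Suc R) (f(Suc (a + 2 * R) := z, a + 2 * R := y)) = ?F R f * G y z" for f y z
  proof -
    have "?F R (f(Suc (a + 2 * R) := z, a + 2 * R := y)) = ?F R f"
      by (intro prod.cong) auto
    then show ?thesis by simp
  qed
  have "\<E> (Pi_pmf {a..<a + 2 * Suc R} d (\<lambda>_. q)) (?F (Suc R)) =
    \<E> q (\<lambda>y. \<E> q (\<lambda>z. \<E> ?P (\<lambda>f. ?F R f * G y z)))"
    unfolding set using assms by (simp add: expectation_Pi_insert del: prod.lessThan_Suc fun_upd_apply) (simp only: F, simp)
  also have "\<dots> = \<E> ?P (?F R) * \<E> q (\<lambda>i. \<E> q (G i))"
    by simp
  finally show ?case using Suc by simp
qed simp

text \<open>Hoeffding's lemma for \<open>- f\<close>, whose range has length \<open>2 * M\<close>: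
  the exponent \<open>l\<^sup>2 * (2 * M)\<^sup>2 / 8\<close> is the one stated.\<close>

lemma Hoeffding_lemma_finite_pmf:
  fixes f :: "'a \<Rightarrow> real"
  assumes "finite (set_pmf p)" "\<And>x. x \<in> set_pmf p \<Longrightarrow> \<bar>f x\<bar> \<le> M" "l > 0"
  shows "\<E> p (\<lambda>x. exp (l * (\<E> p f - f x))) \<le> exp (l\<^sup>2 * M\<^sup>2 / 2)"
proof -
  interpret interval_bounded_random_variable "measure_pmf p" "\<lambda>x. - f x" "- M" M
  proof unfold_locales
    show "AE x in measure_pmf p. - f x \<in> {- M..M}"
      using assms(2) by (auto simp: AE_measure_pmf_iff abs_le_iff minus_le_iff)
  qed auto
  have "nn_integral (measure_pmf p) (\<lambda>x. exp (l * (- f x - \<E> p (\<lambda>x. - f x)))) \<le>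
    ennreal (exp (l\<^sup>2 * (M - - M)\<^sup>2 / 8))"
    using Hoeffdings_lemma_nn_integral[OF assms(3)] by simp
  also have "nn_integral (measure_pmf p) (\<lambda>x. exp (l * (- f x - \<E> p (\<lambda>x. - f x)))) =
    ennreal (\<E> p (\<lambda>x. exp (l * (\<E> p f - f x))))"
    using assms(1) by (subst nn_integral_eq_integral) (auto intro: integrable_measure_pmf_finite simp: algebra_simps)
  finally show ?thesis by (simp add: power2_eq_square mult_ac)
qed

text \<open>Indices \<open>I\<close> carry the distribution, while \<open>\<delta>\<close> and
  \<open>u\<close> see only the data \<open>e i\<close>; duplicates are indices with equal data.
  \<open>kernel_le\<close> expresses density, \<open>U\<close> is the normalisation that the rule
  does not know, and \<open>ys\<close> is the cut to compete with, used only in the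
  analysis.\<close>

locale bounded_kernel =
  fixes I :: "'i set" and q :: "'i pmf" and e :: "'i \<Rightarrow> 'p" and \<delta> :: "'p \<Rightarrow> 'p \<Rightarrow> real"
    and u :: "'p \<Rightarrow> real" and U M :: real and ys :: "'i \<Rightarrow> real" and L :: nat
  assumes fin: "finite I" and set_q: "set_pmf q = I"
    and sym: "\<And>i j. i \<in> I \<Longrightarrow> j \<in> I \<Longrightarrow> \<delta> (e i) (e j) = \<delta> (e j) (e i)"
    and nonneg: "\<And>i j. i \<in> I \<Longrightarrow> j \<in> I \<Longrightarrow> 0 \<le> \<delta> (e i) (e j)"
    and kernel_le: "\<And>i j. i \<in> I \<Longrightarrow> j \<in> I \<Longrightarrow> \<delta> (e i) (e j) \<le> M * (pmf q i * pmf q j)"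
    and u: "\<And>i. i \<in> I \<Longrightarrow> u (e i) = U * pmf q i" and U: "U > 0" and M: "M > 0"
    and ys: "\<And>i. i \<in> I \<Longrightarrow> ys i = 1 \<or> ys i = -1" and L: "L > 0"
begin

definition Q :: "('i \<Rightarrow> real) \<Rightarrow> real" where
  "Q y = (\<Sum>i\<in>I. \<Sum>j\<in>I. \<delta> (e i) (e j) * y i * y j)"

definition row :: "('i \<Rightarrow> real) \<Rightarrow> 'i \<Rightarrow> real" where
  "row y i = (\<Sum>j\<in>I. \<delta> (e i) (e j) * y j)"

lemma q_pos: "i \<in> I \<Longrightarrow> 0 < pmf q i"
  using set_q by (simp add: pmf_positive_iff)

lemma sum_q: "(\<Sum>i\<in>I. pmf q i) = 1"
  using sum_pmf_eq_1[OF fin] set_q by auto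

lemma E_q: "\<E> q f = (\<Sum>i\<in>I. f i * pmf q i)" for f :: "'i \<Rightarrow> real"
  using integral_measure_pmf_real[OF fin, of q f] set_q by simp

lemma fin_q: "finite (set_pmf q)" using fin set_q by simp

lemma Q_add: "Q (\<lambda>i. y i + c * z i) = Q y + 2 * c * (\<Sum>i\<in>I. row y i * z i) + c\<^sup>2 * Q z"
proof -
  have sw: "(\<Sum>i\<in>I. \<Sum>j\<in>I. \<delta> (e i) (e j) * y i * z j) = (\<Sum>i\<in>I. \<Sum>j\<in>I. \<delta> (e i) (e j) * z i * y j)"
    by (subst sum.swap) (auto intro!: sum.cong simp: sym)
  have "Q (\<lambda>i. y i + c * z i) = Q y + c * (\<Sum>i\<in>I. \<Sum>j\<in>I. \<delta> (e i) (e j) * y i * z j) +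
     c * (\<Sum>i\<in>I. \<Sum>j\<in>I. \<delta> (e i) (e j) * z i * y j) + c\<^sup>2 * Q z"
    unfolding Q_def by (simp add: algebra_simps sum.distrib sum_distrib_left power2_eq_square)
  moreover have "(\<Sum>i\<in>I. \<Sum>j\<in>I. \<delta> (e i) (e j) * z i * y j) = (\<Sum>i\<in>I. row y i * z i)"
    unfolding row_def by (simp add: sum_distrib_left sum_distrib_right mult_ac)
  ultimately show ?thesis using sw by simp
qed

lemma abs_Q_le:
  assumes "\<And>i. i \<in> I \<Longrightarrow> \<bar>z i\<bar> \<le> c"
  shows "\<bar>Q z\<bar> \<le> c\<^sup>2 * M"
proof -
  have "\<bar>Q z\<bar> \<le> (\<Sum>i\<in>I. \<Sum>j\<in>I. M * (pmf q i * pmf q j) * c\<^sup>2)"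
    unfolding Q_def
  proof (rule order_trans[OF sum_abs], rule sum_mono, rule order_trans[OF sum_abs], rule sum_mono)
    fix i j assume ij: "i \<in> I" "j \<in> I"
    have "\<bar>\<delta> (e i) (e j) * z i * z j\<bar> = \<delta> (e i) (e j) * (\<bar>z i\<bar> * \<bar>z j\<bar>)"
      using nonneg ij by (simp add: abs_mult)
    also have "\<dots> \<le> M * (pmf q i * pmf q j) * (c * c)"
      using kernel_le[OF ij] nonneg[OF ij] assms ij M
      by (intro mult_mono) (auto intro: order_trans[OF abs_ge_zero])
    finally show "\<bar>\<delta> (e i) (e j) * z i * z j\<bar> \<le> M * (pmf q i * pmf q j) * c\<^sup>2" by (simp add: power2_eq_square)
  qed
  also have "\<dots> = c\<^sup>2 * M * ((\<Sum>i\<in>I. pmf q i) * (\<Sum>j\<in>I. pmf q j))"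
    by (simp add: sum_product sum_distrib_left mult_ac)
  finally show ?thesis by (simp add: sum_q)
qed

text \<open>Importance sampling: the division by \<open>pmf q\<close> makes every term an unbiased
  estimate of \<open>row y i\<close>.\<close>

definition est :: "nat set \<Rightarrow> (nat \<Rightarrow> 'i) \<Rightarrow> ('i \<Rightarrow> real) \<Rightarrow> 'i \<Rightarrow> real" where
  "est B \<omega> y i = (\<Sum>t\<in>B. \<delta> (e i) (e (\<omega> t)) / pmf q (\<omega> t) * y (\<omega> t)) / real (card B)"

text \<open>By \<open>kernel_le\<close> every term is at most \<open>M * pmf q i\<close> in absolute
  value, and averaging \<open>L\<^sup>2\<close> of them reduces the standard deviation by the factor
  \<open>L\<close>. The factor \<open>pmf q i\<close> lets the errors be summed over all
  \<open>i\<close>.\<close>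

lemma E_est_error:
  assumes "i \<in> I" "finite B" "card B = L\<^sup>2" "\<And>j. j \<in> I \<Longrightarrow> \<bar>y j\<bar> \<le> 1"
  shows "\<E> (Pi_pmf B d (\<lambda>_. q)) (\<lambda>\<omega>. \<bar>row y i - est B \<omega> y i\<bar>) \<le> M * pmf q i / L"
proof -
  let ?P = "Pi_pmf B d (\<lambda>_. q)"
  define g where "g = (\<lambda>j. \<delta> (e i) (e j) / pmf q j * y j)"
  define f where "f = (\<lambda>j. row y i - g j)"
  define \<eta> where "\<eta> = M * pmf q i / L"
  have \<eta>: "\<eta> > 0" using M L q_pos[OF assms(1)] by (simp add: \<eta>_def)
  have finP: "finite (set_pmf ?P)" using assms fin_q by (intro finite_set_Pi_pmf) auto
  note int = integrable_measure_pmf_finite[OF finP] integrable_measure_pmf_finite[OF fin_q]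
  have Eg: "\<E> q g = row y i"
    unfolding E_q g_def row_def
  proof (intro sum.cong refl)
    fix j assume "j \<in> I"
    then show "\<delta> (e i) (e j) / pmf q j * y j * pmf q j = \<delta> (e i) (e j) * y j"
      using q_pos[of j] by simp
  qed
  have Ef: "\<E> q f = 0" unfolding f_def using Eg by (simp add: int)
  have g: "\<bar>g j\<bar> \<le> M * pmf q i" if "j \<in> I" for j
  proof -
    have "\<bar>g j\<bar> = \<delta> (e i) (e j) / pmf q j * \<bar>y j\<bar>"
      using nonneg[OF assms(1) that] by (simp add: g_def abs_mult)
    also have "\<dots> \<le> \<delta> (e i) (e j) / pmf q j * 1"
      using nonneg[OF assms(1) that] assms(4)[OF that] by (intro mult_left_mono) auto
    also have "\<dots> \<le> M * pmf q i"
      using kernel_le[OF assms(1) that] q_pos[OF that] by (simp add: field_simps)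
    finally show ?thesis .
  qed
  have "\<E> q (\<lambda>j. (f j)\<^sup>2) = \<E> q (\<lambda>j. (g j)\<^sup>2) - (row y i)\<^sup>2"
    unfolding f_def power2_diff using Eg by (simp add: int) (simp add: power2_eq_square)
  also have "\<dots> \<le> \<E> q (\<lambda>j. (g j)\<^sup>2)" by simp
  also have "\<dots> \<le> \<E> q (\<lambda>j. (M * pmf q i)\<^sup>2)"
  proof (rule expectation_mono_finite[OF fin_q])
    show "(g j)\<^sup>2 \<le> (M * pmf q i)\<^sup>2" if "j \<in> set_pmf q" for j
      using g[of j] that set_q by (intro abs_le_square_iff[THEN iffD1]) auto
  qed
  also have "\<dots> = (M * pmf q i)\<^sup>2" by simp
  finally have Ef2: "\<E> q (\<lambda>j. (f j)\<^sup>2) \<le> (M * pmf q i)\<^sup>2" .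
  have cL: "real (card B) = (real L)\<^sup>2" using assms(3) by simp
  have eq: "row y i - est B \<omega> y i = (\<Sum>t\<in>B. f (\<omega> t)) / (real L)\<^sup>2" for \<omega>
    unfolding est_def f_def g_def cL using L
    by (simp add: sum_subtractf assms(3) diff_divide_distrib)
  \<comment> \<open>Replaces the bound of the first absolute moment by the root of the second one.
    The mean square is at most \<open>\<eta>\<^sup>2\<close>, so both summands are at most
    \<open>\<eta> / 2\<close>.\<close>
  have am: "\<bar>x\<bar> \<le> x\<^sup>2 / (2 * \<eta>) + \<eta> / 2" for x :: real
  proof -
    have "0 \<le> (\<bar>x\<bar> - \<eta>)\<^sup>2" by simp
    then show ?thesis using \<eta> by (simp add: power2_diff field_simps) (simp add: power2_eq_square)
  qed
  have "\<E> ?P (\<lambda>\<omega>. \<bar>row y i - est B \<omega> y i\<bar>) \<le> \<E> ?P (\<lambda>\<omega>. ((\<Sum>t\<in>B. f (\<omega> t)) / (real L)\<^sup>2)\<^sup>2 / (2 * \<eta>) + \<eta> / 2)"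
    unfolding eq using finP by (intro expectation_mono_finite am)
  also have "\<dots> = \<E> ?P (\<lambda>\<omega>. (\<Sum>t\<in>B. f (\<omega> t))\<^sup>2) / ((real L)\<^sup>2)\<^sup>2 / (2 * \<eta>) + \<eta> / 2"
    by (simp add: int power_divide)
  also have "\<dots> = (real L)\<^sup>2 * \<E> q (\<lambda>i. (f i)\<^sup>2) / ((real L)\<^sup>2)\<^sup>2 / (2 * \<eta>) + \<eta> / 2"
    using expectation_square_sum_Pi[OF assms(2) fin_q Ef, of d] cL by simp
  also have "\<dots> \<le> (real L)\<^sup>2 * (M * pmf q i)\<^sup>2 / ((real L)\<^sup>2)\<^sup>2 / (2 * \<eta>) + \<eta> / 2"
    using Ef2 \<eta> by (intro add_right_mono divide_right_mono mult_left_mono) auto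
  also have "\<dots> = \<eta>\<^sup>2 / (2 * \<eta>) + \<eta> / 2"
    unfolding \<eta>_def using L by (simp add: field_simps power2_eq_square)
  also have "\<dots> = \<eta>" using \<eta> by (simp add: power2_eq_square)
  finally show ?thesis by (simp add: \<eta>_def)
qed

section \<open>Descent from the competing cut along sampled gradients\<close>

definition mix :: "nat \<Rightarrow> (nat \<Rightarrow> 'i) \<Rightarrow> 'i \<Rightarrow> real" where
  "mix k \<omega> i = (1 - real k / real L) * ys i +
     vote_sum \<delta> u L (e \<circ> \<omega>) (ys \<circ> \<omega>) k (e i) / real L"

lemma abs_mix_le:
  assumes "i \<in> I" "k \<le> L"
  shows "\<bar>mix k \<omega> i\<bar> \<le> 1"
proof -
  have "\<bar>mix k \<omega> i\<bar> \<le> \<bar>(1 - real k / real L) * ys i\<bar> + \<bar>vote_sum \<delta> u L (e \<circ> \<omega>) (ys \<circ> \<omega>) k (e i) / real L\<bar>"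
    unfolding mix_def by (rule abs_triangle_ineq)
  also have "\<dots> \<le> (1 - real k / real L) + real k / real L"
    using ys[OF assms(1)] assms(2) L abs_vote_sum_le[of \<delta> u L "e \<circ> \<omega>" "ys \<circ> \<omega>" k "e i"]
    by (intro add_mono) (auto simp: abs_mult divide_right_mono)
  finally show ?thesis by simp
qed

text \<open>The step is \<open>z / L\<close> with \<open>z = b - ys\<close>. Since \<open>b\<close>
  minimises the estimated linear form coordinatewise, \<open>h i * z i\<close> is nonpositive for
  every \<open>i\<close>, and only the estimation error of the gradient remains. With
  \<open>z\<close> bounded by 2 it enters with factor 2 * 2 / L, and the quadratic term is at most
  \<open>4 * M / L\<^sup>2\<close>.\<close>

lemma Q_mix_step:
  assumes "k < L" "\<And>t. t \<in> {k * L\<^sup>2..<Suc k * L\<^sup>2} \<Longrightarrow> \<omega> t \<in> I"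
  shows "Q (mix (Suc k) \<omega>) \<le> Q (mix k \<omega>) +
    4 / L * (\<Sum>i\<in>I. \<bar>row (mix k \<omega>) i - est {k * L\<^sup>2..<Suc k * L\<^sup>2} \<omega> (mix k \<omega>) i\<bar>) + 4 * M / L\<^sup>2"
proof -
  let ?B = "{k * L\<^sup>2..<Suc k * L\<^sup>2}" and ?y = "mix k \<omega>"
  define h where "h i = (\<Sum>t\<in>?B. \<delta> (e i) (e (\<omega> t)) / u (e (\<omega> t)) * ?y (\<omega> t))" for i
  define z where "z i = (if h i > 0 then -1 else 1) - ys i" for i
  have hest: "est ?B \<omega> ?y i = U / L\<^sup>2 * h i" for i
  proof -
    have "(\<Sum>t\<in>?B. \<delta> (e i) (e (\<omega> t)) / pmf q (\<omega> t) * ?y (\<omega> t)) = U * h i"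
      unfolding h_def sum_distrib_left
      using assms(2) u U by (intro sum.cong refl) simp
    then show ?thesis unfolding est_def using L by simp
  qed
  have step: "mix (Suc k) \<omega> = (\<lambda>i. ?y i + 1 / L * z i)"
    unfolding mix_def[of "Suc k"] z_def h_def
    using L by (auto simp: mix_def fun_eq_iff field_simps)
  have zb: "\<bar>z i\<bar> \<le> 2" and hz: "h i * z i \<le> 0" if "i \<in> I" for i
    using ys[OF that] by (auto simp: z_def mult_nonneg_nonpos mult_nonpos_nonneg)
  have "(\<Sum>i\<in>I. row ?y i * z i) \<le> (\<Sum>i\<in>I. 2 * \<bar>row ?y i - est ?B \<omega> ?y i\<bar>)"
  proof (rule sum_mono)
    fix i assume i: "i \<in> I"
    have "row ?y i * z i = (row ?y i - est ?B \<omega> ?y i) * z i + U / L\<^sup>2 * (h i * z i)"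
      unfolding hest by (simp add: algebra_simps)
    also have "\<dots> \<le> \<bar>row ?y i - est ?B \<omega> ?y i\<bar> * \<bar>z i\<bar> + 0"
      using hz[OF i] U by (intro add_mono) (auto simp: mult_nonneg_nonpos divide_nonpos_nonneg simp flip: abs_mult)
    also have "\<dots> \<le> \<bar>row ?y i - est ?B \<omega> ?y i\<bar> * 2 + 0"
      using zb[OF i] by (intro add_mono mult_left_mono) auto
    finally show "row ?y i * z i \<le> 2 * \<bar>row ?y i - est ?B \<omega> ?y i\<bar>" by simp
  qed
  moreover have "Q z \<le> 4 * M" using abs_Q_le[of z 2] zb by auto
  ultimately have "Q ?y + 2 * (1 / L) * (\<Sum>i\<in>I. row ?y i * z i) + (1 / L)\<^sup>2 * Q z \<le>
    Q ?y + 2 * (1 / L) * (\<Sum>i\<in>I. 2 * \<bar>row ?y i - est ?B \<omega> ?y i\<bar>) + (1 / L)\<^sup>2 * (4 * M)"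
    using L by (intro add_mono mult_left_mono) auto
  then show ?thesis unfolding step Q_add by (simp add: sum_distrib_left[symmetric] power_divide)
qed

lemma mix_cong:
  assumes "\<And>t. t < k * L\<^sup>2 \<Longrightarrow> \<omega> t = \<omega>' t"
  shows "mix k \<omega> = mix k \<omega>'"
  unfolding mix_def using assms by (intro ext arg_cong2[where f = "(+)"] refl arg_cong2[where f = "(/)"] vote_sum_cong) auto

lemma set_Pi_q:
  assumes "\<omega> \<in> set_pmf (Pi_pmf S d (\<lambda>_. q))" "finite S" "t \<in> S"
  shows "\<omega> t \<in> I"
  using assms set_q by (auto simp: set_Pi_pmf PiE_dflt_def)

text \<open>Conditioned on all samples outside block \<open>k\<close> the iterate is fixed, so
  \<open>E_est_error\<close> applies to the block. The errors sum to \<open>M / L\<close> since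
  \<open>q\<close> has total mass 1; this gives half of \<open>8 * M / L\<^sup>2\<close>, the
  quadratic term the other half.\<close>

lemma E_Q_mix_step:
  assumes "finite S" "{..<Suc k * L\<^sup>2} \<subseteq> S" "k < L"
  shows "\<E> (Pi_pmf S d (\<lambda>_. q)) (\<lambda>\<omega>. Q (mix (Suc k) \<omega>)) \<le> \<E> (Pi_pmf S d (\<lambda>_. q)) (\<lambda>\<omega>. Q (mix k \<omega>)) + 8 * M / L\<^sup>2"
proof -
  let ?P = "Pi_pmf S d (\<lambda>_. q)" and ?B = "{k * L\<^sup>2..<Suc k * L\<^sup>2}"
  have BS: "?B \<subseteq> S" using assms(2) by auto
  have finP: "finite (set_pmf (Pi_pmf T d (\<lambda>_. q)))" if "finite T" for T :: "nat set"
    using that fin_q by (intro finite_set_Pi_pmf) auto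
  note int = integrable_measure_pmf_finite[OF finP]
  have err: "\<E> ?P (\<lambda>\<omega>. \<bar>row (mix k \<omega>) i - est ?B \<omega> (mix k \<omega>) i\<bar>) \<le> M * pmf q i / L" if i: "i \<in> I" for i
  proof -
    have "\<E> ?P (\<lambda>\<omega>. \<bar>row (mix k \<omega>) i - est ?B \<omega> (mix k \<omega>) i\<bar>) =
      \<E> (Pi_pmf ((S - ?B) \<union> ?B) d (\<lambda>_. q)) (\<lambda>\<omega>. \<bar>row (mix k \<omega>) i - est ?B \<omega> (mix k \<omega>) i\<bar>)"
      using BS by (simp add: Un_absorb2)
    also have "\<dots> = \<E> (Pi_pmf (S - ?B) d (\<lambda>_. q)) (\<lambda>f. \<E> (Pi_pmf ?B d (\<lambda>_. q)) (\<lambda>g.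
        \<bar>row (mix k (\<lambda>x. if x \<in> S - ?B then f x else g x)) i -
          est ?B (\<lambda>x. if x \<in> S - ?B then f x else g x) (mix k (\<lambda>x. if x \<in> S - ?B then f x else g x)) i\<bar>))"
      using assms fin_q by (intro expectation_Pi_split) auto
    also have "\<dots> = \<E> (Pi_pmf (S - ?B) d (\<lambda>_. q)) (\<lambda>f. \<E> (Pi_pmf ?B d (\<lambda>_. q)) (\<lambda>g.
        \<bar>row (mix k f) i - est ?B g (mix k f) i\<bar>))"
    proof -
      have m: "mix k (\<lambda>x. if x \<in> S - ?B then f x else g x) = mix k f" for f g
      proof (rule mix_cong)
        fix t assume "t < k * L\<^sup>2"
        then have "t \<in> S - ?B" using assms(2) by (auto simp: subset_iff)
        then show "(if t \<in> S - ?B then f t else g t) = f t" by simp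
      qed
      have "est ?B (\<lambda>x. if x \<in> S - ?B then f x else g x) y i = est ?B g y i" for f g y
        unfolding est_def by (intro arg_cong2[where f = "(/)"] sum.cong) auto
      then show ?thesis by (simp only: m)
    qed
    also have "\<dots> \<le> \<E> (Pi_pmf (S - ?B) d (\<lambda>_. q)) (\<lambda>f. M * pmf q i / L)"
      using i assms abs_mix_le by (intro expectation_mono_finite finP E_est_error) (auto simp: algebra_simps)
    finally show ?thesis by simp
  qed
  have "\<E> ?P (\<lambda>\<omega>. Q (mix (Suc k) \<omega>)) \<le> \<E> ?P (\<lambda>\<omega>. Q (mix k \<omega>) +
    4 / L * (\<Sum>i\<in>I. \<bar>row (mix k \<omega>) i - est ?B \<omega> (mix k \<omega>) i\<bar>) + 4 * M / L\<^sup>2)"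
    using assms BS by (intro expectation_mono_finite finP Q_mix_step) (auto dest!: set_Pi_q)
  also have "\<dots> = \<E> ?P (\<lambda>\<omega>. Q (mix k \<omega>)) +
    4 / L * (\<Sum>i\<in>I. \<E> ?P (\<lambda>\<omega>. \<bar>row (mix k \<omega>) i - est ?B \<omega> (mix k \<omega>) i\<bar>)) + 4 * M / L\<^sup>2"
    using assms(1) by (simp add: int)
  also have "\<dots> \<le> \<E> ?P (\<lambda>\<omega>. Q (mix k \<omega>)) + 4 / L * (\<Sum>i\<in>I. M * pmf q i / L) + 4 * M / L\<^sup>2"
    using err by (intro add_mono mult_left_mono sum_mono) auto
  also have "(\<Sum>i\<in>I. M * pmf q i / L) = M / L"
    by (simp add: sum_q flip: sum_distrib_left sum_divide_distrib)
  finally show ?thesis by (simp add: power2_eq_square)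
qed

lemma E_Q_mix:
  assumes "finite S" "{..<L ^ 3} \<subseteq> S"
  shows "\<E> (Pi_pmf S d (\<lambda>_. q)) (\<lambda>\<omega>. Q (mix L \<omega>)) \<le> Q ys + 8 * M / L"
proof -
  have "k \<le> L \<Longrightarrow> \<E> (Pi_pmf S d (\<lambda>_. q)) (\<lambda>\<omega>. Q (mix k \<omega>)) \<le> Q ys + real k * (8 * M / L\<^sup>2)" for k
  proof (induction k)
    case 0
    have "mix 0 \<omega> = ys" for \<omega> by (simp add: mix_def fun_eq_iff)
    then show ?case by simp
  next
    case (Suc k)
    have "Suc k * L\<^sup>2 \<le> L * L\<^sup>2" using Suc.prems by (intro mult_right_mono) auto
    then have "{..<Suc k * L\<^sup>2} \<subseteq> S" using assms(2) by (auto simp: power3_eq_cube power2_eq_square)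
    then show ?case using E_Q_mix_step[of S k d] Suc assms by (simp add: algebra_simps add_divide_distrib)
  qed
  from this[of L] show ?thesis using L by (simp add: power2_eq_square)
qed

section \<open>Selection among the guesses on fresh pairs\<close>

definition guess_cut :: "(nat \<Rightarrow> 'i) \<Rightarrow> (nat \<Rightarrow> real) \<Rightarrow> 'i \<Rightarrow> real" where
  "guess_cut \<omega> \<sigma> i = vote_sum \<delta> u L (e \<circ> \<omega>) \<sigma> L (e i) / real L"

definition pair_est :: "(nat \<Rightarrow> 'i) \<Rightarrow> ('i \<Rightarrow> real) \<Rightarrow> real" where
  "pair_est \<omega> y = (\<Sum>r<num_pairs L.
     let a = \<omega> (L ^ 3 + 2 * r); b = \<omega> (Suc (L ^ 3 + 2 * r)) in
     \<delta> (e a) (e b) / (pmf q a * pmf q b) * y a * y b) / real (num_pairs L)"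

lemma abs_guess_cut_le: "\<bar>guess_cut \<omega> \<sigma> i\<bar> \<le> 1"
  unfolding guess_cut_def using abs_vote_sum_le[of \<delta> u L "e \<circ> \<omega>" \<sigma> L "e i"] L by (simp add: field_simps)

lemma guess_cut_cong:
  assumes "\<And>t. t < L ^ 3 \<Longrightarrow> \<omega> t = \<omega>' t" "\<And>t. t < L ^ 3 \<Longrightarrow> \<sigma> t = \<sigma>' t"
  shows "guess_cut \<omega> \<sigma> = guess_cut \<omega>' \<sigma>'"
  unfolding guess_cut_def using assms
  by (intro ext arg_cong2[where f = "(/)"] refl vote_sum_cong) (auto simp: power3_eq_cube power2_eq_square)

lemma num_pairs_pos: "num_pairs L > 0" using L by (simp add: num_pairs_def)

text \<open>The unknown factor is positive and common to all guesses, so minimising the computable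
  score minimises the estimate.\<close>

lemma pair_est_score:
  assumes "\<And>t. t < num_slots L \<Longrightarrow> \<omega> t \<in> I"
  shows "pair_est \<omega> (guess_cut \<omega> \<sigma>) = U\<^sup>2 / num_pairs L * guess_score \<delta> u L (e \<circ> \<omega>) \<sigma>"
proof -
  have "(\<Sum>r<num_pairs L.
     let a = \<omega> (L ^ 3 + 2 * r); b = \<omega> (Suc (L ^ 3 + 2 * r)) in
     \<delta> (e a) (e b) / (pmf q a * pmf q b) * guess_cut \<omega> \<sigma> a * guess_cut \<omega> \<sigma> b) =
    U\<^sup>2 * guess_score \<delta> u L (e \<circ> \<omega>) \<sigma>"
    unfolding guess_score_def sum_distrib_left Let_def guess_cut_def[symmetric] o_apply
  proof (rule sum.cong[OF refl])
    fix r assume r: "r \<in> {..<num_pairs L}"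
    let ?a = "\<omega> (L ^ 3 + 2 * r)" and ?b = "\<omega> (Suc (L ^ 3 + 2 * r))"
    have "?a \<in> I" "?b \<in> I" using r by (auto intro!: assms simp: num_slots_def)
    then show "\<delta> (e ?a) (e ?b) / (pmf q ?a * pmf q ?b) * guess_cut \<omega> \<sigma> ?a * guess_cut \<omega> \<sigma> ?b =
      U\<^sup>2 * (\<delta> (e ?a) (e ?b) / (u (e ?a) * u (e ?b)) * guess_cut \<omega> \<sigma> ?a * guess_cut \<omega> \<sigma> ?b)"
      using U q_pos by (simp add: u power2_eq_square field_simps)
  qed
  then show ?thesis unfolding pair_est_def by simp
qed

lemma kernel_q:
  assumes "i \<in> I" "j \<in> I" "\<And>i. i \<in> I \<Longrightarrow> \<bar>y i\<bar> \<le> 1"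
  shows "\<bar>\<delta> (e i) (e j) / (pmf q i * pmf q j) * y i * y j\<bar> \<le> M"
proof -
  have qq: "0 < pmf q i * pmf q j" using q_pos assms by simp
  have "\<bar>\<delta> (e i) (e j) / (pmf q i * pmf q j) * y i * y j\<bar> =
    \<delta> (e i) (e j) / (pmf q i * pmf q j) * (\<bar>y i\<bar> * \<bar>y j\<bar>)"
    using nonneg[OF assms(1,2)] qq by (simp add: abs_mult)
  also have "\<dots> \<le> M * (1 * 1)"
    using kernel_le[OF assms(1,2)] nonneg[OF assms(1,2)] qq assms M
    by (intro mult_mono) (auto simp: field_simps)
  finally show ?thesis by simp
qed

lemma E_pair_kernel:
  "\<E> q (\<lambda>i. \<E> q (\<lambda>j. \<delta> (e i) (e j) / (pmf q i * pmf q j) * y i * y j)) = Q y"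
  unfolding E_q Q_def sum_distrib_right
proof (intro sum.cong refl)
  fix i j assume "i \<in> I" "j \<in> I"
  then show "\<delta> (e i) (e j) / (pmf q i * pmf q j) * y i * y j * pmf q j * pmf q i = \<delta> (e i) (e j) * y i * y j"
    using q_pos[of i] q_pos[of j] by (simp add: field_simps)
qed

lemma E_pair_est:
  "\<E> (Pi_pmf {L ^ 3..<num_slots L} d (\<lambda>_. q)) (\<lambda>\<omega>. pair_est \<omega> y) = Q y"
proof -
  let ?S = "{L ^ 3..<num_slots L}"
  let ?P = "Pi_pmf ?S d (\<lambda>_. q)"
  let ?k = "\<lambda>i j. \<delta> (e i) (e j) / (pmf q i * pmf q j) * y i * y j"
  have "finite (set_pmf ?P)" using fin_q by (intro finite_set_Pi_pmf) auto
  note int = integrable_measure_pmf_finite[OF this]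
  have one: "\<E> ?P (\<lambda>\<omega>. ?k (\<omega> a) (\<omega> b)) = Q y" if "a \<in> ?S" "b \<in> ?S" "a \<noteq> b" for a b
  proof -
    have S: "?S = insert a (insert b (?S - {a, b}))" using that by auto
    have "\<E> (Pi_pmf (insert a (insert b (?S - {a, b}))) d (\<lambda>_. q)) (\<lambda>\<omega>. ?k (\<omega> a) (\<omega> b)) =
      \<E> q (\<lambda>i. \<E> q (\<lambda>j. ?k i j))"
      using that fin_q by (simp add: expectation_Pi_insert)
    then show ?thesis using S E_pair_kernel by simp
  qed
  have "\<E> ?P (\<lambda>\<omega>. pair_est \<omega> y) = (\<Sum>r<num_pairs L. \<E> ?P (\<lambda>\<omega>. ?k (\<omega> (L ^ 3 + 2 * r)) (\<omega> (Suc (L ^ 3 + 2 * r))))) / num_pairs L"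
    unfolding pair_est_def Let_def by (simp add: int)
  also have "\<dots> = (\<Sum>r<num_pairs L. Q y) / num_pairs L"
    by (intro arg_cong2[where f = "(/)"] sum.cong one refl) (auto simp: num_slots_def)
  finally show ?thesis using num_pairs_pos by simp
qed

text \<open>The estimate averages \<open>num_pairs L\<close> independent terms, each bounded by
  \<open>M\<close>. Hoeffding's lemma with parameter \<open>l / num_pairs L\<close> applies to each
  of them and the exponents add up.\<close>

lemma E_exp_pair_est:
  assumes "\<And>i. i \<in> I \<Longrightarrow> \<bar>y i\<bar> \<le> 1" "l > 0"
  shows "\<E> (Pi_pmf {L ^ 3..<num_slots L} d (\<lambda>_. q)) (\<lambda>\<omega>. exp (l * (Q y - pair_est \<omega> y)))
    \<le> exp (l\<^sup>2 * M\<^sup>2 / (2 * num_pairs L))"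
proof -
  let ?k = "\<lambda>i j. \<delta> (e i) (e j) / (pmf q i * pmf q j) * y i * y j"
  let ?R = "num_pairs L"
  let ?G = "\<lambda>i j. exp (l / ?R * (Q y - ?k i j))"
  have "exp (l * (Q y - pair_est \<omega> y)) = (\<Prod>r<?R. ?G (\<omega> (L ^ 3 + 2 * r)) (\<omega> (Suc (L ^ 3 + 2 * r))))" for \<omega>
  proof -
    have "l * (Q y - pair_est \<omega> y) = (\<Sum>r<?R. l / ?R * (Q y - ?k (\<omega> (L ^ 3 + 2 * r)) (\<omega> (Suc (L ^ 3 + 2 * r)))))"
      unfolding pair_est_def Let_def sum_distrib_left[symmetric] sum_subtractf
      using num_pairs_pos by (simp add: field_simps)
    then show ?thesis by (simp add: exp_sum)
  qed
  then have "\<E> (Pi_pmf {L ^ 3..<num_slots L} d (\<lambda>_. q)) (\<lambda>\<omega>. exp (l * (Q y - pair_est \<omega> y))) =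
    (\<E> q (\<lambda>i. \<E> q (?G i))) ^ ?R"
    using expectation_prod_pairs_Pi[OF fin_q, of "L ^ 3" ?R d ?G] by (simp add: num_slots_def)
  also have "\<E> q (\<lambda>i. \<E> q (?G i)) = \<E> (pair_pmf q q) (\<lambda>x. exp (l / ?R * (\<E> (pair_pmf q q) (\<lambda>(i, j). ?k i j) - (case x of (i, j) \<Rightarrow> ?k i j))))"
  proof -
    have "\<E> (pair_pmf q q) (\<lambda>(i, j). ?k i j) = Q y"
      using expectation_pair_finite[OF fin_q fin_q, of "\<lambda>(i, j). ?k i j"] E_pair_kernel by simp
    then show ?thesis using fin_q by (simp only: expectation_pair_finite case_prod_conv)
  qed
  also have "(\<dots>) ^ ?R \<le> (exp ((l / ?R)\<^sup>2 * M\<^sup>2 / 2)) ^ ?R"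
  proof (rule power_mono)
    show "\<E> (pair_pmf q q) (\<lambda>x. exp (l / ?R * (\<E> (pair_pmf q q) (\<lambda>(i, j). ?k i j) - (case x of (i, j) \<Rightarrow> ?k i j)))) \<le>
      exp ((l / ?R)\<^sup>2 * M\<^sup>2 / 2)"
    proof (rule Hoeffding_lemma_finite_pmf)
      fix x assume "x \<in> set_pmf (pair_pmf q q)"
      then have "fst x \<in> I" "snd x \<in> I" using set_q by auto
      then show "\<bar>case x of (i, j) \<Rightarrow> ?k i j\<bar> \<le> M"
        using kernel_q[of "fst x" "snd x" y] assms(1) by (simp only: case_prod_beta)
    qed (use fin_q num_pairs_pos assms in auto)
  qed (auto intro!: integral_nonneg_AE)
  also have "\<dots> = exp (l\<^sup>2 * M\<^sup>2 / (2 * ?R))"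
    using num_pairs_pos by (simp add: exp_of_nat_mult[symmetric] power2_eq_square)
  finally show ?thesis .
qed

text \<open>Given the first \<open>L ^ 3\<close> samples, the cuts of all guesses are fixed. The
  guess that agrees with \<open>ys\<close> on these samples yields \<open>mix L\<close>, and the
  selected guess has no larger estimate. What remains is the expected maximum over all guesses of
  \<open>Q - pair_est\<close>, which is at most \<open>M / L\<close>.\<close>

theorem E_sample_rule:
  "\<E> (Pi_pmf {..<num_slots L} d (\<lambda>_. q)) (\<lambda>\<omega>. Q (\<lambda>i. sample_rule \<delta> u L (e \<circ> \<omega>) (e i)))
    \<le> Q ys + 9 * M / L"
proof -
  let ?A = "{..<L ^ 3}" and ?C = "{L ^ 3..<num_slots L}"
  let ?PA = "Pi_pmf ?A d (\<lambda>_. q)" and ?PC = "Pi_pmf ?C d (\<lambda>_. q)"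
  let ?R = "num_pairs L"
  \<comment> \<open>As \<open>\<rho>\<^sup>2\<close> is the number of pairs, the parameter
    \<open>l = \<rho> / M\<close> makes each exponential moment at most exp (1 / 2), and
    \<open>\<theta>\<close> bounds their sum over all guesses. Then \<open>ln \<theta> / l\<close>
    is at most \<open>M / L\<close>.\<close>
  define \<rho> where "\<rho> = real ((L ^ 3 + 1) * L)"
  define l where "l = \<rho> / M"
  define \<theta> where "\<theta> = 2 ^ (L ^ 3) * exp (1 / 2 :: real)"
  have \<rho>: "\<rho> > 0" "\<rho>\<^sup>2 = real ?R"
    unfolding \<rho>_def num_pairs_def of_nat_0_less_iff of_nat_power using L by simp_all
  have l: "l > 0" using \<rho> M by (simp add: l_def)
  have \<theta>: "\<theta> > 0" by (simp add: \<theta>_def)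
  have sp: "{..<num_slots L} = ?A \<union> ?C" by (auto simp: num_slots_def)
  have finA: "finite (set_pmf ?PA)" and finC: "finite (set_pmf ?PC)"
    using fin_q by (auto intro!: finite_set_Pi_pmf)
  note int = integrable_measure_pmf_finite[OF finA] integrable_measure_pmf_finite[OF finC]
  \<comment> \<open>The tangent of the logarithm at \<open>\<theta>\<close>. It bounds an error
    linearly by its exponential, so the maximum over guesses may be replaced by a sum inside the
    expectation.\<close>
  have tangent: "x \<le> (ln \<theta> - 1 + exp (l * x) / \<theta>) / l" for x
  proof -
    have "1 + (l * x - ln \<theta>) \<le> exp (l * x - ln \<theta>)" by (rule exp_ge_add_one_self)
    then show ?thesis using \<theta> l by (simp add: exp_diff field_simps)
  qed
  have inner: "\<E> ?PC (\<lambda>g. Q (\<lambda>i. sample_rule \<delta> u L (e \<circ> (\<lambda>x. if x \<in> ?A then f x else g x)) (e i)))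
      \<le> Q (mix L f) + M / L" if f: "f \<in> set_pmf ?PA" for f
  proof -
    let ?\<omega> = "\<lambda>g x. if x \<in> ?A then f x else g x"
    let ?\<sigma> = "restrict (ys \<circ> f) ?A"
    have fI: "\<And>t. t \<in> ?A \<Longrightarrow> f t \<in> I" using set_Pi_q[OF f] by auto
    have \<sigma>: "?\<sigma> \<in> guesses L" using fI ys by (fastforce simp: guesses_def)
    \<comment> \<open>At \<open>k = L\<close> the coefficient \<open>1 - k / L\<close> of
      \<open>ys\<close> vanishes, so \<open>ys\<close> enters only through its values on the
      samples.\<close>
    have mixf: "guess_cut f ?\<sigma> = mix L f"
      unfolding guess_cut_def mix_def using L
      by (auto simp: fun_eq_iff power3_eq_cube power2_eq_square intro!: vote_sum_cong)
    have pw: "Q (\<lambda>i. sample_rule \<delta> u L (e \<circ> ?\<omega> g) (e i)) \<le> pair_est g (mix L f) +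
      (ln \<theta> - 1 + (\<Sum>\<sigma>\<in>guesses L. exp (l * (Q (guess_cut f \<sigma>) - pair_est g (guess_cut f \<sigma>)))) / \<theta>) / l"
      if g: "g \<in> set_pmf ?PC" for g
    proof -
      let ?s = "e \<circ> ?\<omega> g"
      define best where "best = arg_min_on (guess_score \<delta> u L ?s) (guesses L)"
      have best: "best \<in> guesses L" "guess_score \<delta> u L ?s best \<le> guess_score \<delta> u L ?s ?\<sigma>"
        using arg_min_if_finite[OF finite_guesses[of L] guesses_nonempty, where f = "guess_score \<delta> u L ?s"] \<sigma>
        unfolding best_def by (auto simp: not_less)
      have \<omega>I: "?\<omega> g t \<in> I" if "t < num_slots L" for t
        using fI set_Pi_q[OF g] that by (auto simp: sp)
      have gc: "guess_cut (?\<omega> g) \<sigma> = guess_cut f \<sigma>" for \<sigma> by (intro guess_cut_cong) auto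
      have pe: "pair_est (?\<omega> g) y = pair_est g y" for y
        unfolding pair_est_def Let_def by (intro arg_cong2[where f = "(/)"] sum.cong refl) auto
      have "pair_est (?\<omega> g) (guess_cut (?\<omega> g) best) \<le> pair_est (?\<omega> g) (guess_cut (?\<omega> g) ?\<sigma>)"
        using pair_est_score[of "?\<omega> g"] \<omega>I best(2) U by (simp add: divide_right_mono mult_left_mono)
      then have le: "pair_est g (guess_cut f best) \<le> pair_est g (mix L f)"
        by (simp only: gc pe mixf)
      have "Q (\<lambda>i. sample_rule \<delta> u L ?s (e i)) = Q (guess_cut f best)"
        unfolding sample_rule_def best_def[symmetric] gc[symmetric] guess_cut_def ..
      also have "\<dots> \<le> pair_est g (mix L f) + (Q (guess_cut f best) - pair_est g (guess_cut f best))"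
        using le by simp
      also have "\<dots> \<le> pair_est g (mix L f) + (ln \<theta> - 1 + exp (l * (Q (guess_cut f best) - pair_est g (guess_cut f best))) / \<theta>) / l"
        by (intro add_left_mono tangent)
      also have "\<dots> \<le> pair_est g (mix L f) +
          (ln \<theta> - 1 + (\<Sum>\<sigma>\<in>guesses L. exp (l * (Q (guess_cut f \<sigma>) - pair_est g (guess_cut f \<sigma>)))) / \<theta>) / l"
        using \<theta> l best(1)
        by (intro add_left_mono divide_right_mono) (auto intro!: member_le_sum finite_guesses)
      finally show ?thesis .
    qed
    have ex: "\<E> ?PC (\<lambda>g. exp (l * (Q (guess_cut f \<sigma>) - pair_est g (guess_cut f \<sigma>)))) \<le> exp (1 / 2)" for \<sigma>
    proof -
      have "l\<^sup>2 * M\<^sup>2 / (2 * ?R) = 1 / 2"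
        unfolding l_def power_divide \<rho>(2) using M num_pairs_pos by simp
      moreover have "\<E> ?PC (\<lambda>g. exp (l * (Q (guess_cut f \<sigma>) - pair_est g (guess_cut f \<sigma>)))) \<le> exp (l\<^sup>2 * M\<^sup>2 / (2 * ?R))"
        by (intro E_exp_pair_est abs_guess_cut_le l)
      ultimately show ?thesis by (simp only:)
    qed
    have "\<E> ?PC (\<lambda>g. Q (\<lambda>i. sample_rule \<delta> u L (e \<circ> ?\<omega> g) (e i))) \<le>
      \<E> ?PC (\<lambda>g. pair_est g (mix L f) +
      (ln \<theta> - 1 + (\<Sum>\<sigma>\<in>guesses L. exp (l * (Q (guess_cut f \<sigma>) - pair_est g (guess_cut f \<sigma>)))) / \<theta>) / l)"
      using finC pw by (rule expectation_mono_finite)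
    also have "\<dots> = Q (mix L f) + (ln \<theta> - 1 +
      (\<Sum>\<sigma>\<in>guesses L. \<E> ?PC (\<lambda>g. exp (l * (Q (guess_cut f \<sigma>) - pair_est g (guess_cut f \<sigma>))))) / \<theta>) / l"
      by (simp add: int E_pair_est)
    also have "\<dots> \<le> Q (mix L f) + (ln \<theta> - 1 + (\<Sum>\<sigma>\<in>guesses L. exp (1 / 2)) / \<theta>) / l"
      using \<theta> l ex by (intro add_left_mono divide_right_mono sum_mono) auto
    also have "(\<Sum>\<sigma>\<in>guesses L. exp (1 / 2)) / \<theta> = 1" using \<theta> by (simp add: card_guesses \<theta>_def)
    also have "(ln \<theta> - 1 + 1) / l \<le> M / L"
    proof -
      have "ln \<theta> = real (L ^ 3) * ln 2 + 1 / 2" by (simp add: \<theta>_def ln_mult ln_realpow)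
      also have "\<dots> \<le> real (L ^ 3) * 1 + 1" using ln_2_less_1 by (intro add_mono mult_left_mono) auto
      finally have "ln \<theta> / l \<le> (real (L ^ 3) + 1) / l" using l by (intro divide_right_mono) auto
      also have "\<dots> = M / L"
      proof -
        have "real (L ^ 3) + 1 > 0" by (simp add: add_nonneg_pos)
        then have "(real (L ^ 3) + 1) / ((real (L ^ 3) + 1) * L / M) = M / L" using M L by simp
        moreover have "real ((L ^ 3 + 1) * L) = (real (L ^ 3) + 1) * L" by (simp add: algebra_simps)
        ultimately show ?thesis unfolding l_def \<rho>_def by (simp only:)
      qed
      finally show ?thesis by simp
    qed
    finally show ?thesis by (simp only: add_le_cancel_left)
  qed
  have "\<E> (Pi_pmf {..<num_slots L} d (\<lambda>_. q)) (\<lambda>\<omega>. Q (\<lambda>i. sample_rule \<delta> u L (e \<circ> \<omega>) (e i))) =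
    \<E> ?PA (\<lambda>f. \<E> ?PC (\<lambda>g. Q (\<lambda>i. sample_rule \<delta> u L (e \<circ> (\<lambda>x. if x \<in> ?A then f x else g x)) (e i))))"
    unfolding sp using fin_q by (intro expectation_Pi_split) auto
  also have "\<dots> \<le> \<E> ?PA (\<lambda>f. Q (mix L f) + M / L)"
    using finA inner by (rule expectation_mono_finite)
  also have "\<dots> = \<E> ?PA (\<lambda>f. Q (mix L f)) + M / L" by (simp add: int)
  also have "\<dots> \<le> Q ys + 8 * M / L + M / L" by (intro add_right_mono E_Q_mix) auto
  finally show ?thesis by simp
qed

end

section \<open>Weighted sampling on a tree of machines\<close>

definition chunks :: "nat \<Rightarrow> 'a list \<Rightarrow> 'a list list" where
  "chunks c xs = map (\<lambda>a. take c (drop (a * c) xs)) [0..<length xs div c]"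

lemma length_concat_uniform: "(\<And>x. x \<in> set xss \<Longrightarrow> length x = c) \<Longrightarrow> length (concat xss) = length xss * c"
  by (induction xss) auto

lemma drop_concat_uniform:
  assumes "\<And>x. x \<in> set xss \<Longrightarrow> length x = c"
  shows "drop (a * c) (concat xss) = concat (drop a xss)"
  using assms
proof (induction a arbitrary: xss)
  case (Suc a)
  then show ?case by (cases xss) auto
qed simp

lemma take_drop_concat_uniform:
  assumes "\<And>x. x \<in> set xss \<Longrightarrow> length x = c" "a < length xss"
  shows "take c (drop (a * c) (concat xss)) = xss ! a"
  using assms(2) drop_concat_uniform[OF assms(1), of xss a] assms(1)
  by (simp add: Cons_nth_drop_Suc[symmetric])

lemma chunks_concat:
  assumes "\<And>x. x \<in> set xss \<Longrightarrow> length x = c" "c > 0"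
  shows "chunks c (concat xss) = xss"
  using assms by (intro nth_equalityI)
    (auto simp: chunks_def length_concat_uniform take_drop_concat_uniform)

section \<open>Messages and the communication pattern of the tree\<close>

abbreviation filler :: "nat \<Rightarrow> mpc_word list" where
  "filler d \<equiv> replicate d (Bits 0)"

definition msg_enc :: "nat \<Rightarrow> nat \<Rightarrow> (nat \<Rightarrow> mpc_word list) \<Rightarrow> mpc_word list" where
  "msg_enc T V f = Bits V # concat (map f [0..<T])"

definition msg_val :: "mpc_word list \<Rightarrow> nat" where
  "msg_val M = (case M of Bits v # _ \<Rightarrow> v | _ \<Rightarrow> 0)"

definition msg_slot :: "nat \<Rightarrow> mpc_word list \<Rightarrow> nat \<Rightarrow> mpc_word list" where
  "msg_slot d M t = take d (drop (Suc (t * d)) M)"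

lemma msg_val_enc [simp]: "msg_val (msg_enc T V f @ xs) = V" "msg_val (msg_enc T V f) = V"
  by (simp_all add: msg_val_def msg_enc_def)

lemma length_msg_enc:
  assumes "\<And>t. t < T \<Longrightarrow> length (f t) = d"
  shows "length (msg_enc T V f) = Suc (T * d)"
proof -
  have "length x = d" if "x \<in> set (map f [0..<T])" for x using assms that by auto
  then have "length (concat (map f [0..<T])) = length (map f [0..<T]) * d" by (rule length_concat_uniform)
  then show ?thesis by (simp add: msg_enc_def)
qed

lemma msg_slot_enc:
  assumes "\<And>t. t < T \<Longrightarrow> length (f t) = d" "t < T"
  shows "msg_slot d (msg_enc T V f) t = f t"
proof -
  have "length x = d" if "x \<in> set (map f [0..<T])" for x using assms that by auto
  then have "take d (drop (t * d) (concat (map f [0..<T]))) = map f [0..<T] ! t"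
    using assms(2) by (intro take_drop_concat_uniform) auto
  then show ?thesis using assms(2) by (simp add: msg_slot_def msg_enc_def)
qed

lemma msg_slot_append:
  assumes "length M = Suc (T * d)" "t < T"
  shows "msg_slot d (M @ xs) t = msg_slot d M t"
proof -
  have "Suc t * d \<le> T * d" using assms by (intro mult_right_mono) auto
  then show ?thesis using assms by (simp add: msg_slot_def)
qed

lemma set_msg_slot: "set (msg_slot d M t) \<subseteq> set M"
  by (auto simp: msg_slot_def dest: in_set_takeD in_set_dropD)

lemma msg_enc_cong: "(\<And>t. t < T \<Longrightarrow> f t = g t) \<Longrightarrow> msg_enc T V f = msg_enc T V g"
  by (auto simp: msg_enc_def intro!: arg_cong[of _ _ concat])

text \<open>Every phase ships \<open>T\<close> slots, even if it only uses one slot or the total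
  \<open>V\<close>. The uniform length lets a machine split its inbox by \<open>take\<close> and
  \<open>drop\<close>.\<close>

definition sample_msg :: "nat \<Rightarrow> nat \<Rightarrow> nat \<Rightarrow> (nat \<Rightarrow> (nat \<times> mpc_word list) list) \<Rightarrow> mpc_word list pmf" where
  "sample_msg d T V ws = map_pmf (msg_enc T V) (Pi_pmf {..<T} (filler d) (\<lambda>t. wpick (filler d) (ws t)))"

definition leaf_msg :: "nat \<Rightarrow> nat \<Rightarrow> (mpc_word list \<Rightarrow> nat) \<Rightarrow> mpc_word list list \<Rightarrow> mpc_word list pmf" where
  "leaf_msg d T v ps = sample_msg d T (\<Sum>p\<leftarrow>ps. v p) (\<lambda>_. map (\<lambda>p. (v p, p)) ps)"

definition merge_msgs :: "nat \<Rightarrow> nat \<Rightarrow> mpc_word list list \<Rightarrow> mpc_word list pmf" where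
  "merge_msgs d T Ms =
     sample_msg d T (\<Sum>M\<leftarrow>Ms. msg_val M) (\<lambda>t. map (\<lambda>M. (msg_val M, msg_slot d M t)) Ms)"

text \<open>The machines form a tree of fan-out \<open>b\<close> in which each group of
  \<open>b ^ r\<close> consecutive machines is represented by its first member.\<close>

definition head :: "nat \<Rightarrow> nat \<Rightarrow> nat \<Rightarrow> nat" where
  "head b r k = k div b ^ r * b ^ r"

text \<open>The self-addressed \<open>sh\<close> keeps the shared words alive. Inboxes are ordered
  by sender, and a head is the least sender to itself; with \<open>sh\<close> in front of its own
  message, the shared words form a prefix of its inbox.\<close>

definition up_out :: "nat \<Rightarrow> nat \<Rightarrow> nat \<Rightarrow> mpc_word list \<Rightarrow> mpc_word list \<Rightarrow> nat \<Rightarrow> mpc_word list" where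
  "up_out b r k sh M l = (if l = k then sh else []) @ (if b ^ r dvd k \<and> head b (Suc r) k = l then M else [])"

text \<open>Here the sender of \<open>M\<close> is a head, of index at most that of the receiver.
  With \<open>M\<close> in front, the new message precedes the older ones also when both machines
  coincide.\<close>

definition down_out :: "nat \<Rightarrow> nat \<Rightarrow> nat \<Rightarrow> mpc_word list \<Rightarrow> mpc_word list \<Rightarrow> nat \<Rightarrow> mpc_word list" where
  "down_out b r k sh M l = (if b ^ r dvd l \<and> head b (Suc r) l = k then M else []) @ (if l = k then sh else [])"

text \<open>A phase lasts \<open>2 * h\<close> rounds and begins with the \<open>j\<close> earlier
  messages in every inbox. Round 0 samples locally, rounds up to \<open>h\<close> merge, round
  \<open>h\<close> also starts the descent at the root, and later rounds relay. All machines compute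
  a candidate \<open>M\<close>; the routing functions send it only where it belongs.\<close>

definition tree_step ::
  "nat \<Rightarrow> nat \<Rightarrow> nat \<Rightarrow> nat \<Rightarrow> (nat \<Rightarrow> mpc_word list \<Rightarrow> mpc_word list \<Rightarrow> nat) \<Rightarrow>
   nat \<Rightarrow> nat \<Rightarrow> mpc_word list \<Rightarrow> mpc_word list \<Rightarrow> (mpc_word list \<times> (nat \<Rightarrow> mpc_word list)) pmf" where
  "tree_step b h d T wt t k mem inb =
    (let j = t div (2 * h); r = t mod (2 * h); len = Suc (T * d); sh = take (j * len) inb in
     if r \<le> h then
       map_pmf (\<lambda>M. (mem, if r < h then up_out b r k sh M else down_out b (h - 1) k sh M))
         (if r = 0 then leaf_msg d T (wt j sh) (chunks d mem)
          else merge_msgs d T (chunks len (drop (j * len) inb)))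
     else return_pmf (mem, down_out b (2 * h - r - 1) k
            (if b ^ (2 * h - r) dvd k then drop len inb else inb) (take len inb)))"

lemma head_le: "head b r k \<le> k"
  by (simp add: head_def)

lemma dvd_head: "b ^ r dvd head b r k"
  by (simp add: head_def)

lemma head_0 [simp]: "head b 0 k = k"
  by (simp add: head_def)

lemma head_head: "b > 0 \<Longrightarrow> head b (Suc r) (head b r k) = head b (Suc r) k"
  by (simp add: head_def div_mult2_eq mult.commute[of b])

lemma concat_up:
  assumes "\<And>i. C i \<Longrightarrow> k \<le> i"
  shows "concat (map (\<lambda>i. (if k = i then sh else []) @ (if C i then M i else [])) [0..<m]) =
    (if k < m then sh else []) @ concat (map M (filter C [0..<m]))"
proof (induction m)
  case (Suc m)
  have "filter C [0..<m] = []" if "m \<le> k" using assms that by (fastforce simp: filter_empty_conv)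
  then show ?case using Suc by auto
qed simp

lemma concat_down:
  assumes "c \<le> k"
  shows "concat (map (\<lambda>i. (if Z \<and> c = i then M else []) @ (if k = i then sh else [])) [0..<m]) =
    (if Z \<and> c < m then M else []) @ (if k < m then sh else [])"
  using assms by (induction m) auto

lemma mset_concat_distinct:
  assumes "distinct xs"
  shows "mset (concat (map g xs)) = (\<Sum>x\<in>set xs. mset (g x))"
  using assms by (induction xs) auto

lemma sum_list_concat_map: "sum_list (map f (concat (map g xs))) = (\<Sum>x\<leftarrow>xs. sum_list (map f (g x)))"
  by (induction xs) auto

lemma filter_eq_upt: "k < m \<Longrightarrow> filter (\<lambda>i. i = k) [0..<m] = [k]"
  by (induction m) (auto simp: filter_empty_conv less_Suc_eq)

lemma tree_step_merge:
  assumes "t div (2 * h) = j" "t mod (2 * h) = r" "length sh = j * Suc (T * d)" "r \<noteq> 0" "r \<le> h"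
  shows "tree_step b h d T wt t k mem (sh @ xs) =
    map_pmf (\<lambda>M. (mem, if r < h then up_out b r k sh M else down_out b (h - 1) k sh M))
      (merge_msgs d T (chunks (Suc (T * d)) xs))"
proof -
  have td: "take (j * Suc (T * d)) (sh @ xs) = sh" "drop (j * Suc (T * d)) (sh @ xs) = xs"
    using assms(3) by (simp_all del: mult_Suc_right)
  show ?thesis unfolding tree_step_def Let_def assms(1,2) td using assms(4,5) by simp
qed

section \<open>Exact law of the tree protocol\<close>

locale tree =
  fixes P :: mpc_params and A :: mpc_algorithm and b h T :: nat
    and wt :: "nat \<Rightarrow> mpc_word list \<Rightarrow> mpc_word list \<Rightarrow> nat"
    and ps :: "nat \<Rightarrow> mpc_word list list"
  assumes b: "b > 0" and h: "h > 0" and m_le: "num_machines P \<le> b ^ h" and m_pos: "num_machines P > 0"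
    and d: "dimension P > 0"
    and step_A: "mpc_step A P = tree_step b h (dimension P) T wt"
    and length_ps: "\<And>k p. p \<in> set (ps k) \<Longrightarrow> length p = dimension P"
begin

abbreviation "m \<equiv> num_machines P"
abbreviation "d \<equiv> dimension P"
abbreviation "len \<equiv> Suc (T * d)"
abbreviation "PS \<equiv> concat (map ps [0..<m])"

definition children :: "nat \<Rightarrow> nat \<Rightarrow> nat list" where
  "children r k = filter (\<lambda>i. b ^ r dvd i \<and> head b (Suc r) i = k) [0..<m]"

definition W :: "nat \<Rightarrow> mpc_word list \<Rightarrow> nat \<Rightarrow> (nat \<times> mpc_word list) list" where
  "W j sh k = map (\<lambda>p. (wt j sh p, p)) (ps k)"

text \<open>The weighted points of the subtree of \<open>k\<close> at level \<open>r\<close>; empty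
  if \<open>k\<close> is not a head at this level.\<close>

definition ws :: "nat \<Rightarrow> mpc_word list \<Rightarrow> nat \<Rightarrow> nat \<Rightarrow> (nat \<times> mpc_word list) list" where
  "ws j sh r k = concat (map (W j sh) (filter (\<lambda>i. head b r i = k) [0..<m]))"

definition val :: "nat \<Rightarrow> mpc_word list \<Rightarrow> nat \<Rightarrow> nat \<Rightarrow> nat" where
  "val j sh r k = sum_list (map fst (ws j sh r k))"

text \<open>Machines that are not heads are included and hold fillers, so the product has the same
  index set on every level.\<close>

definition slots :: "nat \<Rightarrow> mpc_word list \<Rightarrow> nat \<Rightarrow> (nat \<times> nat \<Rightarrow> mpc_word list) pmf" where
  "slots j sh r = Pi_pmf ({..<m} \<times> {..<T}) (filler d) (\<lambda>(k, t). wpick (filler d) (ws j sh r k))"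

definition msgs :: "nat \<Rightarrow> mpc_word list \<Rightarrow> nat \<Rightarrow> (nat \<times> nat \<Rightarrow> mpc_word list) \<Rightarrow> nat \<Rightarrow> mpc_word list" where
  "msgs j sh r f k = msg_enc T (val j sh r k) (\<lambda>t. f (k, t))"

definition start :: "mpc_word list \<Rightarrow> mpc_config" where
  "start sh = (\<lambda>k. if k < m then (concat (ps k), sh) else ([], []))"

definition upc :: "nat \<Rightarrow> mpc_word list \<Rightarrow> (nat \<Rightarrow> mpc_word list) \<Rightarrow> mpc_config" where
  "upc r sh M = (\<lambda>k. if k < m then (concat (ps k), sh @ concat (map M (children r k))) else ([], []))"

definition dnc :: "nat \<Rightarrow> mpc_word list \<Rightarrow> mpc_word list \<Rightarrow> mpc_config" where
  "dnc r sh M = (\<lambda>k. if k < m then (concat (ps k), (if b ^ r dvd k then M else []) @ sh) else ([], []))"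

text \<open>The law of the configuration before round \<open>r\<close> of a phase. On the way up it
  comes from independent samples of all subtrees, on the way down only from the message of the
  root.\<close>

definition phase :: "nat \<Rightarrow> mpc_word list \<Rightarrow> nat \<Rightarrow> mpc_config pmf" where
  "phase j sh r =
    (if r = 0 then return_pmf (start sh)
     else if r \<le> h then map_pmf (\<lambda>f. upc (r - 1) sh (msgs j sh (r - 1) f)) (slots j sh (r - 1))
     else map_pmf (dnc (2 * h - r) sh) (leaf_msg d T (wt j sh) PS))"

text \<open>The reference process, in which a single machine holds all points. The tree reproduces
  its law exactly, so the analysis of the cut need not mention the tree.\<close>

primrec ideal :: "nat \<Rightarrow> mpc_word list pmf" where
  "ideal 0 = return_pmf []"
| "ideal (Suc j) = bind_pmf (ideal j) (\<lambda>sh. map_pmf (\<lambda>M. M @ sh) (leaf_msg d T (wt j sh) PS))"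

definition step_law :: "nat \<Rightarrow> mpc_config \<Rightarrow> mpc_config pmf" where
  "step_law t c = map_pmf (mpc_deliver P)
     (Pi_pmf {..<m} ([], \<lambda>_. []) (\<lambda>k. mpc_step A P t k (fst (c k)) (snd (c k))))"

lemma deliver_up:
  assumes "\<And>k. k < m \<Longrightarrow> F k = (concat (ps k), up_out b r k sh (M k))"
  shows "mpc_deliver P F = upc r sh M"
proof
  fix k
  have "concat (map (\<lambda>i. snd (F i) k) [0..<m]) = concat (map (\<lambda>i. (if k = i then sh else []) @
      (if b ^ r dvd i \<and> head b (Suc r) i = k then M i else [])) [0..<m])"
    using assms by (intro arg_cong[of _ _ concat] map_cong) (auto simp: up_out_def)
  also have "\<dots> = (if k < m then sh else []) @ concat (map M (children r k))"
    unfolding children_def by (rule concat_up) (use head_le in blast)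
  finally show "mpc_deliver P F k = upc r sh M k"
    using assms by (simp add: mpc_deliver_def upc_def)
qed

lemma deliver_down:
  assumes "\<And>k. k < m \<Longrightarrow> fst (F k) = concat (ps k)"
    and "\<And>k l. k < m \<Longrightarrow> l < m \<Longrightarrow> snd (F k) l = down_out b r k sh M l"
  shows "mpc_deliver P F = dnc r sh M"
proof
  fix k
  have "concat (map (\<lambda>i. snd (F i) k) [0..<m]) = (if b ^ r dvd k then M else []) @ sh" if "k < m"
  proof -
    have "concat (map (\<lambda>i. snd (F i) k) [0..<m]) = concat (map (\<lambda>i.
        (if b ^ r dvd k \<and> head b (Suc r) k = i then M else []) @ (if k = i then sh else [])) [0..<m])"
      using assms that by (intro arg_cong[of _ _ concat] map_cong) (auto simp: down_out_def)
    also have "\<dots> = (if b ^ r dvd k \<and> head b (Suc r) k < m then M else []) @ (if k < m then sh else [])"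
      by (rule concat_down[OF head_le])
    finally show ?thesis using that head_le[of b "Suc r" k] by auto
  qed
  then show "mpc_deliver P F k = dnc r sh M k"
    using assms by (simp add: mpc_deliver_def dnc_def)
qed

text \<open>The machines below \<open>k\<close> are partitioned by their heads one level lower.
  Multisets suffice since a weighted pick ignores the order of its list.\<close>

lemma mset_ws_children: "mset (concat (map (ws j sh r) (children r k))) = mset (ws j sh (Suc r) k)"
proof -
  let ?S = "{i. i < m \<and> head b (Suc r) i = k}"
  have ws: "mset (ws j sh r k) = (\<Sum>i\<in>{i. i < m \<and> head b r i = k}. mset (W j sh i))" for r k
    unfolding ws_def by (subst mset_concat_distinct) (auto intro!: sum.cong)
  have "mset (concat (map (ws j sh r) (children r k))) =
    (\<Sum>c\<in>set (children r k). \<Sum>i\<in>{i. i < m \<and> head b r i = c}. mset (W j sh i))"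
    by (subst mset_concat_distinct) (auto simp: ws children_def)
  also have "\<dots> = (\<Sum>c\<in>set (children r k). \<Sum>i\<in>{i\<in>?S. head b r i = c}. mset (W j sh i))"
    using head_head[OF b] by (intro sum.cong) (auto simp: children_def)
  also have "\<dots> = (\<Sum>i\<in>?S. mset (W j sh i))"
  proof (rule sum.group)
    show "head b r ` ?S \<subseteq> set (children r k)"
      using head_head[OF b] dvd_head by (auto simp: children_def intro: le_less_trans[OF head_le])
  qed (auto simp: children_def)
  finally show ?thesis by (simp add: ws)
qed

lemma sum_val_children: "(\<Sum>c\<leftarrow>children r k. val j sh r c) = val j sh (Suc r) k"
proof -
  have "val j sh (Suc r) k = sum_list (map fst (concat (map (ws j sh r) (children r k))))"
    unfolding val_def by (rule sum_list_map_cong_mset[symmetric], rule mset_ws_children)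
  also have "\<dots> = (\<Sum>c\<leftarrow>children r k. val j sh r c)"
    by (simp add: val_def sum_list_concat_map)
  finally show ?thesis by simp
qed

lemma length_slots:
  assumes "f \<in> set_pmf (slots j sh r)"
  shows "length (f (k, t)) = d"
proof -
  have "f (k, t) \<in> insert (filler d) (snd ` set (ws j sh r k))"
    using assms set_wpick[of "filler d" "ws j sh r k"]
    by (cases "k < m \<and> t < T") (auto simp: slots_def set_Pi_pmf PiE_dflt_def)
  then show ?thesis using length_ps by (auto simp: ws_def W_def)
qed

lemma msgs_restrict:
  "msg_enc T (val j sh r k) (\<lambda>t. if t < T then g (k, t) else filler d) = msgs j sh r g k"
  unfolding msgs_def by (intro msg_enc_cong) auto

lemma length_msgs: "f \<in> set_pmf (slots j sh r) \<Longrightarrow> length (msgs j sh r f k) = len"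
  unfolding msgs_def by (rule length_msg_enc) (simp add: length_slots)

lemma length_concat_msgs:
  assumes "f \<in> set_pmf (slots j sh r)"
  shows "length (concat (map (msgs j sh r f) ks)) = length ks * len"
  using length_concat_uniform[of "map (msgs j sh r f) ks" len] length_msgs[OF assms] by auto

text \<open>Slot \<open>t\<close> of \<open>k\<close> is built from slot \<open>t\<close> of its
  children. These sources are disjoint for distinct \<open>(k, t)\<close>, so the merged slots stay
  independent by \<open>Pi_pmf_group\<close>, and \<open>wpick_merge\<close> makes each an exact
  sample of its subtree. \<open>G\<close> stands for the routing that follows.\<close>

lemma merge_law:
  "bind_pmf (slots j sh r) (\<lambda>f. Pi_pmf {..<m} d' (\<lambda>k. map_pmf (G k)
      (merge_msgs d T (chunks len (concat (map (msgs j sh r f) (children r k))))))) =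
   map_pmf (\<lambda>f k. if k < m then G k (msgs j sh (Suc r) f k) else d') (slots j sh (Suc r))"
proof -
  let ?K = "{..<m} \<times> {..<T}"
  let ?X = "\<lambda>f (k, t). wpick (filler d) (map (\<lambda>c. (val j sh r c, f (c, t))) (children r k))"
  have merge: "merge_msgs d T (chunks len (concat (map (msgs j sh r f) (children r k)))) =
     map_pmf (msg_enc T (val j sh (Suc r) k)) (Pi_pmf {..<T} (filler d) (\<lambda>t. ?X f (k, t)))"
    if f: "f \<in> set_pmf (slots j sh r)" for f k
  proof -
    have "chunks len (concat (map (msgs j sh r f) (children r k))) = map (msgs j sh r f) (children r k)"
      using length_msgs[OF f] by (intro chunks_concat) auto
    moreover have "msg_slot d (msgs j sh r f c) t = f (c, t)" if "t < T" for c t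
      unfolding msgs_def using that by (intro msg_slot_enc) (auto simp: length_slots[OF f])
    ultimately show ?thesis
      unfolding merge_msgs_def sample_msg_def using sum_val_children[of j sh r k]
      by (auto simp: msgs_def o_def intro!: arg_cong2[where f = map_pmf] Pi_pmf_cong)
  qed
  have "bind_pmf (slots j sh r) (\<lambda>f. Pi_pmf {..<m} d' (\<lambda>k. map_pmf (G k)
      (merge_msgs d T (chunks len (concat (map (msgs j sh r f) (children r k))))))) =
    bind_pmf (slots j sh r) (\<lambda>f. Pi_pmf {..<m} d' (\<lambda>k.
      map_pmf (\<lambda>g. G k (msg_enc T (val j sh (Suc r) k) g)) (Pi_pmf {..<T} (filler d) (\<lambda>t. ?X f (k, t)))))"
    by (intro bind_pmf_cong refl) (simp add: merge pmf.map_comp o_def)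
  also have "\<dots> = bind_pmf (slots j sh r) (\<lambda>f. map_pmf (\<lambda>g k. if k \<in> {..<m} then
      G k (msg_enc T (val j sh (Suc r) k) (\<lambda>t. if t \<in> {..<T} then g (k, t) else filler d)) else d')
      (Pi_pmf ?K (filler d) (\<lambda>(k, t). ?X f (k, t))))"
    by (intro bind_pmf_cong refl Pi_pmf_nested) auto
  also have "\<dots> = bind_pmf (slots j sh r) (\<lambda>f. map_pmf (\<lambda>g k. if k < m then G k (msgs j sh (Suc r) g k) else d')
      (Pi_pmf ?K (filler d) (?X f)))"
    by (simp only: lessThan_iff msgs_restrict case_prod_conv)
  also have "\<dots> = map_pmf (\<lambda>g k. if k < m then G k (msgs j sh (Suc r) g k) else d')
      (bind_pmf (slots j sh r) (\<lambda>f. Pi_pmf ?K (filler d) (\<lambda>x. ?X f x)))"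
    by (simp add: map_bind_pmf)
  also have "bind_pmf (slots j sh r) (\<lambda>f. Pi_pmf ?K (filler d) (\<lambda>x. ?X f x)) = slots j sh (Suc r)"
  proof -
    let ?C = "\<lambda>(k, t). (\<lambda>c. (c, t)) ` set (children r k)"
    let ?p = "\<lambda>(k, t). wpick (filler d) (ws j sh r k)"
    have "bind_pmf (slots j sh r) (\<lambda>f. Pi_pmf ?K (filler d) (\<lambda>x. ?X f x)) =
      Pi_pmf ?K (filler d) (\<lambda>x. bind_pmf (Pi_pmf (?C x) (filler d) ?p) (\<lambda>f. ?X f x))"
      unfolding slots_def
    proof (rule Pi_pmf_group)
      show "?C x \<subseteq> {..<m} \<times> {..<T}" if "x \<in> ?K" for x using that by (auto simp: children_def)
      show "disjoint_family_on ?C ?K" by (auto simp: disjoint_family_on_def children_def)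
      show "?X f x = ?X g x" if "\<And>y. y \<in> ?C x \<Longrightarrow> f y = g y" for x f g
      proof -
        have "map (\<lambda>c. (val j sh r c, f (c, snd x))) (children r (fst x)) =
          map (\<lambda>c. (val j sh r c, g (c, snd x))) (children r (fst x))"
          using that by (auto simp: case_prod_beta)
        then show ?thesis by (simp only: case_prod_beta)
      qed
    qed auto
    also have "\<dots> = slots j sh (Suc r)"
      unfolding slots_def
    proof (rule Pi_pmf_cong[OF refl refl])
      fix x assume "x \<in> ?K"
      obtain k t where x: "x = (k, t)" by force
      let ?D = "set (children r k)"
      have "bind_pmf (Pi_pmf (?C x) (filler d) ?p) (\<lambda>f. ?X f x) =
        bind_pmf (map_pmf (\<lambda>f c. if c \<in> ?D then f (c, t) else filler d) (Pi_pmf ((\<lambda>c. (c, t)) ` ?D) (filler d) ?p))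
          (\<lambda>f. wpick (filler d) (map (\<lambda>c. (val j sh r c, f c)) (children r k)))"
        unfolding x bind_map_pmf by (auto intro!: bind_pmf_cong arg_cong2[where f = wpick])
      also have "\<dots> = bind_pmf (Pi_pmf ?D (filler d) (\<lambda>c. wpick (filler d) (ws j sh r c)))
          (\<lambda>f. wpick (filler d) (map (\<lambda>c. (val j sh r c, f c)) (children r k)))"
        by (subst Pi_pmf_reindex) (auto simp: inj_on_def)
      also have "\<dots> = wpick (filler d) (concat (map (ws j sh r) (children r k)))"
        unfolding val_def by (rule wpick_merge) auto
      also have "\<dots> = wpick (filler d) (ws j sh (Suc r) k)"
        by (rule wpick_cong_mset[OF mset_ws_children])
      finally show "bind_pmf (Pi_pmf (?C x) (filler d) ?p) (\<lambda>f. ?X f x) =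
        (case x of (k, t) \<Rightarrow> wpick (filler d) (ws j sh (Suc r) k))" by (simp add: x)
    qed
    finally show ?thesis .
  qed
  finally show ?thesis .
qed

lemma ws_0: "k < m \<Longrightarrow> ws j sh 0 k = W j sh k"
proof -
  assume k: "k < m"
  then have "filter (\<lambda>i. i = k) [0..<m] = [k]" by (rule filter_eq_upt)
  then show ?thesis by (simp add: ws_def)
qed

lemma leaf_law:
  "Pi_pmf {..<m} d' (\<lambda>k. map_pmf (G k) (leaf_msg d T (wt j sh) (ps k))) =
   map_pmf (\<lambda>f k. if k < m then G k (msgs j sh 0 f k) else d') (slots j sh 0)"
proof -
  have "leaf_msg d T (wt j sh) (ps k) = map_pmf (msg_enc T (val j sh 0 k))
      (Pi_pmf {..<T} (filler d) (\<lambda>t. wpick (filler d) (ws j sh 0 k)))" if "k < m" for k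
    using that by (simp add: leaf_msg_def sample_msg_def ws_0 val_def W_def o_def)
  then have "Pi_pmf {..<m} d' (\<lambda>k. map_pmf (G k) (leaf_msg d T (wt j sh) (ps k))) =
    Pi_pmf {..<m} d' (\<lambda>k. map_pmf (\<lambda>g. G k (msg_enc T (val j sh 0 k) g))
      (Pi_pmf {..<T} (filler d) (\<lambda>t. wpick (filler d) (ws j sh 0 k))))"
    by (intro Pi_pmf_cong) (auto simp: pmf.map_comp o_def)
  also have "\<dots> = map_pmf (\<lambda>g k. if k \<in> {..<m} then
      G k (msg_enc T (val j sh 0 k) (\<lambda>t. if t \<in> {..<T} then g (k, t) else filler d)) else d') (slots j sh 0)"
    unfolding slots_def by (rule Pi_pmf_nested) auto
  also have "\<dots> = map_pmf (\<lambda>f k. if k < m then G k (msgs j sh 0 f k) else d') (slots j sh 0)"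
    by (simp only: msgs_restrict lessThan_iff)
  finally show ?thesis .
qed

text \<open>As \<open>m \<le> b ^ h\<close>, machine 0 is the head of all machines at level
  \<open>h\<close>, so its message samples from the entire input.\<close>

lemma root_law: "map_pmf (\<lambda>f. msgs j sh h f 0) (slots j sh h) = leaf_msg d T (wt j sh) PS"
proof -
  have "head b h i = 0" if "i < m" for i using that m_le by (simp add: head_def)
  then have "filter (\<lambda>i. head b h i = 0) [0..<m] = [0..<m]" by (simp add: filter_id_conv)
  then have ws: "ws j sh h 0 = map (\<lambda>p. (wt j sh p, p)) PS"
    by (simp add: ws_def W_def[abs_def] map_concat o_def)
  have "Pi_pmf {..<T} (filler d) (\<lambda>t. wpick (filler d) (ws j sh h 0)) =
    map_pmf (\<lambda>f t. if t \<in> {..<T} then f (0, t) else filler d)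
      (Pi_pmf (Pair 0 ` {..<T}) (filler d) (\<lambda>(k, t). wpick (filler d) (ws j sh h k)))"
    by (subst Pi_pmf_reindex) (auto simp: inj_on_def)
  also have "\<dots> = map_pmf (\<lambda>f t. if t \<in> {..<T} then f (0, t) else filler d) (slots j sh h)"
    unfolding slots_def using m_pos
    by (subst Pi_pmf_subset[of "{..<m} \<times> {..<T}"]) (auto simp: pmf.map_comp o_def intro!: map_pmf_cong)
  finally have "leaf_msg d T (wt j sh) PS =
    map_pmf (\<lambda>f. msg_enc T (val j sh h 0) (\<lambda>t. if t \<in> {..<T} then f (0, t) else filler d)) (slots j sh h)"
    unfolding leaf_msg_def sample_msg_def by (simp add: val_def ws o_def pmf.map_comp)
  then show ?thesis by (auto simp: msgs_def intro!: map_pmf_cong msg_enc_cong)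
qed

lemma start_apply: "k < m \<Longrightarrow> start sh k = (concat (ps k), sh)" by (simp add: start_def)

lemma phase_step:
  assumes "length sh = j * len" "r < 2 * h"
  shows "bind_pmf (phase j sh r) (step_law (2 * h * j + r)) = phase j sh (Suc r)"
proof -
  let ?t = "2 * h * j + r"
  have tj: "?t div (2 * h) = j" "?t mod (2 * h) = r" using assms(2) h by auto
  have ch: "chunks d (concat (ps k)) = ps k" for k
    using length_ps d by (intro chunks_concat) auto
  consider "r = 0" | "0 < r" "r < h" | "r = h" | "h < r" by linarith
  then show ?thesis
  proof cases
    case 1
    have "step_law ?t (start sh) = map_pmf (mpc_deliver P) (Pi_pmf {..<m} ([], \<lambda>_. [])
        (\<lambda>k. map_pmf (\<lambda>M. (concat (ps k), up_out b 0 k sh M)) (leaf_msg d T (wt j sh) (ps k))))"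
      unfolding step_law_def
      using h assms(1) tj 1 by (intro arg_cong2[where f = map_pmf] refl Pi_pmf_cong)
        (simp_all add: step_A tree_step_def start_apply ch Let_def)
    also have "\<dots> = map_pmf (\<lambda>f. upc 0 sh (msgs j sh 0 f)) (slots j sh 0)"
      unfolding leaf_law pmf.map_comp o_def by (intro map_pmf_cong refl deliver_up) simp
    finally show ?thesis using 1 h by (simp add: phase_def bind_return_pmf)
  next
    case 2
    then obtain q where q: "r = Suc q" by (cases r) auto
    have "bind_pmf (phase j sh r) (step_law ?t) = bind_pmf (slots j sh q) (\<lambda>f. step_law ?t (upc q sh (msgs j sh q f)))"
      using 2 q by (simp add: phase_def bind_map_pmf)
    also have "\<dots> = map_pmf (mpc_deliver P) (bind_pmf (slots j sh q) (\<lambda>f. Pi_pmf {..<m} ([], \<lambda>_. [])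
        (\<lambda>k. map_pmf (\<lambda>M. (concat (ps k), up_out b r k sh M))
          (merge_msgs d T (chunks len (concat (map (msgs j sh q f) (children q k))))))))"
      unfolding step_law_def map_bind_pmf
      using assms(1) tj 2 by (intro bind_pmf_cong arg_cong2[where f = map_pmf] refl Pi_pmf_cong)
        (simp_all add: step_A tree_step_def upc_def Let_def)
    also have "\<dots> = map_pmf (\<lambda>f. upc r sh (msgs j sh r f)) (slots j sh r)"
      unfolding merge_law pmf.map_comp o_def q by (intro map_pmf_cong refl deliver_up) simp
    finally show ?thesis using 2 by (simp add: phase_def)
  next
    case 3
    define q where "q = h - 1"
    have r: "r \<noteq> 0" "r \<le> h" "\<not> r < h" "r - 1 = q" "h - 1 = q" "Suc q = h"
      "2 * h - Suc r = q" "\<not> Suc r \<le> h" "2 * h * j + h = ?t" using 3 h by (auto simp: q_def)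
    have st: "tree_step b h d T wt ?t k mem (sh @ xs) =
        map_pmf (\<lambda>M. (mem, down_out b q k sh M)) (merge_msgs d T (chunks len xs))" for k mem xs
      unfolding tree_step_merge[OF tj assms(1) r(1,2)] if_not_P[OF r(3)] r(5) ..
    have "phase j sh r = map_pmf (\<lambda>f. upc q sh (msgs j sh q f)) (slots j sh q)"
      using r(1,2,4) by (simp add: phase_def del: One_nat_def)
    then have "bind_pmf (phase j sh r) (step_law ?t) = bind_pmf (slots j sh q) (\<lambda>f. step_law ?t (upc q sh (msgs j sh q f)))"
      by (simp only: bind_map_pmf)
    also have "\<dots> = map_pmf (mpc_deliver P) (bind_pmf (slots j sh q) (\<lambda>f. Pi_pmf {..<m} ([], \<lambda>_. [])
        (\<lambda>k. map_pmf (\<lambda>M. (concat (ps k), down_out b q k sh M))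
          (merge_msgs d T (chunks len (concat (map (msgs j sh q f) (children q k))))))))"
      unfolding step_law_def map_bind_pmf
      by (intro bind_pmf_cong arg_cong2[where f = map_pmf] refl Pi_pmf_cong)
        (simp_all add: step_A upc_def st)
    also have "\<dots> = map_pmf (\<lambda>f. dnc q sh (msgs j sh h f 0)) (slots j sh h)"
      unfolding merge_law pmf.map_comp o_def r(6)
    proof (intro map_pmf_cong refl deliver_down)
      fix f k l assume kl: "k < m" "l < m"
      \<comment> \<open>All receivers have machine 0 as their head, so the merges computed by other
        machines in this round are not sent.\<close>
      have "head b (Suc q) l = 0" using kl m_le r(6) by (simp add: head_def)
      then show "snd (if k < m then (concat (ps k), down_out b q k sh (msgs j sh h f k)) else ([], \<lambda>_. [])) l =
        down_out b q k sh (msgs j sh h f 0) l" using kl by (auto simp: down_out_def)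
    qed simp
    also have "\<dots> = map_pmf (dnc q sh) (leaf_msg d T (wt j sh) PS)"
      by (simp add: root_law[symmetric] pmf.map_comp o_def)
    finally show ?thesis by (simp add: phase_def r(7,8))
  next
    case 4
    define q where "q = 2 * h - Suc r"
    have q: "2 * h - r = Suc q" "2 * h - r - 1 = q" using assms(2) by (auto simp: q_def)
    have "step_law ?t (dnc (Suc q) sh M) = return_pmf (dnc q sh M)" if "M \<in> set_pmf (leaf_msg d T (wt j sh) PS)" for M
    proof -
      have lM: "length M = len"
        using that unfolding root_law[symmetric] by (auto simp: length_msgs)
      have "step_law ?t (dnc (Suc q) sh M) = map_pmf (mpc_deliver P) (Pi_pmf {..<m} ([], \<lambda>_. [])
         (\<lambda>k. return_pmf (concat (ps k), down_out b q k sh (if b ^ Suc q dvd k then M else take len sh))))"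
        unfolding step_law_def
        using assms(1) tj 4 q lM by (intro arg_cong2[where f = map_pmf] refl Pi_pmf_cong)
          (auto simp: step_A tree_step_def dnc_def Let_def)
      also have "\<dots> = return_pmf (mpc_deliver P (\<lambda>k. if k \<in> {..<m} then
          (concat (ps k), down_out b q k sh (if b ^ Suc q dvd k then M else take len sh)) else ([], \<lambda>_. [])))"
        by (simp only: Pi_pmf_return_pmf[OF finite_lessThan] map_return_pmf)
      \<comment> \<open>The sender to a receiver is a head of level \<open>Suc q\<close> and thus
        holds \<open>M\<close>. The value \<open>take len sh\<close> of the other machines is never
        sent.\<close>
      also have "mpc_deliver P (\<lambda>k. if k \<in> {..<m} then
          (concat (ps k), down_out b q k sh (if b ^ Suc q dvd k then M else take len sh)) else ([], \<lambda>_. [])) = dnc q sh M"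
        using dvd_head[of b "Suc q"] by (intro deliver_down) (auto simp: down_out_def)
      finally show ?thesis .
    qed
    then have "bind_pmf (leaf_msg d T (wt j sh) PS) (\<lambda>M. step_law ?t (dnc (Suc q) sh M)) =
      bind_pmf (leaf_msg d T (wt j sh) PS) (\<lambda>M. return_pmf (dnc q sh M))"
      by (intro bind_pmf_cong) auto
    then show ?thesis using 4 q assms(2) by (simp add: phase_def map_pmf_def q_def bind_assoc_pmf bind_return_pmf)
  qed
qed

lemma length_leaf_PS: "M \<in> set_pmf (leaf_msg d T (wt j sh) PS) \<Longrightarrow> length M = len"
  unfolding root_law[symmetric] by (auto simp: length_msgs)

lemma length_ideal: "sh \<in> set_pmf (ideal j) \<Longrightarrow> length sh = j * len"
  by (induction j arbitrary: sh) (auto simp: length_leaf_PS)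

lemma run_Suc: "mpc_run A P x pl (Suc t) = bind_pmf (mpc_run A P x pl t) (step_law t)"
  by (simp add: step_law_def[abs_def])

lemma run_phase:
  assumes init: "mpc_init P x pl = start []" and "r \<le> 2 * h"
  shows "mpc_run A P x pl (2 * h * j + r) = bind_pmf (ideal j) (\<lambda>sh. phase j sh r)"
proof -
  have within: "r \<le> 2 * h \<Longrightarrow> mpc_run A P x pl (2 * h * j + r) = bind_pmf (ideal j) (\<lambda>sh. phase j sh r)"
    if "mpc_run A P x pl (2 * h * j) = map_pmf start (ideal j)" for j r
  proof (induction r)
    case 0
    then show ?case using that by (simp add: phase_def map_pmf_def)
  next
    case (Suc r)
    have "mpc_run A P x pl (2 * h * j + Suc r) = bind_pmf (ideal j) (\<lambda>sh. bind_pmf (phase j sh r) (step_law (2 * h * j + r)))"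
      using Suc by (simp only: add_Suc_right run_Suc) (simp add: bind_assoc_pmf)
    also have "\<dots> = bind_pmf (ideal j) (\<lambda>sh. phase j sh (Suc r))"
      using Suc.prems by (intro bind_pmf_cong refl phase_step) (auto simp: length_ideal)
    finally show ?case .
  qed
  have "mpc_run A P x pl (2 * h * j) = map_pmf start (ideal j)" for j
  proof (induction j)
    case 0
    then show ?case by (simp add: init)
  next
    case (Suc j)
    \<comment> \<open>At level 0 every machine has the message, so the phase ends in the start
      configuration of the next one, with \<open>M\<close> prepended.\<close>
    have dn: "dnc 0 sh = (\<lambda>M. start (M @ sh))" for sh by (auto simp: dnc_def start_def fun_eq_iff)
    have "mpc_run A P x pl (2 * h * Suc j) = bind_pmf (ideal j) (\<lambda>sh. phase j sh (2 * h))"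
      using within[OF Suc, of "2 * h"] by (simp add: algebra_simps)
    also have "\<dots> = map_pmf start (ideal (Suc j))"
      using h by (simp add: phase_def map_bind_pmf pmf.map_comp o_def dn)
    finally show ?case .
  qed
  then show ?thesis using within assms(2) by blast
qed

end

section \<open>Resource limits of the tree\<close>

lemma set_sample_msg:
  assumes "M \<in> set_pmf (sample_msg d T V ws)" "\<And>t z. t < T \<Longrightarrow> z \<in> set (ws t) \<Longrightarrow> length (snd z) = d"
  shows "length M = Suc (T * d)"
    and "set M \<subseteq> {Bits V, Bits 0} \<union> (\<Union>t<T. \<Union>z\<in>set (ws t). set (snd z))"
proof -
  obtain f where M: "M = msg_enc T V f" and f: "f \<in> set_pmf (Pi_pmf {..<T} (filler d) (\<lambda>t. wpick (filler d) (ws t)))"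
    using assms(1) by (auto simp: sample_msg_def)
  have ft: "f t = filler d \<or> f t \<in> snd ` set (ws t)" if "t < T" for t
    using f that set_wpick[of "filler d" "ws t"] by (auto simp: set_Pi_pmf PiE_dflt_def)
  show "length M = Suc (T * d)"
    unfolding M
  proof (rule length_msg_enc)
    show "length (f t) = d" if "t < T" for t using ft[OF that] assms(2)[OF that] by auto
  qed
  have "set (f t) \<subseteq> {Bits 0} \<union> (\<Union>z\<in>set (ws t). set (snd z))" if "t < T" for t
    using ft[OF that] by (auto simp: set_replicate_conv_if split: if_splits)
  then show "set M \<subseteq> {Bits V, Bits 0} \<union> (\<Union>t<T. \<Union>z\<in>set (ws t). set (snd z))"
    unfolding M by (fastforce simp: msg_enc_def)
qed

definition ok_word :: "nat \<Rightarrow> mpc_word \<Rightarrow> bool" where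
  "ok_word w u = (case u of Coord _ \<Rightarrow> True | Bits v \<Rightarrow> v < 2 ^ w)"

lemma ok_word_simps [simp]: "ok_word w (Coord c)" "ok_word w (Bits v) \<longleftrightarrow> v < 2 ^ w"
  by (simp_all add: ok_word_def)

lemma legal_wordsI:
  assumes "\<And>u. u \<in> set us \<Longrightarrow> ok_word w u" "\<And>c. Coord c \<in> set us \<Longrightarrow> Coord c \<in> held"
  shows "legal_words w held us"
  unfolding legal_words_def
proof
  fix u assume u: "u \<in> set us"
  show "case u of Coord c \<Rightarrow> u \<in> held | Bits v \<Rightarrow> v < 2 ^ w"
  proof (cases u)
    case (Coord c)
    then show ?thesis using u assms(2) by simp
  next
    case (Bits v)
    then show ?thesis using u assms(1)[of u] by simp
  qed
qed

text \<open>\<open>J\<close> is the number of phases. An inbox holds at most \<open>b\<close>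
  messages from children and \<open>J\<close> shared ones, which explains \<open>space\<close>.
  \<open>weights\<close> quantifies over all \<open>sh\<close>, so the word bound does not require
  knowing which states are reachable.\<close>

locale tree_limits = tree +
  fixes J :: nat and x :: "nat \<Rightarrow> nat \<Rightarrow> real" and pl :: "nat \<Rightarrow> nat list"
  assumes init: "mpc_init P x pl = start []" and rounds: "mpc_rounds A P = 2 * h * J"
    and space: "(b + J) * len \<le> local_space P"
    and mem_space: "\<And>k. k < m \<Longrightarrow> length (concat (ps k)) \<le> local_space P"
    and weights: "\<And>j sh. (\<Sum>p\<leftarrow>PS. wt j sh p) < 2 ^ word_length P"
    and coords: "\<And>k p u. p \<in> set (ps k) \<Longrightarrow> u \<in> set p \<Longrightarrow> \<exists>c. u = Coord c"
begin

abbreviation "w \<equiv> word_length P"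

lemma val_lt: "val j sh r k < 2 ^ w"
proof -
  have "val j sh r k = (\<Sum>i\<leftarrow>filter (\<lambda>i. head b r i = k) [0..<m]. sum_list (map fst (W j sh i)))"
    by (simp add: val_def ws_def sum_list_concat_map)
  also have "\<dots> \<le> (\<Sum>i\<leftarrow>[0..<m]. sum_list (map fst (W j sh i)))"
    by (induction "[0..<m]" rule: rev_induct; simp add: sum_list_filter_le_nat)
  also have "\<dots> = (\<Sum>p\<leftarrow>PS. wt j sh p)"
    by (simp add: sum_list_concat_map W_def o_def)
  finally show ?thesis using weights[of j sh] by simp
qed

lemma ok_ps: "p \<in> set (ps k) \<Longrightarrow> u \<in> set p \<Longrightarrow> ok_word w u"
  using coords[of p k u] by auto

lemma ok_slots:
  assumes "f \<in> set_pmf (slots j sh r)" "u \<in> set (f (k, t))"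
  shows "ok_word w u"
proof -
  have "f (k, t) \<in> insert (filler d) (snd ` set (ws j sh r k))"
    using assms set_wpick[of "filler d" "ws j sh r k"]
    by (cases "k < m \<and> t < T") (auto simp: slots_def set_Pi_pmf PiE_dflt_def)
  then have "u = Bits 0 \<or> (\<exists>k. \<exists>p\<in>set (ps k). u \<in> set p)"
    using assms(2) by (auto simp: ws_def W_def)
  then show ?thesis using ok_ps by auto
qed

lemma ok_msgs: "f \<in> set_pmf (slots j sh r) \<Longrightarrow> u \<in> set (msgs j sh r f k) \<Longrightarrow> ok_word w u"
  using ok_slots val_lt by (auto simp: msgs_def msg_enc_def)

lemma ok_leaf_PS: "M \<in> set_pmf (leaf_msg d T (wt j sh) PS) \<Longrightarrow> u \<in> set M \<Longrightarrow> ok_word w u"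
  unfolding root_law[symmetric] using ok_msgs by auto

lemma ok_ideal: "sh \<in> set_pmf (ideal j) \<Longrightarrow> u \<in> set sh \<Longrightarrow> ok_word w u"
  by (induction j arbitrary: sh) (auto dest: ok_leaf_PS)

lemma ok_mem: "u \<in> set (concat (ps k)) \<Longrightarrow> ok_word w u"
  using ok_ps by auto

text \<open>Children of the same machine agree in all base \<open>b\<close> digits above position
  \<open>r\<close> and have zeros below, so digit \<open>r\<close> distinguishes them.\<close>

lemma length_children: "length (children r k) \<le> b"
proof -
  have "inj_on (\<lambda>i. i div b ^ r mod b) (set (children r k))"
  proof (rule inj_onI)
    fix i i' assume i: "i \<in> set (children r k)" "i' \<in> set (children r k)" and eq: "i div b ^ r mod b = i' div b ^ r mod b"
    have "i div (b ^ r * b) = i' div (b ^ r * b)"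
      using i b by (auto simp: children_def head_def mult.commute)
    then have "i div b ^ r div b = i' div b ^ r div b" by (simp add: div_mult2_eq)
    with eq have "i div b ^ r = i' div b ^ r" by (metis div_mult_mod_eq)
    then show "i = i'" using i by (auto simp: children_def) (metis dvd_div_mult_self)
  qed
  moreover have "(\<lambda>i. i div b ^ r mod b) ` set (children r k) \<subseteq> {..<b}" using b by auto
  ultimately have "card (set (children r k)) \<le> card {..<b}" by (intro card_inj_on_le) auto
  moreover have "distinct (children r k)" by (simp add: children_def)
  ultimately show ?thesis by (simp add: distinct_card)
qed

text \<open>A machine is a child of at most one machine. Hence the messages of a level take
  \<open>m\<close> times \<open>len\<close> words in total, without a factor
  \<open>b\<close>.\<close>

lemma sum_length_children: "(\<Sum>k<m. length (children r k)) \<le> m"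
proof -
  have "(\<Sum>k<m. length (children r k)) = (\<Sum>k<m. card (set (children r k)))"
    by (intro sum.cong refl distinct_card[symmetric]) (simp add: children_def)
  also have "\<dots> = card (\<Union>k\<in>{..<m}. set (children r k))"
    by (rule card_UN_disjoint[symmetric]) (auto simp: children_def)
  also have "\<dots> \<le> card {..<m}" by (intro card_mono) (auto simp: children_def)
  finally show ?thesis by simp
qed

lemma run_cases:
  assumes "t \<le> 2 * h * J" "c \<in> set_pmf (mpc_run A P x pl t)"
  obtains j r sh where "t = 2 * h * j + r" "r < 2 * h" "j \<le> J" "r = 0 \<or> j < J" "t < 2 * h * J \<longrightarrow> j < J"
    "sh \<in> set_pmf (ideal j)" "c \<in> set_pmf (phase j sh r)"
proof -
  define j r where "j = t div (2 * h)" and "r = t mod (2 * h)"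
  have t: "t = 2 * h * j + r" and r: "r < 2 * h" using h by (auto simp: j_def r_def)
  have lt: "j < J" if "t < 2 * h * J"
  proof -
    have "2 * h * j < 2 * h * J" using that t by linarith
    then show ?thesis by simp
  qed
  have j: "j \<le> J \<and> (r \<noteq> 0 \<longrightarrow> j < J)"
  proof (cases "t < 2 * h * J")
    case False
    then have "t = 2 * h * J" using assms(1) by simp
    then show ?thesis using h by (simp add: j_def r_def)
  qed (use lt in auto)
  from assms(2) obtain sh where "sh \<in> set_pmf (ideal j)" "c \<in> set_pmf (phase j sh r)"
    using run_phase[OF init, of r j] r by (auto simp: t)
  then show thesis by (intro that[of j r sh]) (use t r j lt in auto)
qed

lemma phase_config:
  assumes "sh \<in> set_pmf (ideal j)" "c \<in> set_pmf (phase j sh r)" "j \<le> J" "r = 0 \<or> j < J" "k < m"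
  shows "fst (c k) = concat (ps k)" "length (snd (c k)) \<le> (b + J) * len" "\<And>u. u \<in> set (snd (c k)) \<Longrightarrow> ok_word w u"
proof -
  note sh = length_ideal[OF assms(1)] ok_ideal[OF assms(1)]
  have "fst (c k) = concat (ps k) \<and> length (snd (c k)) \<le> (b + J) * len \<and> (\<forall>u \<in> set (snd (c k)). ok_word w u)"
  proof (cases "r = 0 \<or> r > h")
    case True
    then consider "r = 0" "c = start sh" | M where "r \<noteq> 0" "c = dnc (2 * h - r) sh M" "M \<in> set_pmf (leaf_msg d T (wt j sh) PS)"
      using assms(2) by (auto simp: phase_def split: if_splits)
    then show ?thesis
    proof cases
      case 1
      have "j * len \<le> (b + J) * len" using assms(3) by (intro mult_right_mono) auto
      then show ?thesis using 1 assms(5) sh by (simp add: start_def)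
    next
      case 2
      have "Suc j * len \<le> (b + J) * len" using assms(4) 2(1) by (intro mult_right_mono) auto
      then show ?thesis using 2 assms(5) sh length_leaf_PS[OF 2(3)] ok_leaf_PS[OF 2(3)] by (auto simp: dnc_def)
    qed
  next
    case False
    then obtain f where f: "f \<in> set_pmf (slots j sh (r - 1))" and c: "c = upc (r - 1) sh (msgs j sh (r - 1) f)"
      using assms(2) by (auto simp: phase_def split: if_splits)
    note length_concat_msgs[OF f, of "children (r - 1) k"]
    moreover have "length (children (r - 1) k) * len + j * len \<le> (b + J) * len"
      using length_children[of "r - 1" k] assms(3) by (simp add: add_mult_distrib[symmetric] del: mult_Suc_right)
    ultimately show ?thesis using c assms(5) sh ok_msgs[OF f] by (auto simp: upc_def)
  qed
  then show "fst (c k) = concat (ps k)" "length (snd (c k)) \<le> (b + J) * len"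
    "\<And>u. u \<in> set (snd (c k)) \<Longrightarrow> ok_word w u" by auto
qed

lemma sum_up_out:
  "(\<Sum>l<m. length (up_out b r k sh M l)) \<le> length sh + length M"
proof -
  have "(\<Sum>l<m. length (up_out b r k sh M l)) \<le>
    (\<Sum>l<m. (if l = k then length sh else 0) + (if l = head b (Suc r) k then length M else 0))"
    by (intro sum_mono) (auto simp: up_out_def)
  also have "\<dots> \<le> length sh + length M" by (simp add: sum.distrib)
  finally show ?thesis .
qed

lemma sum_down_out:
  "(\<Sum>l<m. length (down_out b r k sh M l)) \<le> length sh + b * length M"
proof -
  have "(\<Sum>l<m. length (down_out b r k sh M l)) \<le>
    (\<Sum>l<m. (if l = k then length sh else 0) + (if l \<in> set (children r k) then length M else 0))"
    by (intro sum_mono) (auto simp: down_out_def children_def)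
  also have "\<dots> \<le> length sh + card (set (children r k)) * length M"
  proof -
    have "(\<Sum>l<m. if l \<in> set (children r k) then length M else 0) = card ({..<m} \<inter> set (children r k)) * length M"
      by (simp add: sum.If_cases)
    also have "\<dots> \<le> card (set (children r k)) * length M"
      by (intro mult_right_mono card_mono) auto
    finally show ?thesis by (simp add: sum.distrib)
  qed
  also have "\<dots> \<le> length sh + b * length M"
    using length_children[of r k] card_length[of "children r k"] by (intro add_left_mono mult_right_mono) auto
  finally show ?thesis .
qed

lemma set_out: "set (up_out b r k sh M l) \<subseteq> set sh \<union> set M" "set (down_out b r k sh M l) \<subseteq> set sh \<union> set M"
  by (auto simp: up_out_def down_out_def)

lemma step_limits:
  assumes sh: "sh \<in> set_pmf (ideal j)" and c: "c \<in> set_pmf (phase j sh r)" and "j < J" "r < 2 * h" "k < m"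
    and st: "(mem, out) \<in> set_pmf (mpc_step A P (2 * h * j + r) k (fst (c k)) (snd (c k)))"
  shows "(\<Sum>l<m. length (out l)) \<le> local_space P"
    and "legal_words w (set (fst (c k)) \<union> set (snd (c k))) (mem @ concat (map out [0..<m]))"
proof -
  let ?t = "2 * h * j + r"
  let ?held = "set (fst (c k)) \<union> set (snd (c k))"
  have tj: "?t div (2 * h) = j" "?t mod (2 * h) = r" using assms(4) h by auto
  note lsh = length_ideal[OF sh]
  have jJ: "j \<le> J" using assms(3) by simp
  note cf = phase_config[OF sh c jJ disjI2[OF assms(3)] assms(5)]
  have ch: "chunks d (concat (ps k)) = ps k" for k
    using length_ps d by (intro chunks_concat) auto
  \<comment> \<open>In every round the output routes some shared words and one message, so space and
    legality follow from these bounds. Words not already held are totals or fillers, never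
    coordinates.\<close>
  obtain sh' M where mem: "mem = concat (ps k)"
    and out: "out = up_out b r k sh' M \<or> (\<exists>r'. out = down_out b r' k sh' M)"
    and l: "length sh' \<le> J * len" "length M \<le> len"
    and sub: "set sh' \<subseteq> ?held" "set M \<subseteq> ?held \<union> {u. (\<forall>c. u \<noteq> Coord c) \<and> ok_word w u}"
  proof (cases "r \<le> h")
    case True
    have leJ: "length sh \<le> J * len" using lsh jJ by (simp del: mult_Suc_right)
    obtain xs where xs: "snd (c k) = sh @ xs"
      "r = 0 \<Longrightarrow> xs = []" "r \<noteq> 0 \<Longrightarrow> \<exists>f\<in>set_pmf (slots j sh (r - 1)). xs = concat (map (msgs j sh (r - 1) f) (children (r - 1) k))"
    proof (cases "r = 0")
      case True
      then show thesis using that[of "[]"] c assms(5) by (auto simp: phase_def start_def)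
    next
      case False
      then obtain f where "f \<in> set_pmf (slots j sh (r - 1))" "c = upc (r - 1) sh (msgs j sh (r - 1) f)"
        using c True by (auto simp: phase_def)
      then show thesis using that[of "concat (map (msgs j sh (r - 1) f) (children (r - 1) k))"] False assms(5)
        by (auto simp: upc_def)
    qed
    have td: "take (j * len) (sh @ xs) = sh" "drop (j * len) (sh @ xs) = xs"
      using lsh by (simp_all del: mult_Suc_right)
    from st obtain M where M: "M \<in> set_pmf (if r = 0 then leaf_msg d T (wt j sh) (ps k)
          else merge_msgs d T (chunks len xs))"
        and o: "mem = concat (ps k)" "out = (if r < h then up_out b r k sh M else down_out b (h - 1) k sh M)"
      using True unfolding step_A cf(1) xs(1) tree_step_def Let_def tj td ch by auto
    have "length M = len \<and> set M \<subseteq> ?held \<union> {u. (\<forall>c. u \<noteq> Coord c) \<and> ok_word w u}"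
    proof (cases "r = 0")
      case True
      then have M': "M \<in> set_pmf (sample_msg d T (\<Sum>p\<leftarrow>ps k. wt j sh p) (\<lambda>_. map (\<lambda>p. (wt j sh p, p)) (ps k)))"
        using M by (simp add: leaf_msg_def)
      have "val j sh 0 k = (\<Sum>p\<leftarrow>ps k. wt j sh p)" using assms(5) by (simp add: val_def ws_0 W_def o_def)
      then have V: "(\<Sum>p\<leftarrow>ps k. wt j sh p) < 2 ^ w" using val_lt[of j sh 0 k] by simp
      have "length M = len" by (rule set_sample_msg(1)[OF M']) (use length_ps in auto)
      moreover have "set M \<subseteq> {Bits (\<Sum>p\<leftarrow>ps k. wt j sh p), Bits 0} \<union> (\<Union>t<T. \<Union>z\<in>set (map (\<lambda>p. (wt j sh p, p)) (ps k)). set (snd z))"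
        by (rule set_sample_msg(2)[OF M']) (use length_ps in auto)
      moreover have "(\<Union>t<T. \<Union>z\<in>set (map (\<lambda>p. (wt j sh p, p)) (ps k)). set (snd z)) \<subseteq> ?held"
        unfolding cf(1) by auto
      ultimately show ?thesis using V by fastforce
    next
      case False
      then obtain f where f: "f \<in> set_pmf (slots j sh (r - 1))" and xs': "xs = concat (map (msgs j sh (r - 1) f) (children (r - 1) k))"
        using xs(3) by auto
      let ?Ms = "map (msgs j sh (r - 1) f) (children (r - 1) k)"
      have chx: "chunks len xs = ?Ms" unfolding xs' using length_msgs[OF f] by (intro chunks_concat) auto
      have V: "(\<Sum>M\<leftarrow>?Ms. msg_val M) = val j sh (Suc (r - 1)) k"
        using sum_val_children[of j sh "r - 1" k] by (simp add: msgs_def o_def)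
      have M': "M \<in> set_pmf (sample_msg d T (val j sh (Suc (r - 1)) k) (\<lambda>t. map (\<lambda>M. (msg_val M, msg_slot d M t)) ?Ms))"
        using M False unfolding merge_msgs_def chx V by simp
      have sl: "length (snd z) = d" if "t < T" "z \<in> set (map (\<lambda>M. (msg_val M, msg_slot d M t)) ?Ms)" for t z
      proof -
        have "Suc t * d \<le> T * d" using that(1) by (intro mult_right_mono) auto
        then show ?thesis using that length_msgs[OF f] by (auto simp: msg_slot_def)
      qed
      have "set (msg_slot d M t) \<subseteq> set xs" if "M \<in> set ?Ms" for M t
        using that set_msg_slot[of d M t] unfolding xs' by fastforce
      then have "(\<Union>t<T. \<Union>z\<in>set (map (\<lambda>M. (msg_val M, msg_slot d M t)) ?Ms). set (snd z)) \<subseteq> ?held"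
        unfolding xs(1) by fastforce
      then show ?thesis using set_sample_msg[OF M' sl] val_lt by fastforce
    qed
    then show thesis using that[of sh M] o leJ xs(1) by (auto split: if_splits)
  next
    case False
    define q where "q = 2 * h - r"
    obtain M where M: "M \<in> set_pmf (leaf_msg d T (wt j sh) PS)" and c': "c = dnc q sh M"
      using c False by (auto simp: phase_def q_def split: if_splits)
    have o: "mem = concat (ps k)" "out = down_out b (q - 1) k (if b ^ q dvd k then drop len (snd (c k)) else snd (c k)) (take len (snd (c k)))"
      using st False unfolding step_A cf(1) tree_step_def Let_def tj q_def by auto
    have sk: "snd (c k) = (if b ^ q dvd k then M else []) @ sh" using c' assms(5) by (simp add: dnc_def)
    have l': "length (if b ^ q dvd k then drop len (snd (c k)) else snd (c k)) \<le> J * len"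
      using sk lsh length_leaf_PS[OF M] jJ by (auto simp del: mult_Suc_right simp: mult_le_mono1)
    show thesis
    proof (rule that[OF o(1) _ l'])
      show "out = up_out b r k (if b ^ q dvd k then drop len (snd (c k)) else snd (c k)) (take len (snd (c k))) \<or>
        (\<exists>r'. out = down_out b r' k (if b ^ q dvd k then drop len (snd (c k)) else snd (c k)) (take len (snd (c k))))"
        using o(2) by blast
    qed (auto dest: in_set_takeD in_set_dropD)
  qed
  have "(\<Sum>l<m. length (out l)) \<le> length sh' + b * length M"
  proof -
    have "length M \<le> b * length M" using b by simp
    then show ?thesis using out sum_up_out[of r k sh' M] sum_down_out[of _ k sh' M] by (auto intro: order_trans)
  qed
  also have "\<dots> \<le> J * len + b * len" using l by (intro add_mono mult_left_mono) auto
  also have "\<dots> \<le> local_space P" using space by (simp add: algebra_simps)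
  finally show "(\<Sum>l<m. length (out l)) \<le> local_space P" .
  have okh: "ok_word w u" if "u \<in> ?held" for u using that cf(3) ok_mem cf(1) by auto
  have so: "set (mem @ concat (map out [0..<m])) \<subseteq> ?held \<union> {u. (\<forall>c. u \<noteq> Coord c) \<and> ok_word w u}"
    using out sub set_out[of _ k sh' M] mem cf(1) by fastforce
  show "legal_words w ?held (mem @ concat (map out [0..<m]))"
  proof (rule legal_wordsI)
    show "ok_word w u" if "u \<in> set (mem @ concat (map out [0..<m]))" for u using that so okh by blast
    show "Coord c' \<in> ?held" if "Coord c' \<in> set (mem @ concat (map out [0..<m]))" for c' using that so by blast
  qed
qed

lemma respects_limits: "respects_mpc_limits A P x pl"
  unfolding respects_mpc_limits_def rounds
proof (intro conjI allI impI ballI)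
  fix t c k assume "t \<le> 2 * h * J" "c \<in> set_pmf (mpc_run A P x pl t)" and k: "k < m"
  then obtain j r sh where "sh \<in> set_pmf (ideal j)" "c \<in> set_pmf (phase j sh r)" "j \<le> J" "r = 0 \<or> j < J"
    by (elim run_cases) blast+
  from phase_config[OF this k] show "length (fst (c k)) \<le> local_space P" "length (snd (c k)) \<le> local_space P"
    using mem_space[OF k] space by auto
next
  fix t c k z assume t: "t < 2 * h * J" and c: "c \<in> set_pmf (mpc_run A P x pl t)" and k: "k < m"
    and z: "z \<in> set_pmf (mpc_step A P t k (fst (c k)) (snd (c k)))"
  obtain j r sh where "t = 2 * h * j + r" "r < 2 * h" "j < J" "sh \<in> set_pmf (ideal j)" "c \<in> set_pmf (phase j sh r)"
    using run_cases[OF less_imp_le[OF t] c] t by metis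
  with step_limits[of sh j c r k "fst z" "snd z"] k z
  show "case z of (mem, out) \<Rightarrow> (\<Sum>l<m. length (out l)) \<le> local_space P \<and>
      legal_words w (set (fst (c k)) \<union> set (snd (c k))) (mem @ concat (map out [0..<m]))"
    by (auto simp: case_prod_beta)
qed

text \<open>Besides the input, the inboxes hold at most \<open>J\<close> shared messages per machine
  and, on average, one message in transit.\<close>

lemma total_space:
  assumes "t \<le> mpc_rounds A P" "c \<in> set_pmf (mpc_run A P x pl t)"
  shows "(\<Sum>k<m. length (fst (c k)) + length (snd (c k))) \<le> length PS * d + m * (Suc J * len)"
proof -
  obtain j r sh where j: "sh \<in> set_pmf (ideal j)" "c \<in> set_pmf (phase j sh r)" "j \<le> J" "r = 0 \<or> j < J"
    using run_cases[of t c] assms unfolding rounds by metis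
  note lsh = length_ideal[OF j(1)]
  have jl: "j * len \<le> J * len" using j(3) by (intro mult_right_mono) auto
  have "(\<Sum>k<m. length (fst (c k))) = (\<Sum>k<m. length (ps k) * d)"
    using phase_config(1)[OF j] length_ps by (intro sum.cong refl) (simp add: length_concat_uniform)
  also have "\<dots> = length PS * d"
    by (simp add: length_concat o_def interv_sum_list_conv_sum_set_nat atLeast0LessThan sum_distrib_right)
  finally have F: "(\<Sum>k<m. length (fst (c k))) = length PS * d" .
  have "(\<Sum>k<m. length (snd (c k))) \<le> m * (J * len) + m * len"
  proof (cases "r = 0 \<or> r > h")
    case True
    have "length (snd (c k)) \<le> J * len + len" if "k < m" for k
    proof -
      consider "c = start sh" | M where "c = dnc (2 * h - r) sh M" "M \<in> set_pmf (leaf_msg d T (wt j sh) PS)"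
        using True j(2) by (auto simp: phase_def split: if_splits)
      then have "length (snd (c k)) \<le> j * len + len"
      proof cases
        case 1
        then show ?thesis using that lsh by (simp add: start_def)
      next
        case 2
        then show ?thesis using that lsh length_leaf_PS[OF 2(2)] by (simp add: dnc_def)
      qed
      then show ?thesis using jl by linarith
    qed
    then have "(\<Sum>k<m. length (snd (c k))) \<le> (\<Sum>k<m. J * len + len)" by (intro sum_mono) auto
    then show ?thesis by (simp add: algebra_simps)
  next
    case False
    then obtain f where f: "f \<in> set_pmf (slots j sh (r - 1))" and c: "c = upc (r - 1) sh (msgs j sh (r - 1) f)"
      using j(2) by (auto simp: phase_def split: if_splits)
    have "(\<Sum>k<m. length (snd (c k))) = (\<Sum>k<m. j * len + length (children (r - 1) k) * len)"
      using c lsh length_concat_msgs[OF f] by (intro sum.cong refl) (simp add: upc_def del: mult_Suc_right)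
    also have "\<dots> = m * (j * len) + (\<Sum>k<m. length (children (r - 1) k)) * len"
      by (simp only: sum.distrib sum_distrib_right sum_constant card_lessThan of_nat_id)
    also have "\<dots> \<le> m * (J * len) + m * len"
      using j(3) sum_length_children by (intro add_mono mult_left_mono mult_right_mono) auto
    finally show ?thesis .
  qed
  then show ?thesis using F by (simp add: sum.distrib algebra_simps)
qed

end

section \<open>Rounding and few points\<close>

definition point_words :: "nat \<Rightarrow> (nat \<Rightarrow> nat \<Rightarrow> real) \<Rightarrow> nat \<Rightarrow> mpc_word list" where
  "point_words d x i = map (\<lambda>j. Coord (x i j)) [0..<d]"

definition row_pmf :: "real \<Rightarrow> row pmf" where
  "row_pmf y = map_pmf (\<lambda>b. if b then (1, 0) else (0, 1)) (bernoulli_pmf ((1 + y) / 2))"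

definition out_rows :: "(mpc_word list \<Rightarrow> real) \<Rightarrow> mpc_word list list \<Rightarrow> row list pmf" where
  "out_rows \<rho> pts = map_pmf (\<lambda>g. map g [0..<length pts])
     (Pi_pmf {..<length pts} (0, 0) (\<lambda>a. row_pmf (\<rho> (pts ! a))))"

lemma disjoint_concat_map:
  assumes "distinct (concat (map f [0..<m]))" "k < m" "k' < m" "k \<noteq> k'"
  shows "set (f k) \<inter> set (f k') = {}"
  using assms by (induction m) (fastforce simp: less_Suc_eq disjoint_iff)+

lemma distinct_concat_map:
  assumes "distinct (concat (map f [0..<m]))" "k < m"
  shows "distinct (f k)"
  using assms by (induction m) (auto simp: less_Suc_eq)

text \<open>Each index sits at exactly one position of one machine. Reindexing along this bijection
  turns the product over machines and positions into a product over points.\<close>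

lemma collect_rows_law:
  assumes "valid_placement P pl" "m = num_machines P" "n = num_points P"
  shows "map_pmf (collect_rows P pl) (Pi_pmf {..<m} [] (\<lambda>k. out_rows \<rho> (map X (pl k)))) =
    Pi_pmf {..<n} (0, 0) (\<lambda>i. row_pmf (\<rho> (X i)))"
proof -
  let ?S = "Sigma {..<m} (\<lambda>k. {..<length (pl k)})"
  let ?\<psi> = "\<lambda>(k, a). pl k ! a"
  have dist: "distinct (concat (map pl [0..<m]))" and set: "set (concat (map pl [0..<m])) = {..<n}"
    using assms by (auto simp: valid_placement_def)
  have bij: "bij_betw ?\<psi> ?S {..<n}"
  proof (rule bij_betw_imageI)
    show "inj_on ?\<psi> ?S"
    proof (rule inj_onI, clarify)
      fix k a k' a' assume *: "k < m" "a < length (pl k)" "k' < m" "a' < length (pl k')" "pl k ! a = pl k' ! a'"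
      have "k = k'" using disjoint_concat_map[OF dist *(1,3)] * by (metis disjoint_iff nth_mem)
      then show "k = k' \<and> a = a'" using * distinct_concat_map[OF dist *(1)] by (simp add: nth_eq_iff_index_eq)
    qed
    show "?\<psi> ` ?S = {..<n}"
    proof -
      have "?\<psi> ` ?S = (\<Union>k<m. set (pl k))" by (auto simp: set_conv_nth image_iff)
      then show ?thesis using set by (simp add: atLeast0LessThan)
    qed
  qed
  define \<phi> where "\<phi> = inv_into ?S ?\<psi>"
  have \<phi>: "\<phi> ` {..<n} = ?S" "inj_on \<phi> {..<n}" "\<And>i. i < n \<Longrightarrow> \<phi> i \<in> ?S \<and> ?\<psi> (\<phi> i) = i"
    using bij_betw_inv_into[OF bij] bij_betw_inv_into_right[OF bij]
    unfolding \<phi>_def[symmetric] by (auto simp: bij_betw_def)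
  let ?p = "\<lambda>(k, a). row_pmf (\<rho> (X (pl k ! a)))"
  let ?rs = "\<lambda>f k. if k \<in> {..<m} then map (\<lambda>t. if t \<in> {..<length (pl k)} then f (k, t) else (0, 0)) [0..<length (pl k)] else []"
  have "Pi_pmf {..<m} [] (\<lambda>k. out_rows \<rho> (map X (pl k))) =
    Pi_pmf {..<m} [] (\<lambda>k. map_pmf (\<lambda>g. map g [0..<length (pl k)])
      (Pi_pmf {..<length (pl k)} (0, 0) (\<lambda>a. row_pmf (\<rho> (X (pl k ! a))))))"
    by (intro Pi_pmf_cong refl) (auto simp: out_rows_def intro!: arg_cong2[where f = map_pmf] Pi_pmf_cong)
  also have "\<dots> = map_pmf ?rs (Pi_pmf ?S (0, 0) ?p)"
    by (rule Pi_pmf_nested) auto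
  finally have "map_pmf (collect_rows P pl) (Pi_pmf {..<m} [] (\<lambda>k. out_rows \<rho> (map X (pl k)))) =
    map_pmf (\<lambda>f. collect_rows P pl (?rs f)) (Pi_pmf ?S (0, 0) ?p)"
    by (simp add: pmf.map_comp o_def)
  also have "\<dots> = map_pmf (\<lambda>f i. if i \<in> {..<n} then f (\<phi> i) else (0, 0)) (Pi_pmf ?S (0, 0) ?p)"
  proof (intro map_pmf_cong refl ext)
    fix f :: "nat \<times> nat \<Rightarrow> row" and i
    let ?L = "concat (map (\<lambda>k. zip (pl k) (?rs f k)) [0..<m])"
    have "map fst ?L = concat (map pl [0..<m])"
      by (auto simp: map_concat o_def intro!: arg_cong[of _ _ concat])
    then have keys: "distinct (map fst ?L)" "fst ` set ?L = {..<n}"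
      using dist set by (metis, metis list.set_map)
    show "collect_rows P pl (?rs f) i = (if i \<in> {..<n} then f (\<phi> i) else (0, 0))"
    proof (cases "i < n")
      case True
      obtain k a where ka: "\<phi> i = (k, a)" by force
      then have "k < m" "a < length (pl k)" "pl k ! a = i" using \<phi>(3)[OF True] by auto
      then have "(i, f (\<phi> i)) \<in> set (zip (pl k) (?rs f k))"
        unfolding ka by (auto simp: set_zip intro!: exI[of _ a])
      then have "(i, f (\<phi> i)) \<in> set ?L" using \<open>k < m\<close> by auto
      then have "map_of ?L i = Some (f (\<phi> i))" using keys(1) by (intro map_of_is_SomeI) auto
      then show ?thesis using True assms(2) by (simp add: collect_rows_def)
    next
      case False
      then have "map_of ?L i = None" using keys(2) by (simp only: map_of_eq_None_iff) simp
      then show ?thesis using False assms(2) by (simp add: collect_rows_def)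
    qed
  qed
  also have "\<dots> = Pi_pmf {..<n} (0, 0) (\<lambda>i. ?p (\<phi> i))"
    using Pi_pmf_reindex[OF _ \<phi>(2), of "(0, 0)" ?p] \<phi>(1) by simp
  also have "\<dots> = Pi_pmf {..<n} (0, 0) (\<lambda>i. row_pmf (\<rho> (X i)))"
    using \<phi>(3) by (intro Pi_pmf_cong refl) (auto simp: case_prod_beta)
  finally show ?thesis .
qed

lemma finite_row_pmf: "finite (set_pmf (row_pmf y))"
  by (simp add: row_pmf_def)

lemma set_row_pmf: "set_pmf (row_pmf y) \<subseteq> {(1, 0), (0, 1)}"
  by (auto simp: row_pmf_def)

lemma expectation_row_pmf:
  fixes F :: "row \<Rightarrow> real"
  assumes "\<bar>y\<bar> \<le> 1"
  shows "\<E> (row_pmf y) F = (1 + y) / 2 * F (1, 0) + (1 - y) / 2 * F (0, 1)"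
proof -
  have "(1 + y) / 2 \<in> {0..1}" using assms by (auto simp: abs_le_iff)
  then show ?thesis by (simp add: row_pmf_def field_simps)
qed

section \<open>The cut cost as a quadratic form\<close>

definition pair_energy :: "real \<Rightarrow> nat \<Rightarrow> nat \<Rightarrow> (nat \<Rightarrow> nat \<Rightarrow> real) \<Rightarrow> (nat \<Rightarrow> real) \<Rightarrow> real" where
  "pair_energy p n d x y = (\<Sum>i<n. \<Sum>j<n. lp_dist p d (x i) (x j) * y i * y j)"

lemma expectation_cut_cost:
  assumes "p \<ge> 1" "\<And>i. i < n \<Longrightarrow> \<bar>y i\<bar> \<le> 1"
  shows "\<E> (Pi_pmf {..<n} (0, 0) (\<lambda>i. row_pmf (y i))) (cut_cost p n d x) =
    ((\<Sum>i<n. \<Sum>j<n. lp_dist p d (x i) (x j)) + pair_energy p n d x y) / 4"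
proof -
  let ?P = "Pi_pmf {..<n} (0, 0) (\<lambda>i. row_pmf (y i))"
  let ?g = "\<lambda>a b :: row. real (fst a * fst b + snd a * snd b)"
  have "finite (set_pmf ?P)" by (intro finite_set_Pi_pmf finite_row_pmf) auto
  note int = integrable_measure_pmf_finite[OF this]
  have one: "lp_dist p d (x i) (x j) * \<E> ?P (\<lambda>z. ?g (z i) (z j)) =
    lp_dist p d (x i) (x j) * ((1 + y i * y j) / 2)" if "i < n" "j < n" for i j
  proof (cases "i = j")
    case True
    then show ?thesis using assms by (simp add: lp_dist_self)
  next
    case False
    have S: "{..<n} = insert i (insert j ({..<n} - {i, j}))" using that by auto
    have "\<E> (Pi_pmf (insert i (insert j ({..<n} - {i, j}))) (0, 0) (\<lambda>i. row_pmf (y i))) (\<lambda>z. ?g (z i) (z j)) =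
      \<E> (row_pmf (y i)) (\<lambda>a. \<E> (row_pmf (y j)) (\<lambda>b. ?g a b))"
      using False by (simp add: expectation_Pi_insert finite_row_pmf del: of_nat_add of_nat_mult)
    also have "\<dots> = (1 + y i * y j) / 2"
      using assms(2) that by (simp add: expectation_row_pmf field_simps)
    finally show ?thesis using S by simp
  qed
  have "\<E> ?P (cut_cost p n d x) =
    1 / 2 * (\<Sum>i<n. \<Sum>j<n. lp_dist p d (x i) (x j) * \<E> ?P (\<lambda>z. ?g (z i) (z j)))"
    unfolding cut_cost_def by (simp add: int del: of_nat_add of_nat_mult)
  also have "\<dots> = 1 / 2 * (\<Sum>i<n. \<Sum>j<n. lp_dist p d (x i) (x j) * ((1 + y i * y j) / 2))"
    by (intro arg_cong2[where f = "(*)"] refl sum.cong one) auto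
  also have "\<dots> = 1 / 2 * (\<Sum>i<n. \<Sum>j<n. (lp_dist p d (x i) (x j) + lp_dist p d (x i) (x j) * y i * y j) / 2)"
    by (simp add: algebra_simps)
  also have "\<dots> = ((\<Sum>i<n. \<Sum>j<n. lp_dist p d (x i) (x j)) + pair_energy p n d x y) / 4"
    unfolding pair_energy_def by (simp add: sum.distrib flip: sum_divide_distrib)
  finally show ?thesis .
qed

lemma cut_cost_complete:
  assumes "z \<in> complete_cuts n"
  defines "y \<equiv> \<lambda>i. real (fst (z i)) - real (snd (z i))"
  shows "cut_cost p n d x z = ((\<Sum>i<n. \<Sum>j<n. lp_dist p d (x i) (x j)) + pair_energy p n d x y) / 4"
    and "\<And>i. i < n \<Longrightarrow> y i = 1 \<or> y i = -1"
proof -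
  have zi: "z i = (1, 0) \<or> z i = (0, 1)" if "i < n" for i
    using assms(1) that unfolding complete_cuts_def cuts_def by (fastforce dest: PiE_mem)
  show "\<And>i. i < n \<Longrightarrow> y i = 1 \<or> y i = -1" using zi by (fastforce simp: y_def)
  have "cut_cost p n d x z = 1 / 2 * (\<Sum>i<n. \<Sum>j<n. (lp_dist p d (x i) (x j) + lp_dist p d (x i) (x j) * y i * y j) / 2)"
    unfolding cut_cost_def
  proof (intro arg_cong2[where f = "(*)"] refl sum.cong)
    fix i j assume "i \<in> {..<n}" "j \<in> {..<n}"
    then show "lp_dist p d (x i) (x j) * real (fst (z i) * fst (z j) + snd (z i) * snd (z j)) =
      (lp_dist p d (x i) (x j) + lp_dist p d (x i) (x j) * y i * y j) / 2"
      using zi[of i] zi[of j] by (auto simp: y_def)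
  qed
  also have "\<dots> = ((\<Sum>i<n. \<Sum>j<n. lp_dist p d (x i) (x j)) + pair_energy p n d x y) / 4"
    unfolding pair_energy_def by (simp add: sum.distrib flip: sum_divide_distrib)
  finally show "cut_cost p n d x z = ((\<Sum>i<n. \<Sum>j<n. lp_dist p d (x i) (x j)) + pair_energy p n d x y) / 4" .
qed

lemma finite_complete_cuts: "finite (complete_cuts n)" and complete_cuts_nonempty: "complete_cuts n \<noteq> {}"
proof -
  show "finite (complete_cuts n)" unfolding complete_cuts_def cuts_def by (auto intro!: finite_PiE)
  have "restrict (\<lambda>_. (1, 0)) {..<n} \<in> complete_cuts n" by (auto simp: complete_cuts_def cuts_def)
  then show "complete_cuts n \<noteq> {}" by auto
qed

lemma Min_cut_cost_obtain:
  obtains ys where "\<And>i. i < n \<Longrightarrow> ys i = 1 \<or> ys i = (-1::real)"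
    "Min (cut_cost p n d x ` complete_cuts n) = ((\<Sum>i<n. \<Sum>j<n. lp_dist p d (x i) (x j)) + pair_energy p n d x ys) / 4"
proof -
  have "Min (cut_cost p n d x ` complete_cuts n) \<in> cut_cost p n d x ` complete_cuts n"
    using finite_complete_cuts complete_cuts_nonempty by (intro Min_in) auto
  then obtain z where z: "z \<in> complete_cuts n" "Min (cut_cost p n d x ` complete_cuts n) = cut_cost p n d x z" by auto
  show thesis using that[OF cut_cost_complete(2)[OF z(1)]] z(2) cut_cost_complete(1)[OF z(1)] by simp
qed

section \<open>Optimal fractional cut for few points\<close>

definition word_dist :: "real \<Rightarrow> nat \<Rightarrow> mpc_word list \<Rightarrow> mpc_word list \<Rightarrow> real" where
  "word_dist p d u v = lp_dist p d (\<lambda>j. case u ! j of Coord c \<Rightarrow> c | Bits _ \<Rightarrow> 0)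
     (\<lambda>j. case v ! j of Coord c \<Rightarrow> c | Bits _ \<Rightarrow> 0)"

lemma word_dist_points: "word_dist p d (point_words d x i) (point_words d x j) = lp_dist p d (x i) (x j)"
  unfolding word_dist_def by (intro lp_dist_cong) (simp_all add: point_words_def)

definition list_energy :: "('p \<Rightarrow> 'p \<Rightarrow> real) \<Rightarrow> 'p list \<Rightarrow> (nat \<Rightarrow> real) \<Rightarrow> real" where
  "list_energy \<delta> ps y = (\<Sum>a<length ps. \<Sum>b<length ps. \<delta> (ps ! a) (ps ! b) * y a * y b)"

text \<open>An optimal sign vector may separate duplicates, which a rule depending on coordinates
  cannot do. Averaging over the copies of a point removes the dependence on the index.\<close>

definition class_avg :: "'p list \<Rightarrow> (nat \<Rightarrow> real) \<Rightarrow> 'p \<Rightarrow> real" where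
  "class_avg ps y p = (\<Sum>a\<in>{a. a < length ps \<and> ps ! a = p}. y a) / real (card {a. a < length ps \<and> ps ! a = p})"

definition avg_rule :: "('p \<Rightarrow> 'p \<Rightarrow> real) \<Rightarrow> 'p list \<Rightarrow> 'p \<Rightarrow> real" where
  "avg_rule \<delta> ps = class_avg ps (arg_min_on (list_energy \<delta> ps) ({..<length ps} \<rightarrow>\<^sub>E {-1, 1}))"

lemma sum_class_avg:
  fixes G :: "'p \<Rightarrow> real"
  shows "(\<Sum>a<length ps. G (ps ! a) * class_avg ps y (ps ! a)) = (\<Sum>a<length ps. G (ps ! a) * y a)"
proof -
  let ?C = "\<lambda>v. {a \<in> {..<length ps}. ps ! a = v}"
  have "(\<Sum>a\<in>?C v. G (ps ! a) * class_avg ps y (ps ! a)) = (\<Sum>a\<in>?C v. G (ps ! a) * y a)" for v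
  proof (cases "?C v = {}")
    case False
    have "(\<Sum>a\<in>?C v. G (ps ! a) * class_avg ps y (ps ! a)) = (\<Sum>a\<in>?C v. G v * class_avg ps y v)"
      by (intro sum.cong) auto
    also have "\<dots> = G v * (\<Sum>a\<in>?C v. y a)"
      using False by (auto simp: class_avg_def)
    also have "\<dots> = (\<Sum>a\<in>?C v. G (ps ! a) * y a)"
      unfolding sum_distrib_left by (intro sum.cong) auto
    finally show ?thesis .
  qed (simp only: sum.empty)
  then show ?thesis
    by (simp add: sum.image_gen[of "{..<length ps}" _ "(!) ps"])
qed

text \<open>The form is bilinear and its coefficients depend only on the points, so each argument in
  turn may be averaged over copies without changing the value.\<close>

lemma list_energy_class_avg: "list_energy \<delta> ps (\<lambda>a. class_avg ps y (ps ! a)) = list_energy \<delta> ps y"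
proof -
  have "list_energy \<delta> ps (\<lambda>a. class_avg ps y (ps ! a)) =
    (\<Sum>a<length ps. (\<Sum>b<length ps. \<delta> (ps ! a) (ps ! b) * class_avg ps y (ps ! b)) * class_avg ps y (ps ! a))"
    unfolding list_energy_def by (simp add: sum_distrib_left sum_distrib_right mult_ac)
  also have "\<dots> = (\<Sum>a<length ps. (\<Sum>b<length ps. \<delta> (ps ! a) (ps ! b) * y b) * class_avg ps y (ps ! a))"
    by (simp only: sum_class_avg)
  also have "\<dots> = (\<Sum>a<length ps. (\<Sum>b<length ps. \<delta> (ps ! a) (ps ! b) * y b) * y a)"
    by (rule sum_class_avg[of "\<lambda>p. \<Sum>b<length ps. \<delta> p (ps ! b) * y b"])
  also have "\<dots> = list_energy \<delta> ps y"
    unfolding list_energy_def by (simp add: sum_distrib_left sum_distrib_right mult_ac)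
  finally show ?thesis .
qed

lemma avg_rule_bounds:
  shows "\<bar>avg_rule \<delta> ps p\<bar> \<le> 1"
    and "\<And>y. (\<And>a. a < length ps \<Longrightarrow> y a = 1 \<or> y a = -1) \<Longrightarrow> list_energy \<delta> ps (\<lambda>a. avg_rule \<delta> ps (ps ! a)) \<le> list_energy \<delta> ps y"
proof -
  let ?G = "{..<length ps} \<rightarrow>\<^sub>E {-1, 1::real}"
  define y0 where "y0 = arg_min_on (list_energy \<delta> ps) ?G"
  have fin: "finite ?G" "?G \<noteq> {}" by (auto intro!: finite_PiE simp: PiE_eq_empty_iff)
  have y0: "y0 \<in> ?G" "\<And>y. y \<in> ?G \<Longrightarrow> list_energy \<delta> ps y0 \<le> list_energy \<delta> ps y"
    using arg_min_if_finite[OF fin, where f = "list_energy \<delta> ps"] unfolding y0_def by (auto simp: not_less)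
  have eq: "avg_rule \<delta> ps = class_avg ps y0" by (simp add: avg_rule_def y0_def)
  let ?C = "{a. a < length ps \<and> ps ! a = p}"
  have "\<bar>\<Sum>a\<in>?C. y0 a\<bar> \<le> (\<Sum>a\<in>?C. 1)"
  proof (rule order_trans[OF sum_abs], rule sum_mono)
    fix a assume "a \<in> ?C"
    then have "y0 a \<in> {-1, 1}" using y0(1) by auto
    then show "\<bar>y0 a\<bar> \<le> 1" by auto
  qed
  then have le: "\<bar>\<Sum>a\<in>?C. y0 a\<bar> \<le> real (card ?C)" by simp
  show "\<bar>avg_rule \<delta> ps p\<bar> \<le> 1"
    unfolding eq class_avg_def abs_divide using le by (cases "card ?C = 0") (auto simp: divide_le_eq_1)
  fix y :: "nat \<Rightarrow> real" assume y: "\<And>a. a < length ps \<Longrightarrow> y a = 1 \<or> y a = -1"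
  then have "restrict y {..<length ps} \<in> ?G" by auto
  then have "list_energy \<delta> ps y0 \<le> list_energy \<delta> ps (restrict y {..<length ps})" by (rule y0(2))
  also have "\<dots> = list_energy \<delta> ps y" by (simp add: list_energy_def)
  finally show "list_energy \<delta> ps (\<lambda>a. avg_rule \<delta> ps (ps ! a)) \<le> list_energy \<delta> ps y"
    by (simp add: eq list_energy_class_avg)
qed

lemma sum_nth_perm:
  fixes F :: "nat \<Rightarrow> 'b::comm_monoid_add"
  assumes "distinct l" "set l = {..<n}"
  shows "(\<Sum>a<length l. F (l ! a)) = (\<Sum>i<n. F i)"
  using sum.reindex_bij_betw[OF bij_betw_nth[OF assms(1) refl refl], of F] assms(2) by simp

lemma avg_rule_optimal:
  assumes "distinct l" "set l = {..<n}" "\<And>i. i < n \<Longrightarrow> ys i = 1 \<or> ys i = -1"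
  shows "pair_energy p n d x (\<lambda>i. avg_rule (word_dist p d) (map (point_words d x) l) (point_words d x i))
    \<le> pair_energy p n d x ys"
proof -
  let ?ps = "map (point_words d x) l"
  have eq: "pair_energy p n d x Y = list_energy (word_dist p d) ?ps (\<lambda>a. Y (l ! a))" for Y
  proof -
    have "list_energy (word_dist p d) ?ps (\<lambda>a. Y (l ! a)) =
      (\<Sum>a<length l. \<Sum>b<length l. lp_dist p d (x (l ! a)) (x (l ! b)) * Y (l ! a) * Y (l ! b))"
      unfolding list_energy_def by (simp add: word_dist_points)
    also have "\<dots> = pair_energy p n d x Y"
      unfolding pair_energy_def
      using sum_nth_perm[OF assms(1,2), of "\<lambda>i. \<Sum>b<length l. lp_dist p d (x i) (x (l ! b)) * Y i * Y (l ! b)"]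
        sum_nth_perm[OF assms(1,2), of "\<lambda>j. lp_dist p d (x i) (x j) * Y i * Y j" for i] by simp
    finally show ?thesis by simp
  qed
  have "ys (l ! a) = 1 \<or> ys (l ! a) = -1" if "a < length ?ps" for a
  proof -
    have "l ! a \<in> set l" using that by simp
    then show ?thesis using assms(2,3) by simp
  qed
  from avg_rule_bounds(2)[of ?ps "\<lambda>a. ys (l ! a)", OF this, of "word_dist p d"] show ?thesis
    unfolding eq by (simp add: list_energy_def)
qed

section \<open>Choosing the weights\<close>

lemma wpick_map:
  assumes "sum_list (map fst ws) \<noteq> 0"
  shows "wpick d' (map (apsnd f) ws) = map_pmf f (wpick d ws)"
proof (rule pmf_eqI)
  fix y
  let ?W = "sum_list (map fst ws)"
  have W: "sum_list (map fst (map (apsnd f) ws)) = ?W" by (simp add: o_def)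
  have sums: "sum_list (map snd (filter (\<lambda>z. fst z \<in> f -` {y}) (map (\<lambda>(w, a). (a, real w / V)) ws))) =
    (\<Sum>z\<leftarrow>map (apsnd f) ws. if snd z = y then real (fst z) else 0) / V" for V
    by (induction ws) (auto simp: add_divide_distrib)
  have "pmf (map_pmf f (wpick d ws)) y = measure_pmf.prob (wpick d ws) (f -` {y})"
    by (rule pmf_map)
  also have "\<dots> = sum_list (map snd (filter (\<lambda>z. fst z \<in> f -` {y}) (map (\<lambda>(w, a). (a, real w / real ?W)) ws)))"
    unfolding wpick_def Let_def if_not_P[OF assms] by (rule measure_pmf_of_list[OF wpick_wf[OF assms]])
  also have "\<dots> = (\<Sum>z\<leftarrow>map (apsnd f) ws. if snd z = y then real (fst z) else 0) / real ?W"
    by (rule sums)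
  also have "\<dots> = pmf (wpick d' (map (apsnd f) ws)) y"
    using pmf_wpick[of "map (apsnd f) ws" d' y] assms unfolding W by simp
  finally show "pmf (wpick d' (map (apsnd f) ws)) y = pmf (map_pmf f (wpick d ws)) y" by simp
qed

lemma finite_leaf_msg: "finite (set_pmf (leaf_msg d T v ps))"
  unfolding leaf_msg_def sample_msg_def by (auto intro!: finite_imageI finite_set_Pi_pmf finite_set_wpick)

text \<open>The shared words list the broadcast messages, the latest one first: phase 0 yields a uniformly
  random point c, phase 1 a point c' at positive distance from c, phase 2 the total weight V of the
  rounded distances to c, and phase 3 samples with probability proportional to distance plus average
  distance. The cap only serves to keep the weights of unreachable states within the word length.\<close>

definition scaled_dist :: "real \<Rightarrow> nat \<Rightarrow> nat \<Rightarrow> mpc_word list \<Rightarrow> mpc_word list \<Rightarrow> mpc_word list \<Rightarrow> nat" where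
  "scaled_dist p d l c c' q = nat \<lceil>2 ^ l * word_dist p d q c / word_dist p d c' c\<rceil>"

definition point_weight ::
  "real \<Rightarrow> nat \<Rightarrow> nat \<Rightarrow> nat \<Rightarrow> nat \<Rightarrow> nat \<Rightarrow> mpc_word list \<Rightarrow> mpc_word list \<Rightarrow> nat" where
  "point_weight p n d T l j sh q = min (2 ^ (4 * l))
    (let len = Suc (T * d) in
     if j = 0 then 1
     else if j = 1 then (if word_dist p d q (msg_slot d sh 0) > 0 then 1 else 0)
     else if j = 2 then scaled_dist p d l (msg_slot d (drop len sh) 0) (msg_slot d sh 0) q
     else n * scaled_dist p d l (msg_slot d (drop (2 * len) sh) 0) (msg_slot d (drop len sh) 0) q + msg_val sh)"

text \<open>Dropping the latest message restores the state in which its samples were drawn. Thus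
  every machine can recompute the sampling weight of each point.\<close>

definition shared_rule :: "real \<Rightarrow> nat \<Rightarrow> nat \<Rightarrow> nat \<Rightarrow> nat \<Rightarrow> nat \<Rightarrow> mpc_word list \<Rightarrow> mpc_word list \<Rightarrow> real" where
  "shared_rule p n d T l L sh = sample_rule (word_dist p d)
     (\<lambda>q. real (point_weight p n d T l 3 (drop (Suc (T * d)) sh) q)) L (msg_slot d sh)"

text \<open>The bound on \<open>l\<close> does two jobs: scaled nonzero distances are at least 1, so
  rounding up at most doubles them, and there is room for the factor \<open>2 * n\<close> when
  weights are combined.\<close>

locale point_sampling =
  fixes p :: real and n d T l L :: nat and x :: "nat \<Rightarrow> nat \<Rightarrow> real" and \<Delta> :: real
    and PS :: "mpc_word list list" and ys :: "nat \<Rightarrow> real"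
  assumes p: "p \<ge> 1" and n: "n > 0" and L: "L > 0" and T: "T = num_slots L"
    and PS: "mset PS = mset (map (point_words d x) [0..<n])"
    and ratio: "\<And>i j i' j'. i < n \<Longrightarrow> j < n \<Longrightarrow> i' < n \<Longrightarrow> j' < n \<Longrightarrow> lp_dist p d (x i) (x j) \<noteq> 0 \<Longrightarrow>
      lp_dist p d (x i') (x j') \<le> \<Delta> * lp_dist p d (x i) (x j)"
    and \<Delta>: "\<Delta> \<ge> 1" and l: "2 * real n * \<Delta> \<le> 2 ^ l"
    and ys: "\<And>i. i < n \<Longrightarrow> ys i = 1 \<or> ys i = -1"
begin

abbreviation "X \<equiv> point_words d x"
abbreviation "D i j \<equiv> lp_dist p d (x i) (x j)"
abbreviation "wt \<equiv> point_weight p n d T l"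
abbreviation "len \<equiv> Suc (T * d)"
lemma T_pos: "T > 0" using L by (simp add: T num_slots_def)

lemma length_X: "length (X i) = d" by (simp add: point_words_def)

text \<open>Picks an index instead of its words, so that duplicates remain distinct in the kernel
  analysis.\<close>

definition ipick :: "(mpc_word list \<Rightarrow> nat) \<Rightarrow> nat pmf" where
  "ipick v = wpick 0 (map (\<lambda>i. (v (X i), i)) [0..<n])"

lemma sum_weights: "sum_list (map fst (map (\<lambda>i. (v (X i), i)) [0..<n])) = (\<Sum>i<n. v (X i))"
  by (simp add: o_def interv_sum_list_conv_sum_set_nat atLeast0LessThan)

lemma pmf_ipick:
  assumes "(\<Sum>i<n. v (X i)) > 0"
  shows "pmf (ipick v) i = (if i < n then real (v (X i)) / real (\<Sum>i<n. v (X i)) else 0)"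
proof -
  have nz: "sum_list (map fst (map (\<lambda>i. (v (X i), i)) [0..<n])) \<noteq> 0" unfolding sum_weights by (rule gr_implies_not0[OF assms])
  have "(\<Sum>z\<leftarrow>map (\<lambda>i. (v (X i), i)) [0..<n]. if snd z = i then real (fst z) else 0) =
    (\<Sum>j<n. if j = i then real (v (X j)) else 0)"
    by (simp add: o_def interv_sum_list_conv_sum_set_nat atLeast0LessThan)
  also have "\<dots> = (if i < n then real (v (X i)) else 0)" by (simp add: sum.delta)
  finally show ?thesis unfolding ipick_def pmf_wpick[OF nz] sum_weights by simp
qed

lemma leaf_msg_points:
  assumes "(\<Sum>i<n. v (X i)) > 0"
  shows "leaf_msg d T v PS = map_pmf (\<lambda>\<omega>. msg_enc T (\<Sum>i<n. v (X i)) (\<lambda>t. X (\<omega> t)))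
    (Pi_pmf {..<T} 0 (\<lambda>_. ipick v))"
proof -
  let ?I = "map (\<lambda>i. (v (X i), i)) [0..<n]"
  have nz: "sum_list (map fst ?I) \<noteq> 0" unfolding sum_weights by (rule gr_implies_not0[OF assms])
  have V: "(\<Sum>p\<leftarrow>PS. v p) = (\<Sum>i<n. v (X i))"
    using sum_list_map_cong_mset[OF PS, of v] by (simp add: o_def interv_sum_list_conv_sum_set_nat atLeast0LessThan)
  have "mset (map (\<lambda>p. (v p, p)) PS) = mset (map (apsnd X) ?I)"
    using arg_cong[OF PS, of "image_mset (\<lambda>p. (v p, p))"] by (simp add: image_mset.compositionality o_def)
  then have "wpick (filler d) (map (\<lambda>p. (v p, p)) PS) = map_pmf X (ipick v)"
    using wpick_cong_mset wpick_map[OF nz, of "filler d" X 0] by (metis ipick_def)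
  then have "leaf_msg d T v PS = map_pmf (msg_enc T (\<Sum>i<n. v (X i)))
      (Pi_pmf {..<T} (filler d) (\<lambda>_. map_pmf X (ipick v)))"
    unfolding leaf_msg_def sample_msg_def V by simp
  also have "\<dots> = map_pmf (\<lambda>\<omega>. msg_enc T (\<Sum>i<n. v (X i)) (\<lambda>t. if t \<in> {..<T} then X (\<omega> t) else filler d))
    (Pi_pmf {..<T} 0 (\<lambda>_. ipick v))"
    by (simp add: Pi_pmf_map_default[of "{..<T}" "filler d" "\<lambda>_. X" "\<lambda>_. ipick v" 0] pmf.map_comp o_def)
  also have "\<dots> = map_pmf (\<lambda>\<omega>. msg_enc T (\<Sum>i<n. v (X i)) (\<lambda>t. X (\<omega> t))) (Pi_pmf {..<T} 0 (\<lambda>_. ipick v))"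
    by (intro map_pmf_cong refl msg_enc_cong) auto
  finally show ?thesis .
qed

lemma leaf_msg_val:
  assumes "M \<in> set_pmf (leaf_msg d T v PS)"
  shows "msg_val (M @ sh) = (\<Sum>i<n. v (X i))" "length M = len"
proof -
  have V: "(\<Sum>p\<leftarrow>PS. v p) = (\<Sum>i<n. v (X i))"
    using sum_list_map_cong_mset[OF PS, of v] by (simp add: o_def interv_sum_list_conv_sum_set_nat atLeast0LessThan)
  then show "msg_val (M @ sh) = (\<Sum>i<n. v (X i))"
    using assms by (auto simp: leaf_msg_def sample_msg_def)
  have "set PS = set (map X [0..<n])" using PS by (metis set_mset_mset)
  then show "length M = len"
    using assms unfolding leaf_msg_def by (elim set_sample_msg(1)) (auto simp: length_X)
qed

definition energy :: "mpc_word list \<Rightarrow> real" where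
  "energy sh = pair_energy p n d x (\<lambda>i. shared_rule p n d T l L sh (X i))"

text \<open>The kernel bound: with u proportional to distance to c plus its average, two such factors
  dominate the distance up to n times the total distance to c, by the triangle inequality.\<close>

lemma energy_last_phase:
  assumes c: "c < n" and M1: "M1 = msg_enc T V1 (\<lambda>t. X (\<omega>1 t))" "\<omega>1 0 = c"
    and M2: "M2 \<in> set_pmf (leaf_msg d T (wt 1 M1) PS)"
    and M3: "M3 \<in> set_pmf (leaf_msg d T (wt 2 (M2 @ M1)) PS)"
  shows "\<E> (leaf_msg d T (wt 3 (M3 @ M2 @ M1)) PS) (\<lambda>M4. energy (M4 @ M3 @ M2 @ M1))
    \<le> pair_energy p n d x ys + 72 / L * n * (\<Sum>i<n. D i c)"
proof (cases "\<forall>i<n. D i c = 0")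
  case True
  \<comment> \<open>All points coincide. Then no \<open>c'\<close> exists and phase 1 sends fillers,
    but the energy is 0 for any rule.\<close>
  have "D i j = 0" if "i < n" "j < n" for i j
    using lp_dist_triangle[OF p, of d "x i" "x j" "x c"] lp_dist_nonneg[of p d "x i" "x j"]
      lp_dist_commute[of p d "x j" "x c"] True that by force
  then have "pair_energy p n d x y = 0" for y by (simp add: pair_energy_def)
  then show ?thesis using lp_dist_nonneg by (simp add: energy_def sum_nonneg)
next
  case False
  have l1: "length M1 = len" unfolding M1 by (rule length_msg_enc) (rule length_X)
  note l2 = leaf_msg_val(2)[OF M2] and l3 = leaf_msg_val(2)[OF M3]
  have s1: "msg_slot d M1 0 = X c" unfolding M1 using T_pos M1(2) by (simp add: msg_slot_enc length_X)
  have pow: "(1::nat) \<le> 2 ^ (4 * l)" by simp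
  have w1: "wt 1 M1 (X i) = (if D i c > 0 then 1 else 0)" for i
    using pow by (simp add: point_weight_def s1 word_dist_points)
  obtain i0 where i0: "i0 < n" "D i0 c > 0" using False lp_dist_nonneg by (metis less_eq_real_def)
  have "(\<Sum>i<n. wt 1 M1 (X i)) > 0" using i0 by (intro sum_pos2[of _ i0]) (auto simp: w1 simp del: One_nat_def)
  note P2 = leaf_msg_points[OF this] and p2 = pmf_ipick[OF this]
  obtain \<omega>2 where \<omega>2: "M2 = msg_enc T (\<Sum>i<n. wt 1 M1 (X i)) (\<lambda>t. X (\<omega>2 t))"
    "\<omega>2 0 \<in> set_pmf (ipick (wt 1 M1))"
    using M2 T_pos unfolding P2 by (auto simp: set_Pi_pmf PiE_dflt_def)
  define c' where "c' = \<omega>2 0"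
  have c': "c' < n" "D c' c > 0"
    using \<omega>2(2) p2[of c'] unfolding c'_def[symmetric] set_pmf_iff by (auto simp: w1 simp del: One_nat_def split: if_splits)
  have s2: "msg_slot d M2 0 = X c'" unfolding \<omega>2 c'_def using T_pos by (simp add: msg_slot_enc length_X)
  \<comment> \<open>The scale at which distances become integers; it cancels in the end.\<close>
  define \<theta> where "\<theta> = 2 ^ l / D c' c"
  define v where "v i = nat \<lceil>\<theta> * D i c\<rceil>" for i
  define V where "V = (\<Sum>i<n. v i)"
  have \<theta>: "\<theta> > 0" using c' by (simp add: \<theta>_def)
  have vlow: "\<theta> * D i c \<le> v i" for i unfolding v_def by linarith
  \<comment> \<open>A nonzero distance is at least \<open>D c' c / \<Delta>\<close>, hence at least
    1 after scaling, and rounding up at most doubles it.\<close>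
  have vup: "v i \<le> 2 * (\<theta> * D i c)" if "i < n" for i
  proof (cases "D i c = 0")
    case False
    then have "D c' c \<le> \<Delta> * D i c" using ratio[of i c c' c] that c c' by simp
    also have "\<dots> \<le> 2 ^ l * D i c"
    proof (rule mult_right_mono)
      have "1 * \<Delta> \<le> 2 * real n * \<Delta>" using n \<Delta> by (intro mult_right_mono) auto
      then show "\<Delta> \<le> 2 ^ l" using l by simp
    qed (rule lp_dist_nonneg)
    finally have "1 \<le> \<theta> * D i c" using c' by (simp add: \<theta>_def field_simps)
    then show ?thesis unfolding v_def by linarith
  qed (simp add: v_def)
  \<comment> \<open>On reachable states the cap in \<open>point_weight\<close> is inactive: weights
    stay below \<open>2 ^ (2 * l)\<close> here and below \<open>2 ^ (3 * l)\<close> in the last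
    phase.\<close>
  have vcap: "v i \<le> 2 ^ (2 * l)" if "i < n" for i
  proof -
    have "D i c \<le> \<Delta> * D c' c" using ratio[of c' c i c] that c c' by simp
    then have "\<theta> * D i c \<le> 2 ^ l * \<Delta>" using c' by (simp add: \<theta>_def field_simps)
    moreover have "2 * (2 ^ l * \<Delta>) \<le> 2 ^ l * 2 ^ l"
    proof -
      have "2 * 1 * \<Delta> \<le> 2 * real n * \<Delta>" using n \<Delta> by (intro mult_right_mono) auto
      then have "2 * \<Delta> \<le> 2 ^ l" using l by simp
      then have "2 ^ l * (2 * \<Delta>) \<le> 2 ^ l * 2 ^ l" by (intro mult_left_mono) auto
      then show ?thesis by simp
    qed
    moreover have "1 * 1 \<le> 2 ^ l * \<Delta>" using \<Delta> by (intro mult_mono) auto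
    ultimately have "\<theta> * D i c + 1 \<le> 2 ^ l * 2 ^ l" by linarith
    moreover have "0 \<le> \<theta> * D i c" using \<theta> lp_dist_nonneg by simp
    then have "real (v i) \<le> \<theta> * D i c + 1" unfolding v_def by linarith
    ultimately have "real (v i) \<le> 2 ^ (2 * l)" by (simp add: mult_2 power_add)
    then show ?thesis by (metis of_nat_le_iff of_nat_numeral of_nat_power)
  qed
  have n2: "2 * n \<le> 2 ^ l"
  proof -
    have "2 * real n * 1 \<le> 2 * real n * \<Delta>" using \<Delta> by (intro mult_left_mono) auto
    then have "real (2 * n) \<le> real (2 ^ l)" using l by simp
    then show ?thesis by (simp only: of_nat_le_iff)
  qed
  have Vcap: "V \<le> n * 2 ^ (2 * l)" unfolding V_def using sum_bounded_above[of "{..<n}" v "2 ^ (2 * l)"] vcap by simp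
  have w2: "wt 2 (M2 @ M1) (X i) = v i" if "i < n" for i
  proof -
    have "scaled_dist p d l (X c) (X c') (X i) = v i"
      by (simp add: scaled_dist_def word_dist_points v_def \<theta>_def)
    moreover have "v i \<le> 2 ^ (4 * l)"
      by (rule order_trans[OF vcap[OF that] power_increasing]) auto
    ultimately show ?thesis
      using msg_slot_append[OF l2 T_pos, of M1] l2 by (simp add: point_weight_def s1 s2)
  qed
  have V3: "msg_val (M3 @ M2 @ M1) = V"
    using leaf_msg_val(1)[OF M3, of "M2 @ M1"] w2 by (simp add: V_def)
  have w3: "wt 3 (M3 @ M2 @ M1) (X i) = n * v i + V" if "i < n" for i
  proof -
    have sd: "scaled_dist p d l (X c) (X c') (X i) = v i"
      by (simp add: scaled_dist_def word_dist_points v_def \<theta>_def)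
    have dr: "drop len (M3 @ M2 @ M1) = M2 @ M1" "drop (2 * len) (M3 @ M2 @ M1) = M1"
      using l2 l3 by simp_all
    have "n * v i + V \<le> n * 2 ^ (2 * l) + n * 2 ^ (2 * l)"
      using vcap[OF that] Vcap by (intro add_mono mult_left_mono) auto
    also have "\<dots> = (2 * n) * 2 ^ (2 * l)" by simp
    also have "\<dots> \<le> 2 ^ l * 2 ^ (2 * l)" using n2 by (intro mult_right_mono) auto
    also have "\<dots> = 2 ^ (3 * l)" by (simp add: power_add[symmetric])
    also have "\<dots> \<le> 2 ^ (4 * l)" by (intro power_increasing) auto
    finally have "n * v i + V \<le> 2 ^ (4 * l)" .
    then show ?thesis using msg_slot_append[OF l2 T_pos, of M1]
      unfolding point_weight_def Let_def dr V3 by (simp add: s1 s2 sd min_absorb2)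
  qed
  have "v c' > 0" using vlow[of c'] \<theta> c' by (metis mult_pos_pos not_gr_zero of_nat_0 not_less)
  then have Vpos: "V > 0" unfolding V_def using c' by (intro sum_pos2[of _ c']) auto
  let ?w3 = "wt 3 (M3 @ M2 @ M1)"
  have U: "(\<Sum>i<n. ?w3 (X i)) = 2 * n * V"
  proof -
    have "(\<Sum>i<n. ?w3 (X i)) = (\<Sum>i<n. n * v i + V)" using w3 by simp
    also have "\<dots> = 2 * n * V" by (simp add: sum.distrib V_def sum_distrib_left[symmetric])
    finally show ?thesis .
  qed
  then have Upos: "(\<Sum>i<n. ?w3 (X i)) > 0" using Vpos n by simp
  define q where "q = ipick ?w3"
  have pq: "pmf q i = (if i < n then real (n * v i + V) / real (2 * n * V) else 0)" for i
    using pmf_ipick[OF Upos, of i] w3 U by (simp add: q_def)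
  \<comment> \<open>The probabilities are \<open>(n * v i + V) / (2 * n * V)\<close>. The product of
    two numerators contains \<open>n * V * (v i + v j)\<close>, and \<open>v i + v j\<close> is at
    least \<open>\<theta> * D i j\<close>, which leaves
    \<open>(2 * n * V)\<^sup>2 / (n * V * \<theta>)\<close>.\<close>
  define M where "M = 4 * real n * real V / \<theta>"
  have ker: "bounded_kernel {..<n} q X (word_dist p d) (\<lambda>z. real (?w3 z)) (2 * n * V) M ys L"
  proof
    show "set_pmf q = {..<n}"
    proof (rule set_eqI)
      fix i show "i \<in> set_pmf q \<longleftrightarrow> i \<in> {..<n}"
        unfolding set_pmf_iff pq using Vpos n by (auto simp del: of_nat_add of_nat_mult)
    qed
    fix i j assume ij: "i \<in> {..<n}" "j \<in> {..<n}"
    show "word_dist p d (X i) (X j) = word_dist p d (X j) (X i)" by (simp add: word_dist_points lp_dist_commute)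
    show "0 \<le> word_dist p d (X i) (X j)" by (simp add: word_dist_points lp_dist_nonneg)
    have "D i j \<le> D i c + D j c"
      using lp_dist_triangle[OF p, of d "x i" "x j" "x c"] lp_dist_commute[of p d "x j" "x c"] by simp
    also have "\<dots> \<le> (real (v i) + real (v j)) / \<theta>"
      using vlow[of i] vlow[of j] \<theta> by (simp add: field_simps)
    also have "\<dots> = M * ((n * V * (real (v i) + real (v j))) / (2 * n * V) ^ 2)"
      using Vpos n \<theta> by (simp add: M_def power2_eq_square field_simps)
    also have "\<dots> \<le> M * ((real (n * v i + V) * real (n * v j + V)) / (2 * n * V) ^ 2)"
    proof (intro mult_left_mono divide_right_mono)
      show "n * V * (real (v i) + real (v j)) \<le> real (n * v i + V) * real (n * v j + V)"
        by (simp add: algebra_simps)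
    qed (use \<theta> in \<open>auto simp: M_def\<close>)
    also have "\<dots> = M * (pmf q i * pmf q j)" using ij by (simp add: pq power2_eq_square)
    finally show "word_dist p d (X i) (X j) \<le> M * (pmf q i * pmf q j)" by (simp add: word_dist_points)
    show "real (?w3 (X i)) = real (2 * n * V) * pmf q i"
      using ij w3[of i] Vpos n by (simp add: pq del: of_nat_add)
    show "ys i = 1 \<or> ys i = -1" using ys ij by simp
  qed (use Vpos n \<theta> L in \<open>auto simp: M_def\<close>)
  interpret K: bounded_kernel "{..<n}" q X "word_dist p d" "\<lambda>z. real (?w3 z)" "2 * n * V" M ys L
    by (rule ker)
  have Q: "K.Q y = pair_energy p n d x y" for y
    unfolding K.Q_def pair_energy_def by (simp add: word_dist_points)
  have en: "energy (msg_enc T (\<Sum>i<n. ?w3 (X i)) (\<lambda>t. X (\<omega> t)) @ M3 @ M2 @ M1) =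
    K.Q (\<lambda>i. sample_rule (word_dist p d) (\<lambda>z. real (?w3 z)) L (X \<circ> \<omega>) (X i))" for \<omega>
  proof -
    let ?M4 = "msg_enc T (\<Sum>i<n. ?w3 (X i)) (\<lambda>t. X (\<omega> t))"
    have l4: "length ?M4 = len" by (rule length_msg_enc) (rule length_X)
    have "msg_slot d (?M4 @ M3 @ M2 @ M1) t = (X \<circ> \<omega>) t" if "t < num_slots L" for t
      using msg_slot_append[OF l4, of t] msg_slot_enc[of T "\<lambda>t. X (\<omega> t)" d t] that T length_X by simp
    then have "sample_rule \<delta> u L (msg_slot d (?M4 @ M3 @ M2 @ M1)) z = sample_rule \<delta> u L (X \<circ> \<omega>) z" for \<delta> u z
      by (rule sample_rule_cong)
    moreover have "drop len (?M4 @ M3 @ M2 @ M1) = M3 @ M2 @ M1" using l4 by simp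
    ultimately show ?thesis unfolding energy_def shared_rule_def Q by simp
  qed
  have "\<E> (leaf_msg d T ?w3 PS) (\<lambda>M4. energy (M4 @ M3 @ M2 @ M1)) =
    \<E> (Pi_pmf {..<T} 0 (\<lambda>_. q)) (\<lambda>\<omega>. K.Q (\<lambda>i. sample_rule (word_dist p d) (\<lambda>z. real (?w3 z)) L (X \<circ> \<omega>) (X i)))"
    unfolding leaf_msg_points[OF Upos] integral_map_pmf en q_def ..
  also have "\<dots> \<le> K.Q ys + 9 * M / L" by (rule K.E_sample_rule[folded T])
  also have "\<dots> \<le> pair_energy p n d x ys + 72 / L * n * (\<Sum>i<n. D i c)"
  proof -
    \<comment> \<open>Rounding costs a factor 2 in \<open>V\<close>, so \<open>M\<close> is at most
      8 n times the distance sum, and 9 * 8 = 72.\<close>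
    have "real V \<le> (\<Sum>i<n. 2 * (\<theta> * D i c))" unfolding V_def of_nat_sum using vup by (intro sum_mono) auto
    also have "\<dots> = 2 * \<theta> * (\<Sum>i<n. D i c)" by (simp add: sum_distrib_left mult.assoc)
    finally have "M \<le> 4 * real n * (2 * \<theta> * (\<Sum>i<n. D i c)) / \<theta>"
      unfolding M_def using \<theta> by (intro divide_right_mono mult_left_mono) auto
    also have "\<dots> = 8 * n * (\<Sum>i<n. D i c)" using \<theta> by simp
    finally have "9 * M / L \<le> 9 * (8 * n * (\<Sum>i<n. D i c)) / L" by (intro divide_right_mono mult_left_mono) auto
    then show ?thesis unfolding Q by simp
  qed
  finally show ?thesis .
qed

text \<open>For uniformly random \<open>c\<close>, \<open>n\<close> times the total distance to
  \<open>c\<close> has expectation equal to the sum of all distances.\<close>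

lemma expected_energy:
  "\<E> (bind_pmf (leaf_msg d T (wt 0 []) PS) (\<lambda>M1. bind_pmf (leaf_msg d T (wt 1 M1) PS) (\<lambda>M2.
      bind_pmf (leaf_msg d T (wt 2 (M2 @ M1)) PS) (\<lambda>M3.
        map_pmf (\<lambda>M4. M4 @ M3 @ M2 @ M1) (leaf_msg d T (wt 3 (M3 @ M2 @ M1)) PS))))) energy
    \<le> pair_energy p n d x ys + 72 / L * (\<Sum>i<n. \<Sum>j<n. D i j)" (is "?lhs \<le> _")
proof -
  note fin = finite_leaf_msg[of d T _ PS]
  have w0: "wt 0 [] (X i) = 1" for i
    by (simp add: point_weight_def)
  have S0: "(\<Sum>i<n. wt 0 [] (X i)) = n" by (simp add: w0)
  then have pos: "(\<Sum>i<n. wt 0 [] (X i)) > 0" using n by simp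
  let ?P = "Pi_pmf {..<T} 0 (\<lambda>_. ipick (wt 0 []))"
  let ?f = "\<lambda>M1. \<E> (bind_pmf (leaf_msg d T (wt 1 M1) PS) (\<lambda>M2.
      bind_pmf (leaf_msg d T (wt 2 (M2 @ M1)) PS) (\<lambda>M3.
        map_pmf (\<lambda>M4. M4 @ M3 @ M2 @ M1) (leaf_msg d T (wt 3 (M3 @ M2 @ M1)) PS)))) energy"
  have pi: "pmf (ipick (wt 0 [])) i = (if i < n then 1 / n else 0)" for i
    using pmf_ipick[OF pos, of i] w0 S0 by simp
  have setp: "set_pmf (ipick (wt 0 [])) = {..<n}" using n by (auto simp: set_pmf_iff pi split: if_splits)
  have finP: "finite (set_pmf ?P)" by (intro finite_set_Pi_pmf) (auto simp: setp)
  have inner: "?f (msg_enc T n (\<lambda>t. X (\<omega> t))) \<le> pair_energy p n d x ys + 72 / L * n * (\<Sum>i<n. D i (\<omega> 0))"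
    if "\<omega> \<in> set_pmf ?P" for \<omega>
  proof -
    let ?M1 = "msg_enc T n (\<lambda>t. X (\<omega> t))"
    let ?B = "pair_energy p n d x ys + 72 / L * n * (\<Sum>i<n. D i (\<omega> 0))"
    have c: "\<omega> 0 < n" using that T_pos setp by (auto simp: set_Pi_pmf PiE_dflt_def)
    have "?f ?M1 = \<E> (leaf_msg d T (wt 1 ?M1) PS) (\<lambda>M2. \<E> (leaf_msg d T (wt 2 (M2 @ ?M1)) PS) (\<lambda>M3.
        \<E> (leaf_msg d T (wt 3 (M3 @ M2 @ ?M1)) PS) (\<lambda>M4. energy (M4 @ M3 @ M2 @ ?M1))))"
      by (simp add: expectation_bind_finite fin)
    also have "\<dots> \<le> \<E> (leaf_msg d T (wt 1 ?M1) PS) (\<lambda>M2. \<E> (leaf_msg d T (wt 2 (M2 @ ?M1)) PS) (\<lambda>M3. ?B))"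
      by (intro expectation_mono_finite fin energy_last_phase[of "\<omega> 0" ?M1 n \<omega>, OF c refl refl])
    finally show ?thesis by simp
  qed
  have "?lhs =
    \<E> (leaf_msg d T (wt 0 []) PS) ?f"
    by (rule expectation_bind_finite) (auto simp: fin)
  also have "\<dots> = \<E> ?P (\<lambda>\<omega>. ?f (msg_enc T n (\<lambda>t. X (\<omega> t))))"
    unfolding leaf_msg_points[OF pos] integral_map_pmf S0 ..
  also have "\<dots> \<le> \<E> ?P (\<lambda>\<omega>. pair_energy p n d x ys + 72 / L * n * (\<Sum>i<n. D i (\<omega> 0)))"
    using finP inner by (rule expectation_mono_finite)
  also have "\<dots> = \<E> (map_pmf (\<lambda>\<omega>. \<omega> 0) ?P) (\<lambda>c. pair_energy p n d x ys + 72 / L * n * (\<Sum>i<n. D i c))"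
    by simp
  also have "map_pmf (\<lambda>\<omega>. \<omega> 0) ?P = ipick (wt 0 [])" using T_pos by (simp add: Pi_pmf_component)
  also have "\<E> (ipick (wt 0 [])) (\<lambda>c. pair_energy p n d x ys + 72 / L * n * (\<Sum>i<n. D i c)) =
    (\<Sum>c<n. (pair_energy p n d x ys + 72 / L * n * (\<Sum>i<n. D i c)) * (1 / n))"
    using integral_measure_pmf_real[of "{..<n}" "ipick (wt 0 [])"] setp by (simp add: pi)
  also have "\<dots> = pair_energy p n d x ys + 72 / L * (\<Sum>c<n. \<Sum>i<n. D i c)"
  proof -
    have "(\<Sum>c<n. (pair_energy p n d x ys + 72 / L * n * (\<Sum>i<n. D i c)) * (1 / n)) =
      (\<Sum>c<n. pair_energy p n d x ys / n + 72 / L * (\<Sum>i<n. D i c))"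
      using n by (intro sum.cong refl) (simp add: field_simps)
    then show ?thesis using n by (simp add: sum.distrib sum_distrib_left)
  qed
  also have "(\<Sum>c<n. \<Sum>i<n. D i c) = (\<Sum>i<n. \<Sum>j<n. D i j)" by (rule sum.swap)
  finally show ?thesis .
qed

end

section \<open>The algorithm\<close>

text \<open>The final error is 18 / L times the sum of distances; 20 leaves some slack.\<close>

definition accuracy :: "real \<Rightarrow> nat" where
  "accuracy \<epsilon> = nat \<lceil>20 / \<epsilon>\<rceil>"

definition slot_count :: "real \<Rightarrow> nat" where
  "slot_count \<epsilon> = num_slots (accuracy \<epsilon>)"

text \<open>The number of messages that fit into local memory, less the four shared ones.\<close>

definition fan :: "real \<Rightarrow> mpc_params \<Rightarrow> nat" where
  "fan \<epsilon> P = local_space P div Suc (slot_count \<epsilon> * dimension P) - 4"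

definition depth :: "real \<Rightarrow> mpc_params \<Rightarrow> nat" where
  "depth \<epsilon> P = (LEAST h. 0 < h \<and> num_machines P \<le> fan \<epsilon> P ^ h)"

text \<open>Machines are not told the aspect ratio; \<open>word_length P div 6\<close> recovers a
  precision \<open>l\<close> suited to it. The threshold separates inputs small enough to be sent to
  everybody from those with at least as many points as slots.\<close>

definition cut_algorithm :: "real \<Rightarrow> real \<Rightarrow> mpc_algorithm" where
  "cut_algorithm \<epsilon> p = \<lparr>
     mpc_rounds = \<lambda>P. if num_points P < slot_count \<epsilon> then 1 else 2 * depth \<epsilon> P * 4,
     mpc_step = \<lambda>P. if num_points P < slot_count \<epsilon> then (\<lambda>t k mem inb. return_pmf (mem, \<lambda>_. mem))
       else tree_step (fan \<epsilon> P) (depth \<epsilon> P) (dimension P) (slot_count \<epsilon>)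
         (point_weight p (num_points P) (dimension P) (slot_count \<epsilon>) (word_length P div 6)),
     mpc_output = \<lambda>P k mem inb. out_rows
       (if num_points P < slot_count \<epsilon> then avg_rule (word_dist p (dimension P)) (chunks (dimension P) inb)
        else shared_rule p (num_points P) (dimension P) (slot_count \<epsilon>) (word_length P div 6) (accuracy \<epsilon>) inb)
       (chunks (dimension P) mem)\<rparr>"

lemma accuracy_bounds:
  assumes "0 < \<epsilon>" "\<epsilon> < 1"
  shows "20 / \<epsilon> \<le> accuracy \<epsilon>" "accuracy \<epsilon> \<le> 21 / \<epsilon>" "accuracy \<epsilon> > 0"
proof -
  have "1 / \<epsilon> > 1" using assms by simp
  moreover have "20 / \<epsilon> = 20 * (1 / \<epsilon>)" "21 / \<epsilon> = 21 * (1 / \<epsilon>)" by simp_all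
  ultimately show "20 / \<epsilon> \<le> accuracy \<epsilon>" "accuracy \<epsilon> \<le> 21 / \<epsilon>" unfolding accuracy_def by linarith+
  then show "accuracy \<epsilon> > 0" using assms by (metis divide_pos_pos gr0I not_less of_nat_0 zero_less_numeral)
qed

lemma num_slots_le:
  assumes "L > 0"
  shows "num_slots L \<le> 9 * L ^ 8"
proof -
  have "L ^ 3 \<le> L ^ 8" using assms by (intro power_increasing) auto
  moreover have "((L ^ 3 + 1) * L)\<^sup>2 \<le> (2 * L ^ 3 * L)\<^sup>2"
  proof (intro power_mono mult_right_mono)
    have "1 \<le> L ^ 3" using assms by simp
    then show "L ^ 3 + 1 \<le> 2 * L ^ 3" by linarith
  qed auto
  moreover have "(2 * L ^ 3 * L)\<^sup>2 = 4 * L ^ 8"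
    by (simp add: power_mult_distrib flip: power_mult)
  ultimately show ?thesis by (simp add: num_slots_def num_pairs_def)
qed

lemma slot_count_le:
  assumes "0 < \<epsilon>" "\<epsilon> < 1"
  shows "real (slot_count \<epsilon>) \<le> 9 * 21 ^ 8 * (1 / \<epsilon>) ^ 8"
proof -
  have "real (slot_count \<epsilon>) \<le> 9 * real (accuracy \<epsilon>) ^ 8"
    using num_slots_le[OF accuracy_bounds(3)[OF assms]] unfolding slot_count_def
    by (metis of_nat_le_iff of_nat_mult of_nat_numeral of_nat_power)
  also have "\<dots> \<le> 9 * (21 / \<epsilon>) ^ 8"
    using accuracy_bounds[OF assms] by (intro mult_left_mono power_mono) auto
  finally show ?thesis by (simp add: power_divide)
qed

lemma aspect_ratio_bounds:
  shows "aspect_ratio p n d x \<ge> 1"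
    and "i < n \<Longrightarrow> j < n \<Longrightarrow> i' < n \<Longrightarrow> j' < n \<Longrightarrow> lp_dist p d (x i) (x j) \<noteq> 0 \<Longrightarrow>
      lp_dist p d (x i') (x j') \<le> aspect_ratio p n d x * lp_dist p d (x i) (x j)"
proof -
  let ?D = "{lp_dist p d (x i) (x j) | i j. i < n \<and> j < n \<and> lp_dist p d (x i) (x j) \<noteq> 0}"
  have "?D \<subseteq> (\<lambda>(i, j). lp_dist p d (x i) (x j)) ` ({..<n} \<times> {..<n})" by auto
  then have fin: "finite ?D" by (rule finite_subset) auto
  have pos: "r > 0" if "r \<in> ?D" for r
    using that lp_dist_nonneg[of p d] by (auto simp: less_le)
  have ar: "aspect_ratio p n d x = (if ?D = {} then 1 else Max ?D / Min ?D)"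
    by (simp only: aspect_ratio_def Let_def)
  show "aspect_ratio p n d x \<ge> 1"
  proof (cases "?D = {}")
    case False
    have "Min ?D > 0" using pos Min_in[OF fin False] by blast
    moreover have "Min ?D \<le> Max ?D" using fin Min_in[OF fin False] by (intro Max_ge)
    ultimately show ?thesis using False unfolding ar by simp
  next
    case True
    show ?thesis unfolding ar if_P[OF True] by simp
  qed
  assume ij: "i < n" "j < n" "i' < n" "j' < n" "lp_dist p d (x i) (x j) \<noteq> 0"
  then have r: "lp_dist p d (x i) (x j) \<in> ?D" by auto
  then have ne: "?D \<noteq> {}" by auto
  have mp: "Min ?D > 0" using pos Min_in[OF fin ne] by blast
  have ml: "Min ?D \<le> lp_dist p d (x i) (x j)" using fin r by (rule Min_le)
  have Mp: "Max ?D > 0" using pos Max_in[OF fin ne] by blast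
  have "lp_dist p d (x i') (x j') \<le> Max ?D"
  proof (cases "lp_dist p d (x i') (x j') = 0")
    case False
    then have "lp_dist p d (x i') (x j') \<in> ?D" using ij by auto
    with fin show ?thesis by (rule Max_ge)
  qed (use Mp in simp)
  also have "\<dots> = Max ?D / Min ?D * Min ?D" using mp by simp
  also have "\<dots> \<le> Max ?D / Min ?D * lp_dist p d (x i) (x j)"
    using ml mp Mp by (intro mult_left_mono) auto
  finally show "lp_dist p d (x i') (x j') \<le> aspect_ratio p n d x * lp_dist p d (x i) (x j)"
    unfolding ar if_not_P[OF ne] .
qed

lemma word_length_ge:
  assumes "0 < \<epsilon>" "\<epsilon> < 1" "n > 0" "d > 0" "\<Delta> \<ge> 1"
  shows "2 * real n * \<Delta> \<le> 2 ^ (word_length_bound 6 \<epsilon> n d \<Delta> div 6)"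
proof -
  define l where "l = nat \<lceil>1 + log 2 (real n * real d * \<Delta> / \<epsilon>)\<rceil>"
  let ?y = "real n * real d * \<Delta> / \<epsilon>"
  have pos: "?y > 0" using assms by simp
  have "2 * real n * \<Delta> = 2 * (real n * 1 * \<Delta> / 1)" by simp
  also have "\<dots> \<le> 2 * ?y" using assms by (intro mult_left_mono frac_le mult_right_mono) auto
  also have "\<dots> = 2 powr (1 + log 2 ?y)" using pos by (simp add: powr_add)
  also have "\<dots> \<le> 2 powr real l" unfolding l_def by (intro powr_mono) linarith+
  also have "\<dots> = 2 ^ l" by (simp add: powr_realpow)
  finally show ?thesis by (simp add: word_length_bound_def l_def)
qed

lemma concat_map_concat: "concat (map (\<lambda>k. concat (map f (g k))) ks) = concat (map f (concat (map g ks)))"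
  by (induction ks) auto

section \<open>Guarantees for a single input\<close>

locale cut_instance =
  fixes \<kappa> \<epsilon> p \<alpha> :: real and n d s m :: nat and x :: "nat \<Rightarrow> nat \<Rightarrow> real" and pl :: "nat \<Rightarrow> nat list"
    and P :: mpc_params
  assumes \<kappa>: "\<kappa> \<ge> 1" and \<epsilon>: "0 < \<epsilon>" "\<epsilon> < 1" and p: "1 \<le> p" and \<alpha>: "0 < \<alpha>" "\<alpha> \<le> 1"
    and n: "1 \<le> n" and d: "1 \<le> d"
    and s: "real s \<ge> local_space_bound ((4 * \<kappa> + 22) * (9 * 21 ^ 8)) 8 \<epsilon> \<alpha> n d"
    and ms: "real m * real s \<ge> real n * real d"
    and m: "real m \<le> \<kappa> * of_int \<lceil>real n * real d / real s\<rceil>"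
    and P: "P = \<lparr>num_points = n, dimension = d, num_machines = m, local_space = s,
               word_length = word_length_bound 6 \<epsilon> n d (aspect_ratio p n d x)\<rparr>"
    and pl: "valid_placement P pl"
begin

abbreviation "T \<equiv> slot_count \<epsilon>"
abbreviation "A \<equiv> cut_algorithm \<epsilon> p"
abbreviation "X \<equiv> point_words d x"
abbreviation "mem k \<equiv> concat (map X (pl k))"
abbreviation "ix \<equiv> concat (map pl [0..<m])"
abbreviation "Dsum \<equiv> \<Sum>i<n. \<Sum>j<n. lp_dist p d (x i) (x j)"
abbreviation "opt \<equiv> Min (cut_cost p n d x ` complete_cuts n)"

lemma sel [simp]: "num_points P = n" "dimension P = d" "num_machines P = m" "local_space P = s"
  by (simp_all add: P)

lemma ix: "distinct ix" "set ix = {..<n}" and pl_space: "\<And>k. k < m \<Longrightarrow> d * length (pl k) \<le> s"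
  using pl by (auto simp: valid_placement_def)

lemma length_ix: "length ix = n"
  using distinct_card[OF ix(1)] ix(2) by simp

lemma length_mem: "length (mem k) = d * length (pl k)"
proof -
  have "length (mem k) = length (map X (pl k)) * d"
    by (rule length_concat_uniform) (auto simp: point_words_def)
  then show ?thesis by simp
qed

lemma concat_mem: "concat (map mem [0..<m]) = concat (map X ix)"
  by (rule concat_map_concat)

lemma sum_mem: "(\<Sum>k<m. length (mem k)) = n * d"
proof -
  have "(\<Sum>k<m. length (mem k)) = d * (\<Sum>k<m. length (pl k))" by (simp only: length_mem sum_distrib_left)
  also have "(\<Sum>k<m. length (pl k)) = length ix"
    by (simp add: length_concat o_def interv_sum_list_conv_sum_set_nat atLeast0LessThan)
  finally show ?thesis using length_ix by simp
qed

lemma chunks_mem: "chunks d (concat (map X l)) = map X l"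
  using d by (intro chunks_concat) (auto simp: point_words_def)

lemma init: "mpc_init P x pl = (\<lambda>k. if k < m then (mem k, []) else ([], []))"
  by (intro ext) (simp add: mpc_init_def point_words_def[abs_def])

lemma n\<alpha>: "1 \<le> real n powr \<alpha>"
  using n \<alpha> by (simp add: ge_one_powr_ge_zero)

lemma T_pos: "T > 0"
  using accuracy_bounds(3)[OF \<epsilon>] by (simp add: slot_count_def num_slots_def)

lemma space_ge: "(4 * \<kappa> + 22) * (real T * real d * real n powr \<alpha>) \<le> real s"
proof -
  have "(4 * \<kappa> + 22) * (real T * real d * real n powr \<alpha>) \<le>
    (4 * \<kappa> + 22) * ((9 * 21 ^ 8 * (1 / \<epsilon>) ^ 8) * real d * real n powr \<alpha>)"
    using slot_count_le[OF \<epsilon>] \<kappa> by (intro mult_left_mono mult_right_mono) auto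
  also have "\<dots> = local_space_bound ((4 * \<kappa> + 22) * (9 * 21 ^ 8)) 8 \<epsilon> \<alpha> n d"
    by (simp add: local_space_bound_def)
  finally show ?thesis using s by linarith
qed

lemma space_ge': "(4 * \<kappa> + 22) * (real T * real d) \<le> real s"
proof -
  have "(4 * \<kappa> + 22) * (real T * real d * 1) \<le> (4 * \<kappa> + 22) * (real T * real d * real n powr \<alpha>)"
    using n\<alpha> \<kappa> by (intro mult_left_mono) auto
  then show ?thesis using space_ge by simp
qed

lemma m_pos: "m > 0"
proof (rule ccontr)
  assume "\<not> m > 0"
  then have "real n * real d \<le> 0" using ms by simp
  moreover have "real n * real d > 0" using n d by simp
  ultimately show False by linarith
qed

lemma s_pos: "s > 0"
proof (rule ccontr)
  assume "\<not> s > 0"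
  then have "real n * real d \<le> 0" using ms by simp
  moreover have "real n * real d > 0" using n d by simp
  ultimately show False by linarith
qed

lemma outcome_law:
  assumes "mpc_run A P x pl (mpc_rounds A P) = map_pmf (\<lambda>sh k. if k < m then (mem k, sh) else ([], [])) I"
    and "\<And>k sh. sh \<in> set_pmf I \<Longrightarrow> mpc_output A P k (mem k) sh = out_rows (\<rho> sh) (map X (pl k))"
  shows "mpc_outcome A P x pl = bind_pmf I (\<lambda>sh. Pi_pmf {..<n} (0, 0) (\<lambda>i. row_pmf (\<rho> sh (X i))))"
proof -
  have "mpc_outcome A P x pl = bind_pmf I (\<lambda>sh. map_pmf (collect_rows P pl)
    (Pi_pmf {..<m} [] (\<lambda>k. mpc_output A P k (mem k) sh)))"
    unfolding mpc_outcome_def assms(1) bind_map_pmf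
    by (intro bind_pmf_cong refl arg_cong2[where f = map_pmf] Pi_pmf_cong) auto
  also have "\<dots> = bind_pmf I (\<lambda>sh. map_pmf (collect_rows P pl)
    (Pi_pmf {..<m} [] (\<lambda>k. out_rows (\<rho> sh) (map X (pl k)))))"
    by (intro bind_pmf_cong refl arg_cong2[where f = map_pmf] Pi_pmf_cong assms(2))
  also have "\<dots> = bind_pmf I (\<lambda>sh. Pi_pmf {..<n} (0, 0) (\<lambda>i. row_pmf (\<rho> sh (X i))))"
    by (intro bind_pmf_cong refl collect_rows_law[OF pl]) auto
  finally show ?thesis .
qed

lemma outcome_rows:
  assumes "mpc_outcome A P x pl = bind_pmf I (\<lambda>sh. Pi_pmf {..<n} (0, 0) (\<lambda>i. row_pmf (\<rho> sh i)))"
    and "z \<in> set_pmf (mpc_outcome A P x pl)" "i < n"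
  shows "z i \<in> {(1, 0), (0, 1)}"
  using assms set_row_pmf by (fastforce simp: set_Pi_pmf PiE_dflt_def)

lemma outcome_expectation:
  assumes "mpc_outcome A P x pl = bind_pmf I (\<lambda>sh. Pi_pmf {..<n} (0, 0) (\<lambda>i. row_pmf (\<rho> sh i)))"
    and "finite (set_pmf I)" "\<And>sh i. \<bar>\<rho> sh i\<bar> \<le> 1"
  shows "\<E> (mpc_outcome A P x pl) (cut_cost p n d x) =
    (Dsum + \<E> I (\<lambda>sh. pair_energy p n d x (\<rho> sh))) / 4"
proof -
  have "\<E> (mpc_outcome A P x pl) (cut_cost p n d x) =
    \<E> I (\<lambda>sh. \<E> (Pi_pmf {..<n} (0, 0) (\<lambda>i. row_pmf (\<rho> sh i))) (cut_cost p n d x))"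
    unfolding assms(1) using assms(2)
    by (intro expectation_bind_finite finite_set_Pi_pmf finite_row_pmf) auto
  also have "\<dots> = \<E> I (\<lambda>sh. (Dsum + pair_energy p n d x (\<rho> sh)) / 4)"
    by (intro expectation_cong_pmf expectation_cut_cost p assms(3))
  also have "\<dots> = (Dsum + \<E> I (\<lambda>sh. pair_energy p n d x (\<rho> sh))) / 4"
    by (simp add: integrable_measure_pmf_finite[OF assms(2)])
  finally show ?thesis .
qed

text \<open>The entire input fits into one local memory, which bounds the number of machines by
  \<kappa>. So every machine can afford to send its points to all machines, and each computes the
  same optimal fractional cut.\<close>

lemma few_points:
  assumes few: "n < T"
  shows "mpc_rounds A P \<le> 8 * nat \<lceil>1 / \<alpha>\<rceil> + 1" "respects_mpc_limits A P x pl"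
    "total_space_le A P x pl (12 * \<kappa> * (real n * real d))"
    "\<And>z i. z \<in> set_pmf (mpc_outcome A P x pl) \<Longrightarrow> i < n \<Longrightarrow> z i \<in> {(1, 0), (0, 1)}"
    "\<E> (mpc_outcome A P x pl) (cut_cost p n d x) \<le> opt + \<epsilon> * Dsum"
proof -
  have rounds: "mpc_rounds A P = 1" using few by (simp add: cut_algorithm_def)
  have step: "mpc_step A P = (\<lambda>t k mem inb. return_pmf (mem, \<lambda>_. mem))" using few by (simp add: cut_algorithm_def)
  have nd: "real n * real d \<le> real T * real d" using few by (intro mult_right_mono) auto
  have nT: "0 \<le> real T * real d" by simp
  have "1 * (real T * real d) \<le> (4 * \<kappa> + 22) * (real T * real d)" using \<kappa> by (intro mult_right_mono) auto
  then have nds: "real n * real d \<le> real s" using space_ge' nd by linarith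
  then have "real n * real d / real s \<le> 1" using s_pos by simp
  then have "\<lceil>real n * real d / real s\<rceil> \<le> 1" by simp
  then have "\<kappa> * of_int \<lceil>real n * real d / real s\<rceil> \<le> \<kappa> * 1" using \<kappa> by (intro mult_left_mono) auto
  then have m\<kappa>: "real m \<le> \<kappa>" using m by linarith
  have "real (m * (n * d)) \<le> \<kappa> * (real T * real d)" using m\<kappa> nd by (simp add: mult_mono)
  also have "\<dots> \<le> (4 * \<kappa> + 22) * (real T * real d)" using \<kappa> by (intro mult_right_mono) auto
  finally have mnd: "m * (n * d) \<le> s" using space_ge' by linarith
  define c1 where "c1 = (\<lambda>k. if k < m then (mem k, concat (map X ix)) else ([], []))"
  have run0: "mpc_run A P x pl 0 = return_pmf (\<lambda>k. if k < m then (mem k, []) else ([], []))" by (simp add: init)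
  have run1: "mpc_run A P x pl 1 = return_pmf c1"
  proof -
    have "mpc_deliver P (\<lambda>k. if k < m then (mem k, \<lambda>_. mem k) else ([], \<lambda>_. [])) = c1"
    proof
      fix k
      have "concat (map (\<lambda>i. snd (if i < m then (mem i, \<lambda>_::nat. mem i) else ([], \<lambda>_. [])) k) [0..<m]) = concat (map mem [0..<m])"
        by (intro arg_cong[of _ _ concat] map_cong) auto
      then show "mpc_deliver P (\<lambda>k. if k < m then (mem k, \<lambda>_. mem k) else ([], \<lambda>_. [])) k = c1 k"
        by (simp add: mpc_deliver_def c1_def concat_mem)
    qed
    moreover have "Pi_pmf {..<m} ([], \<lambda>_. []) (\<lambda>k. mpc_step A P 0 k (fst (mpc_init P x pl k)) (snd (mpc_init P x pl k))) =
      return_pmf (\<lambda>k. if k < m then (mem k, \<lambda>_. mem k) else ([], \<lambda>_. []))"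
      by (subst Pi_pmf_cong[OF refl refl, of _ _ "\<lambda>k. return_pmf (mem k, \<lambda>_. mem k)"]) (auto simp: step init)
    ultimately show ?thesis by (simp add: bind_return_pmf)
  qed
  have t01: "t = 0 \<or> t = 1" if "t \<le> mpc_rounds A P" for t using that rounds by auto
  have lX: "length (concat (map X ix)) = n * d"
    using sum_mem concat_mem length_concat[of "map mem [0..<m]"]
    by (simp add: o_def interv_sum_list_conv_sum_set_nat atLeast0LessThan)
  have mem_le: "length (mem k) \<le> n * d" if "k < m" for k
    using sum_mem member_le_sum[of k "{..<m}" "\<lambda>k. length (mem k)"] that by simp
  have nds': "n * d \<le> s" using nds by (simp flip: of_nat_mult)
  show "mpc_rounds A P \<le> 8 * nat \<lceil>1 / \<alpha>\<rceil> + 1" by (simp add: rounds)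
  show "respects_mpc_limits A P x pl"
    unfolding respects_mpc_limits_def
  proof (intro conjI allI impI ballI)
    fix t c k assume t: "t \<le> mpc_rounds A P" and c: "c \<in> set_pmf (mpc_run A P x pl t)" and k: "k < num_machines P"
    have "fst (c k) = mem k \<and> (snd (c k) = [] \<or> snd (c k) = concat (map X ix))"
      using t01[OF t] c k run0 run1 by (auto simp: c1_def)
    then show "length (fst (c k)) \<le> local_space P" "length (snd (c k)) \<le> local_space P"
      using mem_le[of k] nds' k lX by auto
  next
    fix t c k z assume t: "t < mpc_rounds A P" and c: "c \<in> set_pmf (mpc_run A P x pl t)" and k: "k < num_machines P"
      and z: "z \<in> set_pmf (mpc_step A P t k (fst (c k)) (snd (c k)))"
    have ck: "fst (c k) = mem k" using t c k run0 rounds by auto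
    have z': "z = (mem k, \<lambda>_. mem k)" using z by (simp add: step ck)
    have "m * length (mem k) \<le> m * (n * d)" using mem_le k by (intro mult_left_mono) auto
    then have "m * length (mem k) \<le> s" using mnd by linarith
    moreover have "legal_words (word_length P) (set (fst (c k)) \<union> set (snd (c k))) (mem k @ concat (map (\<lambda>_. mem k) [0..<m]))"
    proof (rule legal_wordsI)
      show "ok_word (word_length P) u" if "u \<in> set (mem k @ concat (map (\<lambda>_. mem k) [0..<m]))" for u
        using that by (auto simp: point_words_def split: if_splits)
      show "Coord a \<in> set (fst (c k)) \<union> set (snd (c k))" if "Coord a \<in> set (mem k @ concat (map (\<lambda>_. mem k) [0..<m]))" for a
        using that unfolding ck by (auto split: if_splits)
    qed
    ultimately show "case z of (mem', out) \<Rightarrow> (\<Sum>l<num_machines P. length (out l)) \<le> local_space P \<and>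
      legal_words (word_length P) (set (fst (c k)) \<union> set (snd (c k))) (mem' @ concat (map out [0..<num_machines P]))"
      unfolding z' by simp
  qed
  show "total_space_le A P x pl (12 * \<kappa> * (real n * real d))"
    unfolding total_space_le_def
  proof (intro allI impI ballI)
    fix t c assume t: "t \<le> mpc_rounds A P" and c: "c \<in> set_pmf (mpc_run A P x pl t)"
    have "length (fst (c k)) + length (snd (c k)) \<le> length (mem k) + n * d" if "k < m" for k
      using t01[OF t] c that run0 run1 lX by (auto simp: c1_def)
    then have "(\<Sum>k<m. length (fst (c k)) + length (snd (c k))) \<le> (\<Sum>k<m. length (mem k) + n * d)"
      by (intro sum_mono) auto
    also have "\<dots> = n * d + m * (n * d)" by (simp only: sum.distrib sum_mem sum_constant card_lessThan of_nat_id)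
    finally have "real (\<Sum>k<m. length (fst (c k)) + length (snd (c k))) \<le> real (n * d + m * (n * d))"
      by (simp only: of_nat_le_iff)
    also have "\<dots> = (1 + real m) * (real n * real d)" by (simp add: algebra_simps)
    also have "\<dots> \<le> 12 * \<kappa> * (real n * real d)" using m\<kappa> \<kappa> by (intro mult_right_mono) auto
    finally show "real (\<Sum>k<num_machines P. length (fst (c k)) + length (snd (c k))) \<le> 12 * \<kappa> * (real n * real d)"
      by simp
  qed
  define \<rho> where "\<rho> = (\<lambda>sh. avg_rule (word_dist p d) (chunks d sh))"
  have out: "mpc_outcome A P x pl =
    bind_pmf (return_pmf (concat (map X ix))) (\<lambda>sh. Pi_pmf {..<n} (0, 0) (\<lambda>i. row_pmf (\<rho> sh (X i))))"
  proof (rule outcome_law)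
    show "mpc_run A P x pl (mpc_rounds A P) = map_pmf (\<lambda>sh k. if k < m then (mem k, sh) else ([], [])) (return_pmf (concat (map X ix)))"
      by (simp only: rounds run1 map_return_pmf c1_def)
    show "mpc_output A P k (mem k) sh = out_rows (\<rho> sh) (map X (pl k))" for k sh
      using few by (simp add: cut_algorithm_def chunks_mem \<rho>_def)
  qed
  show "z i \<in> {(1, 0), (0, 1)}" if "z \<in> set_pmf (mpc_outcome A P x pl)" "i < n" for z i
    by (rule outcome_rows[OF out that])
  obtain ys where ys: "\<And>i. i < n \<Longrightarrow> ys i = 1 \<or> ys i = (-1::real)" "opt = (Dsum + pair_energy p n d x ys) / 4"
    using Min_cut_cost_obtain by blast
  have "\<E> (mpc_outcome A P x pl) (cut_cost p n d x) =
    (Dsum + pair_energy p n d x (\<lambda>i. avg_rule (word_dist p d) (map X ix) (X i))) / 4"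
    by (subst outcome_expectation[OF out]) (auto simp: \<rho>_def avg_rule_bounds chunks_mem)
  also have "\<dots> \<le> opt" using avg_rule_optimal[OF ix ys(1), where p = p and d = d and x = x] ys(2) by simp
  also have "opt \<le> opt + \<epsilon> * Dsum" using \<epsilon> by (simp add: sum_nonneg lp_dist_nonneg)
  finally show "\<E> (mpc_outcome A P x pl) (cut_cost p n d x) \<le> opt + \<epsilon> * Dsum" .
qed

lemma many_points:
  assumes many: "T \<le> n"
  shows "mpc_rounds A P \<le> 8 * nat \<lceil>1 / \<alpha>\<rceil> + 1" "respects_mpc_limits A P x pl"
    "total_space_le A P x pl (12 * \<kappa> * (real n * real d))"
    "\<And>z i. z \<in> set_pmf (mpc_outcome A P x pl) \<Longrightarrow> i < n \<Longrightarrow> z i \<in> {(1, 0), (0, 1)}"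
    "\<E> (mpc_outcome A P x pl) (cut_cost p n d x) \<le> opt + \<epsilon> * Dsum"
proof -
  define b where "b = fan \<epsilon> P"
  define h where "h = depth \<epsilon> P"
  define l where "l = word_length P div 6"
  define len where "len = Suc (T * d)"
  define h0 where "h0 = nat \<lceil>1 / \<alpha>\<rceil>"
  let ?wt = "point_weight p n d T l"
  have Td: "1 \<le> T * d" using T_pos d by simp
  have len2: "real len \<le> 2 * (real T * real d)" using Td unfolding len_def by (simp flip: of_nat_mult)
  have lenpos: "real len > 0" unfolding len_def of_nat_0_less_iff by simp
  \<comment> \<open>Halving \<open>4 * \<kappa> + 22\<close> pays for
    \<open>len \<le> 2 * T * d\<close>, that is, for the header word of a message.\<close>
  have \<beta>: "(2 * \<kappa> + 11) * real n powr \<alpha> * real len \<le> real s"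
  proof -
    have "(2 * \<kappa> + 11) * real n powr \<alpha> * real len \<le> (2 * \<kappa> + 11) * real n powr \<alpha> * (2 * (real T * real d))"
      using len2 \<kappa> by (intro mult_left_mono) auto
    also have "\<dots> = (4 * \<kappa> + 22) * (real T * real d * real n powr \<alpha>)" by (simp add: algebra_simps)
    finally show ?thesis using space_ge by linarith
  qed
  have sdiv: "(2 * \<kappa> + 11) * real n powr \<alpha> - 1 \<le> real (s div len)"
  proof -
    have "(2 * \<kappa> + 11) * real n powr \<alpha> \<le> real s / real len" using \<beta> lenpos by (simp add: field_simps)
    also have "real s / real len \<le> real (s div len) + 1"
    proof -
      have "s < len + s div len * len" by (rule dividend_less_div_times) (simp add: len_def)
      then have "real s < real (len + s div len * len)" by (simp only: of_nat_less_iff)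
      then show ?thesis using lenpos by (simp add: divide_le_eq algebra_simps)
    qed
    finally show ?thesis by simp
  qed
  have nn: "(2 * \<kappa> + 11) * real n powr \<alpha> = 2 * \<kappa> * real n powr \<alpha> + 11 * real n powr \<alpha>" by (simp add: algebra_simps)
  have k1: "1 \<le> \<kappa> * real n powr \<alpha>" using mult_mono[of 1 \<kappa> 1 "real n powr \<alpha>"] \<kappa> n\<alpha> by simp
  have s4: "4 \<le> s div len"
  proof -
    have "real 4 \<le> real (s div len)" using sdiv nn k1 n\<alpha> by linarith
    then show ?thesis by (simp only: of_nat_le_iff)
  qed
  have b4: "b + 4 = s div len" using s4 by (simp add: b_def fan_def len_def)
  then have b_real: "real b = real (s div len) - 4" by linarith
  \<comment> \<open>The summand \<open>11 * n powr \<alpha>\<close> absorbs the floor of the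
    division and the four reserved messages.\<close>
  have b_ge: "2 * \<kappa> * real n powr \<alpha> \<le> real b" using sdiv nn n\<alpha> b_real by linarith
  then have b_pos: "b > 0" using k1 by (cases "b = 0") auto
  have bspace: "(b + 4) * len \<le> s" unfolding b4 by (rule div_times_less_eq_dividend)
  have len5: "5 * real len \<le> real s"
  proof -
    have "5 * len \<le> (b + 4) * len" using b_pos by (intro mult_right_mono) auto
    then have "5 * len \<le> s" using bspace by linarith
    then show ?thesis by (metis of_nat_le_iff of_nat_mult of_nat_numeral)
  qed
  have m_le: "real m \<le> \<kappa> * (real n * real d / real s + 1)"
  proof -
    have "of_int \<lceil>real n * real d / real s\<rceil> \<le> real n * real d / real s + 1" by linarith
    then have "\<kappa> * of_int \<lceil>real n * real d / real s\<rceil> \<le> \<kappa> * (real n * real d / real s + 1)"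
      using \<kappa> by (intro mult_left_mono) auto
    then show ?thesis using m by linarith
  qed
  have m2: "real m \<le> 2 * \<kappa> * real n"
  proof -
    have "real d \<le> real s"
    proof -
      have "1 * real d \<le> (4 * \<kappa> + 22) * real T * real d"
        using \<kappa> T_pos mult_mono[of 1 "4 * \<kappa> + 22" 1 "real T"] by (intro mult_right_mono) auto
      then show ?thesis using space_ge' by (simp add: mult.assoc)
    qed
    then have "real n * real d / real s \<le> real n"
      using s_pos by (simp add: divide_le_eq mult_left_mono)
    then have "\<kappa> * (real n * real d / real s + 1) \<le> \<kappa> * (real n + real n)"
      using \<kappa> n by (intro mult_left_mono add_mono) auto
    then show ?thesis using m_le by simp
  qed
  have h0: "h0 \<ge> 1" "1 \<le> \<alpha> * real h0"
  proof -
    have "1 / \<alpha> \<ge> 1" using \<alpha> by simp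
    then show "h0 \<ge> 1" unfolding h0_def by linarith
    have "1 / \<alpha> \<le> real h0" unfolding h0_def by linarith
    then show "1 \<le> \<alpha> * real h0" using \<alpha> by (simp add: field_simps)
  qed
  \<comment> \<open>There are at most \<open>2 * \<kappa> * n\<close> machines, and the
    \<open>h0\<close>-th power of \<open>2 * \<kappa> * n powr \<alpha>\<close> exceeds this as
    \<open>\<alpha> * h0 \<ge> 1\<close>. So the depth is at most the ceiling of 1 /
    \<alpha>.\<close>
  have mb: "m \<le> b ^ h0"
  proof -
    have "real m \<le> (2 * \<kappa>) ^ 1 * real n powr 1" using m2 n by simp
    also have "\<dots> \<le> (2 * \<kappa>) ^ h0 * real n powr (\<alpha> * real h0)"
      using \<kappa> n h0 by (intro mult_mono power_increasing powr_mono) auto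
    also have "\<dots> = (2 * \<kappa> * real n powr \<alpha>) ^ h0"
      using n by (simp add: power_mult_distrib powr_powr[symmetric] powr_realpow)
    also have "\<dots> \<le> real b ^ h0" using b_ge \<kappa> by (intro power_mono) auto
    finally show ?thesis by (metis of_nat_le_iff of_nat_power)
  qed
  have h: "0 < h" "m \<le> b ^ h"
    using LeastI[of "\<lambda>h. 0 < h \<and> num_machines P \<le> fan \<epsilon> P ^ h" h0] mb h0
    by (auto simp: h_def depth_def b_def)
  have hh0: "h \<le> h0"
    unfolding h_def depth_def using mb h0 by (intro Least_le) (auto simp: b_def)
  have rounds: "mpc_rounds A P = 2 * h * 4" using many by (simp add: cut_algorithm_def h_def)
  let ?\<Delta> = "aspect_ratio p n d x"
  have l: "2 * real n * ?\<Delta> \<le> 2 ^ l"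
    unfolding l_def P using word_length_ge[of \<epsilon> n d ?\<Delta>] \<epsilon> n d aspect_ratio_bounds(1) by simp
  have wl: "word_length P = 6 * l" by (simp add: l_def P word_length_bound_def)
  have n2: "2 * n \<le> 2 ^ l"
  proof -
    have "2 * real n * 1 \<le> 2 * real n * ?\<Delta>" using aspect_ratio_bounds(1) by (intro mult_left_mono) auto
    then have "real (2 * n) \<le> real (2 ^ l)" using l by simp
    then show ?thesis by (simp only: of_nat_le_iff)
  qed
  have PSix: "concat (map (\<lambda>k. map X (pl k)) [0..<m]) = map X ix" by (simp add: map_concat o_def)
  interpret R: tree P A b h T ?wt "\<lambda>k. map X (pl k)"
  proof
    show "0 < b" "0 < h" "num_machines P \<le> b ^ h" using b_pos h by simp_all
    show "0 < num_machines P" "0 < dimension P" using m_pos d by simp_all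
    show "mpc_step A P = tree_step b h (dimension P) T ?wt"
      using many by (simp add: cut_algorithm_def b_def h_def l_def)
    show "length q = dimension P" if "q \<in> set (map X (pl k))" for k q
      using that by (auto simp: point_words_def)
  qed
  have start_eq: "R.start = (\<lambda>sh k. if k < m then (mem k, sh) else ([], []))"
    by (intro ext) (simp add: R.start_def)
  interpret R: tree_limits P A b h T ?wt "\<lambda>k. map X (pl k)" 4 x pl
  proof
    show "mpc_init P x pl = R.start []" by (simp add: init start_eq)
    show "mpc_rounds A P = 2 * h * 4" by (rule rounds)
    show "(b + 4) * Suc (T * dimension P) \<le> local_space P" using bspace by (simp add: len_def)
    show "length (concat (map X (pl k))) \<le> local_space P" if "k < num_machines P" for k
      using pl_space[of k] that length_mem[of k] by simp
    show "(\<Sum>q\<leftarrow>concat (map (\<lambda>k. map X (pl k)) [0..<num_machines P]). ?wt j sh q) < 2 ^ word_length P" for j sh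
    proof -
      \<comment> \<open>There are \<open>n < 2 ^ l\<close> weights, each capped at
        \<open>2 ^ (4 * l)\<close>, so totals have fewer than \<open>5 * l\<close> bits plus one and
        fit into words of \<open>6 * l\<close> bits.\<close>
      have "(\<Sum>q\<leftarrow>map X ix. ?wt j sh q) \<le> (\<Sum>q\<leftarrow>map X ix. 2 ^ (4 * l))"
        by (intro sum_list_mono) (simp add: point_weight_def)
      also have "\<dots> = n * 2 ^ (4 * l)" using length_ix by (simp add: sum_list_triv o_def)
      also have "\<dots> < 2 ^ l * 2 ^ (4 * l)" using n2 n by (intro mult_strict_right_mono) auto
      also have "\<dots> = 2 ^ (5 * l)" by (simp flip: power_add)
      also have "\<dots> \<le> 2 ^ (6 * l)" by (intro power_increasing) auto
      finally show ?thesis by (simp only: PSix sel wl)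
    qed
    show "\<exists>a. u = Coord a" if "q \<in> set (map X (pl k))" "u \<in> set q" for k q u
      using that by (auto simp: point_words_def)
  qed
  show "mpc_rounds A P \<le> 8 * nat \<lceil>1 / \<alpha>\<rceil> + 1" using hh0 by (simp add: rounds h0_def)
  show "respects_mpc_limits A P x pl" by (rule R.respects_limits)
  show "total_space_le A P x pl (12 * \<kappa> * (real n * real d))"
    unfolding total_space_le_def
  proof (intro allI impI ballI)
    fix t c assume t: "t \<le> mpc_rounds A P" and c: "c \<in> set_pmf (mpc_run A P x pl t)"
    have "(\<Sum>k<m. length (fst (c k)) + length (snd (c k))) \<le> n * d + m * (5 * len)"
      using R.total_space[OF t c] length_ix unfolding sel PSix by (simp add: len_def)
    then have "real (\<Sum>k<m. length (fst (c k)) + length (snd (c k))) \<le> real (n * d + m * (5 * len))"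
      by (simp only: of_nat_le_iff)
    also have "\<dots> = real n * real d + real m * (5 * real len)" by simp
    also have "\<dots> \<le> real n * real d + \<kappa> * (real n * real d / real s + 1) * (5 * real len)"
      using m_le lenpos by (intro add_left_mono mult_right_mono) auto
    also have "\<dots> = real n * real d + \<kappa> * (real n * real d) * (5 * real len / real s) + 5 * \<kappa> * real len"
      by (simp add: algebra_simps)
    \<comment> \<open>The machines counted by \<open>n * d / s\<close> pay for their messages since
      \<open>5 * len \<le> s\<close>. The one from rounding up pays by \<open>T \<le> n\<close>,
      which makes a message no longer than twice the input.\<close>
    also have "\<dots> \<le> real n * real d + \<kappa> * (real n * real d) * 1 + 5 * \<kappa> * (2 * (real n * real d))"
    proof (intro add_mono mult_left_mono order_refl)
      show "5 * real len / real s \<le> 1" using len5 s_pos by simp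
      have "real T * real d \<le> real n * real d" using many by (intro mult_right_mono) auto
      then show "real len \<le> 2 * (real n * real d)" using len2 by linarith
    qed (use \<kappa> in auto)
    also have "\<dots> = (1 + 11 * \<kappa>) * (real n * real d)" by (simp add: algebra_simps)
    also have "\<dots> \<le> 12 * \<kappa> * (real n * real d)" using \<kappa> by (intro mult_right_mono) auto
    finally show "real (\<Sum>k<num_machines P. length (fst (c k)) + length (snd (c k))) \<le> 12 * \<kappa> * (real n * real d)"
      by simp
  qed
  let ?L = "accuracy \<epsilon>"
  let ?\<rho> = "shared_rule p n d T l ?L"
  have "mpc_run A P x pl (2 * h * 4 + 0) = bind_pmf (R.ideal 4) (\<lambda>sh. R.phase 4 sh 0)"
    by (rule R.run_phase[OF R.init]) simp
  then have run: "mpc_run A P x pl (mpc_rounds A P) = map_pmf (\<lambda>sh k. if k < m then (mem k, sh) else ([], [])) (R.ideal 4)"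
    unfolding rounds by (simp add: R.phase_def map_pmf_def start_eq)
  have out: "mpc_outcome A P x pl = bind_pmf (R.ideal 4) (\<lambda>sh. Pi_pmf {..<n} (0, 0) (\<lambda>i. row_pmf (?\<rho> sh (X i))))"
    using many by (intro outcome_law[OF run]) (simp add: cut_algorithm_def chunks_mem l_def)
  show "z i \<in> {(1, 0), (0, 1)}" if "z \<in> set_pmf (mpc_outcome A P x pl)" "i < n" for z i
    by (rule outcome_rows[OF out that])
  obtain ys where ys: "\<And>i. i < n \<Longrightarrow> ys i = 1 \<or> ys i = (-1::real)" "opt = (Dsum + pair_energy p n d x ys) / 4"
    using Min_cut_cost_obtain by blast
  interpret S: point_sampling p n d T l ?L x ?\<Delta> "map X ix" ys
  proof
    show "mset (map X ix) = mset (map X [0..<n])"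
    proof -
      have "mset ix = mset [0..<n]" using ix by (intro set_eq_iff_mset_eq_distinct[THEN iffD1]) auto
      then show ?thesis by simp
    qed
  qed (use p n accuracy_bounds(3)[OF \<epsilon>] aspect_ratio_bounds l ys(1) in \<open>auto simp: slot_count_def\<close>)
  have ideal4: "R.ideal 4 = bind_pmf (leaf_msg d T (?wt 0 []) (map X ix)) (\<lambda>M1. bind_pmf (leaf_msg d T (?wt 1 M1) (map X ix)) (\<lambda>M2.
      bind_pmf (leaf_msg d T (?wt 2 (M2 @ M1)) (map X ix)) (\<lambda>M3.
        map_pmf (\<lambda>M4. M4 @ M3 @ M2 @ M1) (leaf_msg d T (?wt 3 (M3 @ M2 @ M1)) (map X ix)))))"
    by (simp add: PSix eval_nat_numeral bind_map_pmf bind_assoc_pmf bind_return_pmf)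
  have fin4: "finite (set_pmf (R.ideal 4))" unfolding ideal4 by (auto simp: finite_leaf_msg)
  have rule_le: "\<bar>?\<rho> sh q\<bar> \<le> 1" for sh q unfolding shared_rule_def by (rule abs_sample_rule_le)
  have "\<E> (mpc_outcome A P x pl) (cut_cost p n d x) =
    (Dsum + \<E> (R.ideal 4) S.energy) / 4"
    unfolding S.energy_def[abs_def] by (rule outcome_expectation[OF out fin4 rule_le])
  also have "\<dots> \<le> (Dsum + (pair_energy p n d x ys + 72 / ?L * Dsum)) / 4"
    using S.expected_energy unfolding ideal4 by (intro divide_right_mono add_left_mono) auto
  also have "\<dots> = opt + 18 / ?L * Dsum" unfolding ys(2) by (simp add: add_divide_distrib)
  also have "\<dots> \<le> opt + \<epsilon> * Dsum"
  proof (intro add_left_mono mult_right_mono)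
    have "18 / \<epsilon> \<le> 20 / \<epsilon>" using \<epsilon> by (simp add: divide_right_mono)
    then have "18 / \<epsilon> \<le> ?L" using accuracy_bounds(1)[OF \<epsilon>] by linarith
    then show "18 / ?L \<le> \<epsilon>" using \<epsilon> accuracy_bounds(3)[OF \<epsilon>] by (simp add: field_simps)
  qed (simp add: sum_nonneg lp_dist_nonneg)
  finally show "\<E> (mpc_outcome A P x pl) (cut_cost p n d x) \<le> opt + \<epsilon> * Dsum" .
qed

end

theorem theorem3p1:
  fixes \<kappa> :: real
  assumes "\<kappa> \<ge> 1"
  shows "\<exists>(C\<^sub>s :: real) (c\<^sub>s :: nat) (C\<^sub>t :: real) (c\<^sub>t :: nat) (K :: real) (W :: nat) (R :: real \<Rightarrow> nat).
    C\<^sub>t \<ge> 1 \<and>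
    (\<forall>\<epsilon> p :: real. 0 < \<epsilon> \<and> \<epsilon> < 1 \<and> 1 \<le> p \<and> p \<le> 2 \<longrightarrow>
      (\<exists>A :: mpc_algorithm.
        \<forall>(\<alpha> :: real) (n :: nat) (d :: nat) (s :: nat) (m :: nat)
          (x :: nat \<Rightarrow> nat \<Rightarrow> real) (pl :: nat \<Rightarrow> nat list) (P :: mpc_params).
          0 < \<alpha> \<and> \<alpha> \<le> 1 \<and> 1 \<le> n \<and> 1 \<le> d \<and>
          real s \<ge> local_space_bound C\<^sub>s c\<^sub>s \<epsilon> \<alpha> n d \<and>
          real m * real s \<ge> total_space_bound C\<^sub>t c\<^sub>t \<epsilon> n d \<and>
          real m \<le> \<kappa> * of_int \<lceil>total_space_bound C\<^sub>t c\<^sub>t \<epsilon> n d / real s\<rceil> \<and>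
          P = \<lparr>num_points = n, dimension = d, num_machines = m, local_space = s,
               word_length = word_length_bound W \<epsilon> n d (aspect_ratio p n d x)\<rparr> \<and>
          valid_placement P pl
          \<longrightarrow>
          mpc_rounds A P \<le> R \<alpha> \<and>
          respects_mpc_limits A P x pl \<and>
          total_space_le A P x pl (K * total_space_bound C\<^sub>t c\<^sub>t \<epsilon> n d) \<and>
          (\<forall>z \<in> set_pmf (mpc_outcome A P x pl). \<forall>i<n. z i \<in> {(1, 0), (0, 1)}) \<and>
          measure_pmf.expectation (mpc_outcome A P x pl) (cut_cost p n d x)
            \<le> Min (cut_cost p n d x ` complete_cuts n)
               + \<epsilon> * (\<Sum>i<n. \<Sum>j<n. lp_dist p d (x i) (x j))))"
\<comment> \<open>With \<open>C\<^sub>t = 1\<close> and \<open>c\<^sub>t = 0\<close> the total space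
  bound is just \<open>n * d\<close>, and the factor \<open>12 * \<kappa>\<close> covers the
  inboxes. Word length factor 6 matches \<open>div 6\<close> in the algorithm. Eight rounds per
  level are four phases, each going up and down.\<close>
proof (rule exI[of _ "(4 * \<kappa> + 22) * (9 * 21 ^ 8)"], rule exI[of _ 8], rule exI[of _ 1], rule exI[of _ 0],
    rule exI[of _ "12 * \<kappa>"], rule exI[of _ 6], rule exI[of _ "\<lambda>\<alpha>. 8 * nat \<lceil>1 / \<alpha>\<rceil> + 1"],
    intro conjI allI impI, goal_cases)
  case (2 \<epsilon> p)
  have tsb: "total_space_bound 1 0 \<epsilon> n d = real n * real d" for n d
    by (simp add: total_space_bound_def)
  show ?case
  proof (rule exI[of _ "cut_algorithm \<epsilon> p"], intro allI impI, goal_cases)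
    case (1 \<alpha> n d s m x pl P)
    interpret cut_instance \<kappa> \<epsilon> p \<alpha> n d s m x pl P
      by (unfold_locales; insert assms 2 1; unfold tsb; elim conjE; assumption)
    show ?case
      unfolding tsb using few_points many_points by (cases "n < slot_count \<epsilon>") auto
  qed
qed simp

end
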